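(* Let $s>0$. The boundary driven symmetric inclusion process (SIP) on $\mathbb{N}^V$ with generator $L=\sum_{i,j\in V}p(i,j)L_{ij}+\sum_{i\in V}c(i)L_i^{\alpha_i,\gamma_i}$ is Poisson intertwined with the boundary driven Brownian energy process (BEP) on $[0,\infty)^V$ with generator $$\mathcal{L}=\sum_{i,j\in V}p(i,j)\mathcal{L}_{ij}+\sum_{i\in V}c(i)\mathcal{L}_i^{\alpha_i,\gamma_i},$$ i.e. $\mathcal{G}L=\mathcal{L}\mathcal{G}$ for the Poisson intertwiner $\mathcal{G}f(\zeta)=\int f(\eta)\big(\bigotimes_{i\in V}\pi_{\zeta_i}\big)(d\eta)$. As a consequence, if the boundary driven SIP (semigroup $S(t)$) is started from the product of Poisson measures $\bigotimes_{i\in V}\pi_{\zeta_i}$, $\zeta\in[0,\infty)^V$, then $$\Big(\bigotimes_{i\in V}\pi_{\zeta_i}\Big)S(t)=\mathbb{E}_\zeta\Big(\bigotimes_{i\in V}\pi_{\zeta_i(t)}\Big),$$ where $\zeta(t)$ evolves according to the generator $\mathcal{L}$, started from $\zeta$. As a further consequence, the unique stationary measure of the boundary driven SIP is a mixture of products of Poisson measures $$\int\Big(\bigotimes_{i\in V}\pi_{\zeta_i}\Big)\,\Xi\Big(\prod_{i\in V}d\zeta_i\Big),$$ where $\Xi$ is the unique stationary measure of the process with generator $\mathcal{L}$.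
   Context: $\mathbb{N}=\{0,1,2,\dots\}$. $V$ is a finite set, $p(i,j)=p(j,i)\ge 0$ ($i,j\in V$) are symmetric edge weights which are irreducible: any two vertices are joined by a finite path along which $p>0$. Sums $\sum_{i,j}$ run over ordered pairs of distinct vertices. $c(i)\ge0$ are constants with $c(i)>0$ for at least one $i$; $\alpha_i,\gamma_i\ge0$ with $\alpha_i<\gamma_i$ for all $i\in V$. $\pi_z$ is the Poisson distribution with parameter $z\ge0$. SIP generators: $L_{ij}$ acts on $(\eta_i,\eta_j)=(n_1,n_2)$ as $$L_{ij}f(n_1,n_2)=n_1(2s+n_2)\big(f(n_1-1,n_2+1)-f(n_1,n_2)\big)+n_2(2s+n_1)\big(f(n_1+1,n_2-1)-f(n_1,n_2)\big);$$ $L_i^{\alpha,\gamma}$ acts on $\eta_i=n$ as $L^{\alpha,\gamma}f(n)=\alpha(2s+n)\big(f(n+1)-f(n)\big)+\gamma n\big(f(n-1)-f(n)\big)$. BEP generators, with $\partial_i=\partial/\partial\zeta_i$: $\mathcal{L}_{ij}=\zeta_i\zeta_j(\partial_i-\partial_j)^2-2s(\zeta_i-\zeta_j)(\partial_i-\partial_j)$, and $\mathcal{L}_i^{\alpha,\gamma}=\alpha\zeta_i\partial_i^2+\big(2s\alpha-(\gamma-\alpha)\zeta_i\big)\partial_i$. $\mathbb{E}_\zeta(\bigotimes_i\pi_{\zeta_i(t)})$ is the measure $A\mapsto\mathbb{E}_\zeta[(\bigotimes_i\pi_{\zeta_i(t)})(A)]$. The generator identity is understood for functions $f$ for which both sides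 are well defined. *)

theory Defs
  imports "HOL-Probability.Probability" "HOL-Probability.Product_PMF"
begin

section \<open>Markov processes with a given generator\<close>

text \<open>A time-homogeneous Markov process on \<open>M\<close> is given by its transition semigroup: \<open>P t x\<close> is the
  law at time \<open>t\<close> of the process started from \<open>x\<close>. Only times \<open>t \<ge> 0\<close> matter.\<close>

definition markov_semigroup :: "'a measure \<Rightarrow> (real \<Rightarrow> 'a \<Rightarrow> 'a measure) \<Rightarrow> bool" where
  "markov_semigroup M P \<longleftrightarrow>
     (\<forall>t\<ge>0. P t \<in> M \<rightarrow>\<^sub>M prob_algebra M) \<and>
     (\<forall>x\<in>space M. P 0 x = return M x) \<and>
     (\<forall>t\<ge>0. \<forall>u\<ge>0. \<forall>x\<in>space M. P (t + u) x = P t x \<bind> P u)"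

text \<open>The process has generator \<open>A\<close> on the class \<open>D\<close> of test functions if Dynkin's formula
  \<open>P\<^sub>t f = f + \<integral>\<^sub>0\<^sup>t P\<^sub>u (A f) du\<close> holds for \<open>f \<in> D\<close>. Together with the Markov property this says
  that the process solves the martingale problem for \<open>A\<close> on \<open>D\<close>.\<close>

definition has_generator ::
    "'a measure \<Rightarrow> ('a \<Rightarrow> real) set \<Rightarrow> (('a \<Rightarrow> real) \<Rightarrow> 'a \<Rightarrow> real) \<Rightarrow> (real \<Rightarrow> 'a \<Rightarrow> 'a measure) \<Rightarrow> bool"
  where
  "has_generator M D A P \<longleftrightarrow>
     markov_semigroup M P \<and>
     (\<forall>f\<in>D. \<forall>x\<in>space M. \<forall>t\<ge>0.
        ((\<lambda>u. \<integral>y. A f y \<partial>P u x) has_integral ((\<integral>y. f y \<partial>P t x) - f x)) {0..t})"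

definition stationary_measure ::
    "'a measure \<Rightarrow> (real \<Rightarrow> 'a \<Rightarrow> 'a measure) \<Rightarrow> 'a measure \<Rightarrow> bool" where
  "stationary_measure M P \<mu> \<longleftrightarrow> \<mu> \<in> space (prob_algebra M) \<and> (\<forall>t\<ge>0. \<mu> \<bind> P t = \<mu>)"


section \<open>The boundary driven symmetric inclusion process\<close>

text \<open>Where natural subtraction truncates (\<open>\<eta> i = 0\<close>), the jump rate vanishes.\<close>

definition sip_edge :: "real \<Rightarrow> 'v \<Rightarrow> 'v \<Rightarrow> (('v \<Rightarrow> nat) \<Rightarrow> real) \<Rightarrow> ('v \<Rightarrow> nat) \<Rightarrow> real" where
  "sip_edge s i j f \<eta> =
     real (\<eta> i) * (2 * s + real (\<eta> j)) * (f (\<eta>(i := \<eta> i - 1, j := \<eta> j + 1)) - f \<eta>)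
   + real (\<eta> j) * (2 * s + real (\<eta> i)) * (f (\<eta>(i := \<eta> i + 1, j := \<eta> j - 1)) - f \<eta>)"

definition sip_site :: "real \<Rightarrow> real \<Rightarrow> real \<Rightarrow> 'v \<Rightarrow> (('v \<Rightarrow> nat) \<Rightarrow> real) \<Rightarrow> ('v \<Rightarrow> nat) \<Rightarrow> real" where
  "sip_site s a g i f \<eta> =
     a * (2 * s + real (\<eta> i)) * (f (\<eta>(i := \<eta> i + 1)) - f \<eta>)
   + g * real (\<eta> i) * (f (\<eta>(i := \<eta> i - 1)) - f \<eta>)"

definition sip_generator ::
    "real \<Rightarrow> ('v::finite \<Rightarrow> 'v \<Rightarrow> real) \<Rightarrow> ('v \<Rightarrow> real) \<Rightarrow> ('v \<Rightarrow> real) \<Rightarrow> ('v \<Rightarrow> real)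
      \<Rightarrow> (('v \<Rightarrow> nat) \<Rightarrow> real) \<Rightarrow> ('v \<Rightarrow> nat) \<Rightarrow> real" where
  "sip_generator s p c \<alpha> \<gamma> f \<eta> =
     (\<Sum>i\<in>UNIV. \<Sum>j\<in>UNIV - {i}. p i j * sip_edge s i j f \<eta>)
   + (\<Sum>i\<in>UNIV. c i * sip_site s (\<alpha> i) (\<gamma> i) i f \<eta>)"

abbreviation sip_space :: "('v::finite \<Rightarrow> nat) measure" where
  "sip_space \<equiv> count_space UNIV"

text \<open>The rates are conservative and non-explosive, so finitely supported test functions determine
  the semigroup (forward equation).\<close>

definition sip_semigroup ::
    "real \<Rightarrow> ('v::finite \<Rightarrow> 'v \<Rightarrow> real) \<Rightarrow> ('v \<Rightarrow> real) \<Rightarrow> ('v \<Rightarrow> real) \<Rightarrow> ('v \<Rightarrow> real)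
      \<Rightarrow> (real \<Rightarrow> ('v \<Rightarrow> nat) \<Rightarrow> ('v \<Rightarrow> nat) measure) \<Rightarrow> bool" where
  "sip_semigroup s p c \<alpha> \<gamma> S \<longleftrightarrow>
     has_generator sip_space {f. finite {\<eta>. f \<eta> \<noteq> 0}} (sip_generator s p c \<alpha> \<gamma>) S"


section \<open>The boundary driven Brownian energy process\<close>

definition orthant :: "('v \<Rightarrow> real) set" where
  "orthant = {\<zeta>. \<forall>i. 0 \<le> \<zeta> i}"

text \<open>Functions on the orthant are represented by functions on the whole space, of which only the
  values on the orthant matter: partial derivatives are one-sided at the boundary.\<close>

definition pderivative :: "'v \<Rightarrow> (('v \<Rightarrow> real) \<Rightarrow> real) \<Rightarrow> ('v \<Rightarrow> real) \<Rightarrow> real" where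
  "pderivative i f \<zeta> = vector_derivative (\<lambda>x. f (\<zeta>(i := x))) (at (\<zeta> i) within {0..})"

definition C1_orthant :: "(('v::finite \<Rightarrow> real) \<Rightarrow> real) \<Rightarrow> bool" where
  "C1_orthant f \<longleftrightarrow> continuous_on orthant f \<and>
     (\<forall>i. (\<forall>\<zeta>\<in>orthant. (\<lambda>x. f (\<zeta>(i := x))) differentiable (at (\<zeta> i) within {0..})) \<and>
          continuous_on orthant (pderivative i f))"

definition C2_orthant :: "(('v::finite \<Rightarrow> real) \<Rightarrow> real) \<Rightarrow> bool" where
  "C2_orthant f \<longleftrightarrow> C1_orthant f \<and> (\<forall>i. C1_orthant (pderivative i f))"

definition bep_test_functions :: "(('v::finite \<Rightarrow> real) \<Rightarrow> real) set" where
  "bep_test_functions =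
     {f. C2_orthant f \<and> (\<exists>R. \<forall>\<zeta>\<in>orthant. f \<zeta> \<noteq> 0 \<longrightarrow> (\<forall>i. \<zeta> i \<le> R))}"

definition pdifference :: "'v \<Rightarrow> 'v \<Rightarrow> (('v \<Rightarrow> real) \<Rightarrow> real) \<Rightarrow> ('v \<Rightarrow> real) \<Rightarrow> real" where
  "pdifference i j f \<zeta> = pderivative i f \<zeta> - pderivative j f \<zeta>"

definition bep_edge :: "real \<Rightarrow> 'v \<Rightarrow> 'v \<Rightarrow> (('v \<Rightarrow> real) \<Rightarrow> real) \<Rightarrow> ('v \<Rightarrow> real) \<Rightarrow> real" where
  "bep_edge s i j f \<zeta> =
     \<zeta> i * \<zeta> j * pdifference i j (pdifference i j f) \<zeta>
   - 2 * s * (\<zeta> i - \<zeta> j) * pdifference i j f \<zeta>"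

definition bep_site :: "real \<Rightarrow> real \<Rightarrow> real \<Rightarrow> 'v \<Rightarrow> (('v \<Rightarrow> real) \<Rightarrow> real) \<Rightarrow> ('v \<Rightarrow> real) \<Rightarrow> real" where
  "bep_site s a g i f \<zeta> =
     a * \<zeta> i * pderivative i (pderivative i f) \<zeta>
   + (2 * s * a - (g - a) * \<zeta> i) * pderivative i f \<zeta>"

definition bep_generator ::
    "real \<Rightarrow> ('v::finite \<Rightarrow> 'v \<Rightarrow> real) \<Rightarrow> ('v \<Rightarrow> real) \<Rightarrow> ('v \<Rightarrow> real) \<Rightarrow> ('v \<Rightarrow> real)
      \<Rightarrow> (('v \<Rightarrow> real) \<Rightarrow> real) \<Rightarrow> ('v \<Rightarrow> real) \<Rightarrow> real" where
  "bep_generator s p c \<alpha> \<gamma> f \<zeta> =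
     (\<Sum>i\<in>UNIV. \<Sum>j\<in>UNIV - {i}. p i j * bep_edge s i j f \<zeta>)
   + (\<Sum>i\<in>UNIV. c i * bep_site s (\<alpha> i) (\<gamma> i) i f \<zeta>)"

definition bep_space :: "('v::finite \<Rightarrow> real) measure" where
  "bep_space = restrict_space borel orthant"

definition bep_semigroup ::
    "real \<Rightarrow> ('v::finite \<Rightarrow> 'v \<Rightarrow> real) \<Rightarrow> ('v \<Rightarrow> real) \<Rightarrow> ('v \<Rightarrow> real) \<Rightarrow> ('v \<Rightarrow> real)
      \<Rightarrow> (real \<Rightarrow> ('v \<Rightarrow> real) \<Rightarrow> ('v \<Rightarrow> real) measure) \<Rightarrow> bool" where
  "bep_semigroup s p c \<alpha> \<gamma> K \<longleftrightarrow>
     has_generator bep_space bep_test_functions (bep_generator s p c \<alpha> \<gamma>) K"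


section \<open>Products of Poisson measures and the Poisson intertwiner\<close>

text \<open>\<^const>\<open>poisson_pmf\<close> is only specified for positive rates.\<close>

definition poisson :: "real \<Rightarrow> nat pmf" where
  "poisson z = (if z = 0 then return_pmf 0 else poisson_pmf z)"

definition poisson_product :: "('v::finite \<Rightarrow> real) \<Rightarrow> ('v \<Rightarrow> nat) measure" where
  "poisson_product \<zeta> = measure_pmf (Pi_pmf UNIV 0 (\<lambda>i. poisson (\<zeta> i)))"

definition poisson_intertwiner ::
    "(('v::finite \<Rightarrow> nat) \<Rightarrow> real) \<Rightarrow> ('v \<Rightarrow> real) \<Rightarrow> real" where
  "poisson_intertwiner f \<zeta> = (\<integral>\<eta>. f \<eta> \<partial>poisson_product \<zeta>)"

text \<open>The measure \<open>A \<mapsto> \<integral> (\<Otimes>\<^sub>i \<pi>\<^bsub>\<zeta> i\<^esub>)(A) \<Xi>(d\<zeta>)\<close>.\<close>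

definition poisson_mixture :: "('v::finite \<Rightarrow> real) measure \<Rightarrow> ('v \<Rightarrow> nat) measure" where
  "poisson_mixture \<Xi> = \<Xi> \<bind> poisson_product"

end

theory Submission
  imports Defs
begin

text \<open>
  The intertwiner turns \<open>\<partial>\<^sub>i\<close> into the difference \<open>f \<mapsto> f(\<cdot> + e\<^sub>i) - f\<close> and multiplication by \<open>\<zeta>\<^sub>i\<close> into
  \<open>f \<mapsto> \<eta>\<^sub>i f(\<cdot> - e\<^sub>i)\<close>, so the generator identity is an algebraic identity for these operators.

  For the semigroups, approximate \<open>exp (- \<bar>\<zeta>\<bar>)\<close> by \<open>(1 - \<bar>\<zeta>\<bar>/n)\<^sub>+\<^sup>n\<close>: Dynkin's formula for the BEP extends to
  \<open>\<zeta> \<mapsto> (\<Otimes>\<^sub>i \<pi>\<^bsub>\<zeta> i\<^esub>){\<eta>}\<close>, so the Poisson mixture of the law of \<open>\<zeta>(t)\<close> solves the forward equation of the SIP.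
  That equation has only one solution by Kato's inequality for the difference of two solutions, cut off
  in the number of particles: exchanges conserve this number and the boundary rates are linear in it.

  Two stationary laws of the SIP coincide because every configuration leads to the empty one, and
  Poisson mixtures determine their mixing measure (Laplace transform), which gives uniqueness for the
  BEP. For existence, average the laws of \<open>\<zeta>(k)\<close>, \<open>k \<le> n\<close>, started from \<open>0\<close>. A linear Lyapunov function
  makes the corresponding SIP laws tight, and compactness of measures on a cube (reduced to Helly's
  theorem on the line by Schoenberg's space-filling curve) yields a limit \<open>\<Xi>\<close>, whose Poisson mixture is
  invariant by Fatou's lemma; injectivity carries the invariance back to \<open>\<Xi>\<close>.
\<close>

section \<open>Poisson products and the intertwiner\<close>

text \<open>Both processes are known only through Dynkin's formula for compactly or finitely
  supported functions: no moments and no Feller property are given. Two obstacles follow. The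
  exchange rates of the SIP are quadratic, so the rates admit no linear bound in the number of
  particles. But exchanges leave functions of the total number of particles unchanged, just as
  \<open>\<partial>_i - \<partial>_j\<close> annihilates functions of the total mass; hence every
  cut-off below is a function of the total and meets only the boundary terms. Second, a weak limit
  of BEP laws cannot be shown invariant directly, since \<open>K t\<close> is not known to preserve
  continuous functions. On the SIP side the space is countable and convergence means convergence of
  point masses, so the limit is studied there. Working with the single kernel \<open>S 1\<close>
  suffices: its invariant law is unique, and \<open>S t\<close> commutes with \<open>S 1\<close>,
  hence fixes that law.\<close>

definition pow_fact :: "('v::finite \<Rightarrow> real) \<Rightarrow> ('v \<Rightarrow> nat) \<Rightarrow> real" where
  "pow_fact \<zeta> \<eta> = (\<Prod>i\<in>UNIV. \<zeta> i ^ \<eta> i / fact (\<eta> i))"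

definition poisson_density :: "('v::finite \<Rightarrow> real) \<Rightarrow> ('v \<Rightarrow> nat) \<Rightarrow> real" where
  "poisson_density \<zeta> \<eta> = pow_fact \<zeta> \<eta> * exp (- (\<Sum>i\<in>UNIV. \<zeta> i))"

text \<open>Demanded at every rate rather than at one: this makes the class stable under the shift
  \<open>raise\<close>, whose integrability at \<open>\<zeta>\<close> comes from that of
  \<open>f\<close> at a larger rate.\<close>

definition poisson_integrable :: "(('v::finite \<Rightarrow> nat) \<Rightarrow> real) \<Rightarrow> bool" where
  "poisson_integrable f \<longleftrightarrow> (\<forall>\<zeta>\<in>orthant. integrable (poisson_product \<zeta>) f)"

lemma orthantD: "\<zeta> \<in> orthant \<Longrightarrow> 0 \<le> \<zeta> i"
  by (simp add: orthant_def)

lemma orthant_upd: "\<zeta> \<in> orthant \<Longrightarrow> 0 \<le> x \<Longrightarrow> \<zeta>(i := x) \<in> orthant"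
  by (simp add: orthant_def)

lemma pow_fact_nonneg: "\<zeta> \<in> orthant \<Longrightarrow> 0 \<le> pow_fact \<zeta> \<eta>"
  by (auto simp: pow_fact_def orthant_def intro!: prod_nonneg)

lemma poisson_density_nonneg: "\<zeta> \<in> orthant \<Longrightarrow> 0 \<le> poisson_density \<zeta> \<eta>"
  by (simp add: poisson_density_def pow_fact_nonneg)

lemma pmf_poisson_product:
  assumes "\<zeta> \<in> orthant"
  shows "pmf (Pi_pmf UNIV 0 (\<lambda>i. poisson (\<zeta> i))) \<eta> = poisson_density \<zeta> \<eta>"
proof -
  have "pmf (poisson z) k = z ^ k / fact k * exp (- z)" if "0 \<le> z" for z k
    using that by (auto simp: poisson_def power_0_left)
  then have "pmf (Pi_pmf UNIV 0 (\<lambda>i. poisson (\<zeta> i))) \<eta>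
      = (\<Prod>i\<in>UNIV. \<zeta> i ^ \<eta> i / fact (\<eta> i) * exp (- \<zeta> i))"
    using assms by (subst pmf_Pi') (auto simp: orthant_def)
  then show ?thesis
    by (simp only: poisson_density_def pow_fact_def prod.distrib exp_sum[OF finite, symmetric] sum_negf)
qed

lemma poisson_product_density:
  assumes "\<zeta> \<in> orthant"
  shows "poisson_product \<zeta> = density (count_space UNIV) (\<lambda>\<eta>. ennreal (poisson_density \<zeta> \<eta>))"
  by (simp add: poisson_product_def measure_pmf_eq_density pmf_poisson_product[OF assms])

lemma integrable_poisson_product:
  assumes "\<zeta> \<in> orthant"
  shows "integrable (poisson_product \<zeta>) f
    \<longleftrightarrow> integrable (count_space UNIV) (\<lambda>\<eta>. f \<eta> * poisson_density \<zeta> \<eta>)"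
  by (simp add: poisson_product_density[OF assms] integrable_density
      poisson_density_nonneg[OF assms] mult.commute)

lemma integral_poisson_product:
  assumes "\<zeta> \<in> orthant"
  shows "poisson_intertwiner f \<zeta> = (\<integral>\<eta>. f \<eta> * poisson_density \<zeta> \<eta> \<partial>count_space UNIV)"
  by (simp add: poisson_intertwiner_def poisson_product_density[OF assms] integral_density
      poisson_density_nonneg[OF assms] mult.commute)

text \<open>For fixed \<open>\<zeta>\<close> the exponential is a constant factor, so integrability
  at different rates is compared through the monomials \<open>pow_fact\<close> alone.\<close>

lemma integrable_poisson_product':
  assumes "\<zeta> \<in> orthant"
  shows "integrable (poisson_product \<zeta>) f
    \<longleftrightarrow> integrable (count_space UNIV) (\<lambda>\<eta>. f \<eta> * pow_fact \<zeta> \<eta>)"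
  by (simp add: integrable_poisson_product[OF assms] poisson_density_def mult.assoc[symmetric])

text \<open>Adding a particle at \<open>i\<close> is a bijection onto the configurations with
  \<open>\<eta> i \<noteq> 0\<close>. This is the summation by parts behind \<open>lower\<close> and
  behind the derivative of the intertwiner.\<close>

lemma
  fixes H :: "('v::finite \<Rightarrow> nat) \<Rightarrow> real"
  shows integrable_shift: "integrable (count_space UNIV) (\<lambda>\<eta>. H (\<eta>(i := \<eta> i + 1)))
      \<longleftrightarrow> integrable (count_space UNIV) (\<lambda>\<eta>. if \<eta> i = 0 then 0 else H \<eta>)" (is ?A)
    and integral_shift: "(\<integral>\<eta>. H (\<eta>(i := \<eta> i + 1)) \<partial>count_space UNIV)
      = (\<integral>\<eta>. (if \<eta> i = 0 then 0 else H \<eta>) \<partial>count_space UNIV)" (is ?B)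
proof -
  let ?S = "{\<eta> :: 'v \<Rightarrow> nat. \<eta> i \<noteq> 0}"
  have b: "bij_betw (\<lambda>\<eta>. \<eta>(i := \<eta> i + 1)) UNIV ?S"
    by (rule bij_betwI[where g = "\<lambda>\<eta>. \<eta>(i := \<eta> i - 1)"]) (auto simp: fun_eq_iff)
  have r: "count_space ?S = restrict_space (count_space UNIV) ?S"
    by (simp add: restrict_count_space)
  have e: "(\<lambda>\<eta>. if \<eta> i = 0 then 0 else H \<eta>) = (\<lambda>\<eta>. indicat_real ?S \<eta> *\<^sub>R H \<eta>)"
    by (auto simp: fun_eq_iff indicator_def)
  show ?A
    unfolding integrable_bij_count_space[OF b, of H] r e by (subst integrable_restrict_space) auto
  show ?B
    unfolding integral_bij_count_space[OF b, of H] r e by (subst integral_restrict_space) auto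
qed

lemma pow_fact_remove:
  fixes \<zeta> :: "'v::finite \<Rightarrow> real"
  shows "pow_fact \<zeta> \<eta> = \<zeta> i ^ \<eta> i / fact (\<eta> i) * (\<Prod>j\<in>UNIV - {i}. \<zeta> j ^ \<eta> j / fact (\<eta> j))"
  unfolding pow_fact_def by (subst prod.remove[of _ i]) auto

lemma pow_fact_Suc:
  "real (\<eta> i + 1) * pow_fact \<zeta> (\<eta>(i := \<eta> i + 1)) = \<zeta> i * pow_fact \<zeta> \<eta>"
proof -
  have "(\<Prod>j\<in>UNIV - {i}. \<zeta> j ^ (\<eta>(i := \<eta> i + 1)) j / fact ((\<eta>(i := \<eta> i + 1)) j))
      = (\<Prod>j\<in>UNIV - {i}. \<zeta> j ^ \<eta> j / fact (\<eta> j))"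
    by (intro prod.cong) auto
  then show ?thesis
    by (simp only: pow_fact_remove[of _ _ i] fun_upd_same)
      (simp add: field_simps del: of_nat_Suc)
qed

lemma poisson_density_Suc:
  "real (\<eta> i + 1) * poisson_density \<zeta> (\<eta>(i := \<eta> i + 1)) = \<zeta> i * poisson_density \<zeta> \<eta>"
  using pow_fact_Suc[of \<eta> i \<zeta>] by (simp add: poisson_density_def mult.assoc[symmetric])

definition lower :: "'v \<Rightarrow> (('v \<Rightarrow> nat) \<Rightarrow> real) \<Rightarrow> ('v \<Rightarrow> nat) \<Rightarrow> real" where
  "lower i f \<eta> = real (\<eta> i) * f (\<eta>(i := \<eta> i - 1))"

definition raise :: "'v \<Rightarrow> (('v \<Rightarrow> nat) \<Rightarrow> real) \<Rightarrow> ('v \<Rightarrow> nat) \<Rightarrow> real" where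
  "raise i f \<eta> = f (\<eta>(i := \<eta> i + 1))"

text \<open>Size-biasing of the Poisson law, \<open>(k + 1) \<pi>(k + 1) = z \<pi>(k)\<close>,
  summed after a shift. The configurations missed by the shift contribute nothing because
  \<open>lower\<close> carries the factor \<open>\<eta> i\<close>.\<close>

lemma
  fixes f :: "('v::finite \<Rightarrow> nat) \<Rightarrow> real"
  assumes "\<zeta> \<in> orthant" "integrable (poisson_product \<zeta>) f"
  shows integrable_lower: "integrable (poisson_product \<zeta>) (lower i f)" (is ?A)
    and intertwiner_lower: "poisson_intertwiner (lower i f) \<zeta> = \<zeta> i * poisson_intertwiner f \<zeta>" (is ?B)
proof -
  define H where "H \<eta> = lower i f \<eta> * poisson_density \<zeta> \<eta>" for \<eta>
  have H: "H (\<eta>(i := \<eta> i + 1)) = \<zeta> i * (f \<eta> * poisson_density \<zeta> \<eta>)" for \<eta>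
    using poisson_density_Suc[of \<eta> i \<zeta>] by (simp add: H_def lower_def ac_simps)
  have H0: "(if \<eta> i = 0 then 0 else H \<eta>) = H \<eta>" for \<eta>
    by (simp add: H_def lower_def)
  have i: "integrable (count_space UNIV) (\<lambda>\<eta>. f \<eta> * poisson_density \<zeta> \<eta>)"
    using assms by (simp add: integrable_poisson_product)
  show ?A
    using integrable_shift[of H i] i
    unfolding H H0 unfolding H_def integrable_poisson_product[OF assms(1)] by auto
  show ?B
    using integral_shift[of H i]
    unfolding H H0 unfolding H_def integral_poisson_product[OF assms(1)] by simp
qed

lemma poisson_integrable_lower: "poisson_integrable f \<Longrightarrow> poisson_integrable (lower i f)"
  by (simp add: poisson_integrable_def integrable_lower)

lemma poisson_integrable_raise:
  fixes f :: "('v::finite \<Rightarrow> nat) \<Rightarrow> real"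
  assumes "poisson_integrable f"
  shows "poisson_integrable (raise i f)"
  unfolding poisson_integrable_def
proof
  fix \<zeta> :: "'v \<Rightarrow> real" assume \<zeta>: "\<zeta> \<in> orthant"
  \<comment> \<open>Rates of at least 1 allow one more power of \<open>\<xi> i\<close>, and doubling
    the rate at \<open>i\<close> supplies \<open>2 ^ (\<eta> i + 1)\<close>, which absorbs the extra
    factor \<open>\<eta> i + 1\<close> of the larger factorial.\<close>
  define \<xi> where "\<xi> = (\<lambda>j. \<zeta> j + 1)"
  have \<xi>: "\<xi> \<in> orthant" "2 * \<xi> i > 0" "\<xi>(i := 2 * \<xi> i) \<in> orthant"
    using \<zeta> by (auto simp: orthant_def \<xi>_def add_nonneg_pos)
  have le: "pow_fact \<zeta> \<eta> \<le> pow_fact (\<xi>(i := 2 * \<xi> i)) (\<eta>(i := \<eta> i + 1))" for \<eta>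
  proof -
    have "\<zeta> i ^ \<eta> i \<le> \<xi> i ^ \<eta> i"
      using \<zeta> by (intro power_mono) (auto simp: \<xi>_def orthant_def)
    also have "\<dots> \<le> \<xi> i ^ (\<eta> i + 1)"
      using \<zeta> by (intro power_increasing) (auto simp: \<xi>_def orthant_def)
    finally have a: "\<zeta> i ^ \<eta> i \<le> \<xi> i ^ (\<eta> i + 1)" .
    have "real (\<eta> i + 1) \<le> 2 ^ (\<eta> i + 1)"
      using of_nat_less_two_power[of "\<eta> i + 1", where 'a = real] by linarith
    then have *: "\<zeta> i ^ \<eta> i * real (\<eta> i + 1) \<le> \<xi> i ^ (\<eta> i + 1) * 2 ^ (\<eta> i + 1)"
      using a \<zeta> by (intro mult_mono) (auto simp: orthant_def \<xi>_def)
    have 1: "\<zeta> i ^ \<eta> i / fact (\<eta> i) \<le> (2 * \<xi> i) ^ (\<eta> i + 1) / fact (\<eta> i + 1)"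
    proof -
      have "\<zeta> i ^ \<eta> i / fact (\<eta> i) = \<zeta> i ^ \<eta> i * real (\<eta> i + 1) / fact (\<eta> i + 1)"
      proof -
        have "z / w = z * r / (r * w)" if "r \<noteq> 0" for z w r :: real
          using that by simp
        then show ?thesis
          by (simp del: of_nat_Suc of_nat_add)
      qed
      also have "\<dots> \<le> \<xi> i ^ (\<eta> i + 1) * 2 ^ (\<eta> i + 1) / fact (\<eta> i + 1)"
        using * by (rule divide_right_mono) simp
      finally show ?thesis
        by (simp add: power_mult_distrib mult_ac)
    qed
    have 2: "(\<Prod>j\<in>UNIV - {i}. \<zeta> j ^ \<eta> j / fact (\<eta> j)) \<le> (\<Prod>j\<in>UNIV - {i}. \<xi> j ^ \<eta> j / fact (\<eta> j))"
      using \<zeta> by (intro prod_mono) (auto simp: orthant_def \<xi>_def intro!: divide_right_mono power_mono)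
    have "pow_fact \<zeta> \<eta> \<le> (2 * \<xi> i) ^ (\<eta> i + 1) / fact (\<eta> i + 1) * (\<Prod>j\<in>UNIV - {i}. \<xi> j ^ \<eta> j / fact (\<eta> j))"
      unfolding pow_fact_remove[of _ _ i]
      using 1 2 \<zeta> \<xi> by (intro mult_mono) (auto simp: orthant_def intro!: prod_nonneg)
    also have "\<dots> = pow_fact (\<xi>(i := 2 * \<xi> i)) (\<eta>(i := \<eta> i + 1))"
      unfolding pow_fact_remove[of _ _ i]
      by (intro arg_cong2[where f = "(*)"] prod.cong) auto
    finally show ?thesis .
  qed
  have "integrable (count_space UNIV) (\<lambda>\<eta>. f \<eta> * pow_fact (\<xi>(i := 2 * \<xi> i)) \<eta>)"
    using assms \<xi> unfolding poisson_integrable_def by (simp add: integrable_poisson_product'[symmetric])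
  then have "integrable (count_space UNIV) (\<lambda>\<eta>. if \<eta> i = 0 then 0 else f \<eta> * pow_fact (\<xi>(i := 2 * \<xi> i)) \<eta>)"
    by (rule Bochner_Integration.integrable_bound) auto
  then have "integrable (count_space UNIV)
      (\<lambda>\<eta>. f (\<eta>(i := \<eta> i + 1)) * pow_fact (\<xi>(i := 2 * \<xi> i)) (\<eta>(i := \<eta> i + 1)))"
    by (subst integrable_shift)
  then have "integrable (count_space UNIV) (\<lambda>\<eta>. raise i f \<eta> * pow_fact \<zeta> \<eta>)"
    by (rule Bochner_Integration.integrable_bound)
       (use le pow_fact_nonneg[OF \<zeta>] pow_fact_nonneg[OF \<xi>(3)] in
        \<open>auto simp: raise_def abs_mult intro!: mult_left_mono\<close>)
  then show "integrable (poisson_product \<zeta>) (raise i f)"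
    by (simp add: integrable_poisson_product'[OF \<zeta>])
qed

section \<open>Continuity and one-sided derivatives of the intertwiner\<close>

lemma at_within_atLeast_neq_bot: "0 \<le> x \<Longrightarrow> at x within {0::real..} \<noteq> bot"
proof -
  assume "0 \<le> x"
  then have "at_right x \<le> at x within {0..}"
    by (intro at_le) auto
  then show ?thesis
    using trivial_limit_at_right_real[of x] by (auto simp: bot.extremum_unique)
qed

lemma pderivative_eqI:
  assumes "\<zeta> \<in> orthant"
    and "((\<lambda>x. f (\<zeta>(i := x))) has_real_derivative D) (at (\<zeta> i) within {0..})"
  shows "pderivative i f \<zeta> = D"
  unfolding pderivative_def
  using assms at_within_atLeast_neq_bot[OF orthantD[OF assms(1), of i]]
  by (intro vector_derivative_within) (auto simp: has_real_derivative_iff_has_vector_derivative)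

lemma C1_orthantI:
  assumes "continuous_on orthant f"
    and "\<And>i. continuous_on orthant (f' i)"
    and "\<And>i \<zeta>. \<zeta> \<in> orthant \<Longrightarrow>
      ((\<lambda>x. f (\<zeta>(i := x))) has_real_derivative f' i \<zeta>) (at (\<zeta> i) within {0..})"
  shows "C1_orthant f"
proof -
  have "continuous_on orthant (pderivative i f)" for i
    using assms(2)[of i] pderivative_eqI[OF _ assms(3)]
    by (subst continuous_on_cong[where g = "f' i"]) auto
  then show ?thesis
    using assms(1,3) unfolding C1_orthant_def
    by (meson differentiableI has_field_derivative_imp_has_derivative)
qed

text \<open>Formulas for first derivatives are available on the orthant only. One-sided derivatives
  do not look outside it, so such formulas may be differentiated once more.\<close>

lemma derivative_orthant_cong:
  assumes "\<And>\<zeta>. \<zeta> \<in> orthant \<Longrightarrow> f \<zeta> = g \<zeta>" and "\<zeta> \<in> orthant"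
    and "((\<lambda>x. g (\<zeta>(i := x))) has_real_derivative D) (at (\<zeta> i) within {0..})"
  shows "((\<lambda>x. f (\<zeta>(i := x))) has_real_derivative D) (at (\<zeta> i) within {0..})"
  using assms(3)
  by (rule has_field_derivative_transform_within[where d = 1])
     (use assms in \<open>auto simp: orthant_upd orthantD\<close>)

text \<open>In the variable \<open>\<zeta> i\<close> this is the forward equation of a Poisson
  process with \<open>\<zeta> i\<close> as time.\<close>

lemma poisson_density_derivative:
  fixes \<zeta> :: "'v::finite \<Rightarrow> real"
  shows "((\<lambda>x. poisson_density (\<zeta>(i := x)) \<eta>) has_real_derivative
      (if \<eta> i = 0 then 0 else poisson_density (\<zeta>(i := x)) (\<eta>(i := \<eta> i - 1))) - poisson_density (\<zeta>(i := x)) \<eta>)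
    (at x within S)"
proof -
  define c where "c = (\<Prod>j\<in>UNIV - {i}. \<zeta> j ^ \<eta> j / fact (\<eta> j))"
  define d where "d = (\<Sum>j\<in>UNIV - {i}. \<zeta> j)"
  have e: "poisson_density (\<zeta>(i := y)) (\<eta>(i := k)) = c * y ^ k / fact k * exp (- (y + d))" for y k
  proof -
    have "(\<Prod>j\<in>UNIV - {i}. (\<zeta>(i := y)) j ^ (\<eta>(i := k)) j / fact ((\<eta>(i := k)) j)) = c"
      unfolding c_def by (intro prod.cong) auto
    moreover have "(\<Sum>j\<in>UNIV. (\<zeta>(i := y)) j) = y + d"
      by (subst sum.remove[of _ i]) (auto simp: d_def intro!: sum.cong)
    ultimately show ?thesis
      by (simp add: poisson_density_def pow_fact_remove[of _ _ i] mult_ac)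
  qed
  have e': "poisson_density (\<zeta>(i := y)) \<eta> = c * y ^ \<eta> i / fact (\<eta> i) * exp (- (y + d))" for y
    using e[of y "\<eta> i"] by simp
  show ?thesis
  proof (cases "\<eta> i")
    case 0
    then show ?thesis
      unfolding e' by (auto intro!: derivative_eq_intros)
  next
    case (Suc n)
    have "((\<lambda>x. c * x ^ Suc n / fact (Suc n) * exp (- (x + d))) has_real_derivative
        c * x ^ n / fact n * exp (- (x + d)) - c * x ^ Suc n / fact (Suc n) * exp (- (x + d))) (at x within S)"
      by (rule derivative_eq_intros refl | simp)+ (simp add: field_simps)
    then show ?thesis
      unfolding e e' by (simp add: Suc del: power_Suc fact_Suc)
  qed
qed

text \<open>Dropping the exponential gives one majorant for all rates up to \<open>R\<close>. It is
  still integrable against \<open>f\<close>, being proportional to the weights of constant rate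
  \<open>R\<close>.\<close>

lemma poisson_density_bound:
  assumes "\<zeta> \<in> orthant" "\<And>i. \<zeta> i \<le> R"
  shows "poisson_density \<zeta> \<eta> \<le> pow_fact (\<lambda>_. R) \<eta>"
proof -
  have "poisson_density \<zeta> \<eta> \<le> pow_fact \<zeta> \<eta> * 1"
    unfolding poisson_density_def using assms
    by (intro mult_left_mono) (auto simp: pow_fact_nonneg orthant_def intro!: sum_nonneg)
  also have "\<dots> \<le> pow_fact (\<lambda>_. R) \<eta>"
    unfolding pow_fact_def mult_1_right using assms
    by (intro prod_mono) (auto simp: orthant_def intro!: divide_right_mono power_mono)
  finally show ?thesis .
qed

lemma intertwiner_continuous:
  fixes f :: "('v::finite \<Rightarrow> nat) \<Rightarrow> real"
  assumes f: "poisson_integrable f"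
  shows "continuous_on orthant (poisson_intertwiner f)"
  unfolding continuous_on_sequentially
proof (intro allI ballI impI; elim conjE)
  fix X :: "nat \<Rightarrow> 'v \<Rightarrow> real" and \<zeta>
  assume \<zeta>: "\<zeta> \<in> orthant" and X: "\<forall>n. X n \<in> orthant" and lim: "X \<longlonglongrightarrow> \<zeta>"
  have limi: "(\<lambda>n. X n i) \<longlonglongrightarrow> \<zeta> i" for i
    using continuous_on_tendsto_compose[OF continuous_on_product_coordinates lim] by simp
  define R where "R = Max (range \<zeta>) + 1"
  have less_R: "\<zeta> i < R" for i
    unfolding R_def by (meson Max_ge finite_imageI finite_class.finite_UNIV less_add_one order_le_less_trans rangeI)
  have "\<forall>\<^sub>F n in sequentially. X n i \<le> R" for i
    using order_tendstoD(2)[OF limi[of i] less_R[of i]] by eventually_elim simp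
  then have ev: "\<forall>\<^sub>F n in sequentially. \<forall>i. X n i \<le> R"
    by (simp add: eventually_all_finite)
  have R: "(\<lambda>_. R) \<in> orthant"
    using \<zeta> less_R by (auto simp: orthant_def) (meson less_imp_le order_trans)
  from ev obtain N where N: "\<And>n i. n \<ge> N \<Longrightarrow> X n i \<le> R"
    by (auto simp: eventually_sequentially)
  have "(\<lambda>n. poisson_intertwiner f (X (n + N))) \<longlonglongrightarrow> poisson_intertwiner f \<zeta>"
    unfolding integral_poisson_product[OF \<zeta>] integral_poisson_product[OF X[rule_format]]
  proof (rule integral_dominated_convergence[where w = "\<lambda>\<eta>. \<bar>f \<eta>\<bar> * pow_fact (\<lambda>_. R) \<eta>"])
    show "integrable sip_space (\<lambda>\<eta>. \<bar>f \<eta>\<bar> * pow_fact (\<lambda>_. R) \<eta>)"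
      using f R unfolding poisson_integrable_def
      by (subst integrable_poisson_product'[OF R, symmetric]) auto
    show "AE \<eta> in sip_space. (\<lambda>n. f \<eta> * poisson_density (X (n + N)) \<eta>) \<longlonglongrightarrow> f \<eta> * poisson_density \<zeta> \<eta>"
      unfolding poisson_density_def pow_fact_def
      by (intro AE_I2 tendsto_intros LIMSEQ_ignore_initial_segment[OF limi]) auto
    show "AE \<eta> in sip_space. norm (f \<eta> * poisson_density (X (n + N)) \<eta>) \<le> \<bar>f \<eta>\<bar> * pow_fact (\<lambda>_. R) \<eta>" for n
      using N X by (intro AE_I2)
        (auto simp: abs_mult poisson_density_nonneg intro!: mult_left_mono poisson_density_bound)
  qed auto
  then show "(poisson_intertwiner f \<circ> X) \<longlonglongrightarrow> poisson_intertwiner f \<zeta>"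
    by (simp add: o_def LIMSEQ_offset)
qed

lemma intertwiner_derivative:
  fixes f :: "('v::finite \<Rightarrow> nat) \<Rightarrow> real"
  assumes f: "poisson_integrable f" and \<zeta>: "\<zeta> \<in> orthant"
  shows "((\<lambda>x. poisson_intertwiner f (\<zeta>(i := x))) has_real_derivative
      poisson_intertwiner (raise i f) \<zeta> - poisson_intertwiner f \<zeta>) (at (\<zeta> i) within {0..})"
  unfolding has_field_derivative_iff tendsto_at_iff_sequentially
proof (intro allI impI)
  fix X :: "nat \<Rightarrow> real"
  assume X: "\<forall>n. X n \<in> {0..} - {\<zeta> i}" and lim: "X \<longlonglongrightarrow> \<zeta> i"
  define R where "R = Max (range \<zeta>) + 1"
  have less_R: "\<zeta> j < R" for j
    unfolding R_def by (meson Max_ge finite_imageI finite_class.finite_UNIV less_add_one order_le_less_trans rangeI)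
  have R: "(\<lambda>_. R) \<in> orthant"
    using \<zeta> less_R by (auto simp: orthant_def) (meson less_imp_le order_trans)
  obtain N where N: "\<And>n. n \<ge> N \<Longrightarrow> X n \<le> R"
    using order_tendstoD(2)[OF lim less_R] by (auto simp: eventually_sequentially intro: less_imp_le)
  define Y where "Y n = X (n + N)" for n
  have Y: "Y n \<noteq> \<zeta> i" "0 \<le> Y n" "Y n \<le> R" for n
    using X N by (auto simp: Y_def)
  have limY: "Y \<longlonglongrightarrow> \<zeta> i"
    unfolding Y_def by (rule LIMSEQ_ignore_initial_segment[OF lim])
  define D where "D x \<eta> = (if \<eta> i = 0 then 0 else poisson_density (\<zeta>(i := x)) (\<eta>(i := \<eta> i - 1)))
      - poisson_density (\<zeta>(i := x)) \<eta>" for x \<eta>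
  define B where "B \<eta> = (if \<eta> i = 0 then 0 else pow_fact (\<lambda>_. R) (\<eta>(i := \<eta> i - 1)))
      + pow_fact (\<lambda>_. R) \<eta>" for \<eta>
  define q where "q n \<eta> = (poisson_density (\<zeta>(i := Y n)) \<eta> - poisson_density (\<zeta>(i := \<zeta> i)) \<eta>) / (Y n - \<zeta> i)" for n \<eta>
  have der: "((\<lambda>x. poisson_density (\<zeta>(i := x)) \<eta>) has_real_derivative D x \<eta>) (at x within S)" for x S \<eta>
    unfolding D_def by (rule poisson_density_derivative)
  have pb: "0 \<le> poisson_density (\<zeta>(i := x)) \<eta>" "poisson_density (\<zeta>(i := x)) \<eta> \<le> pow_fact (\<lambda>_. R) \<eta>"
    if "x \<in> {0..R}" for x \<eta>
    using that \<zeta> less_R[THEN less_imp_le]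
    by (auto intro!: poisson_density_nonneg poisson_density_bound orthant_upd)
  have DB: "\<bar>D x \<eta>\<bar> \<le> B \<eta>" if "x \<in> {0..R}" for x \<eta>
    using pb[OF that, of \<eta>] pb[OF that, of "\<eta>(i := \<eta> i - 1)"] by (auto simp: D_def B_def)
  have q_lim: "(\<lambda>n. q n \<eta>) \<longlonglongrightarrow> D (\<zeta> i) \<eta>" for \<eta>
    using der[of \<eta> "\<zeta> i" UNIV] limY Y unfolding q_def has_field_derivative_iff
    by (auto simp: tendsto_at_iff_sequentially o_def)
  have q_bound: "\<bar>q n \<eta>\<bar> \<le> B \<eta>" for n \<eta>
  proof -
    \<comment> \<open>The mean value inequality on \<open>{0..R}\<close> bounds the difference
      quotients by the majorant \<open>B\<close> of the derivative, uniformly in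
      \<open>n\<close>.\<close>
    have "norm (poisson_density (\<zeta>(i := Y n)) \<eta> - poisson_density (\<zeta>(i := \<zeta> i)) \<eta>) \<le> B \<eta> * norm (Y n - \<zeta> i)"
      using Y \<zeta> less_R
      by (intro field_differentiable_bound[where S = "{0..R}" and f' = "\<lambda>x. D x \<eta>"])
         (auto intro!: der DB simp: orthant_def less_imp_le simp del: fun_upd_apply)
    then show ?thesis
      using Y[of n] by (simp add: q_def abs_divide divide_le_eq)
  qed
  have int: "integrable sip_space (\<lambda>\<eta>. g \<eta> * poisson_density \<xi> \<eta>)" if "poisson_integrable g" "\<xi> \<in> orthant" for g \<xi>
    using that unfolding poisson_integrable_def by (subst integrable_poisson_product[symmetric]) auto
  have intp: "integrable sip_space (\<lambda>\<eta>. g \<eta> * pow_fact (\<lambda>_. R) \<eta>)" if "poisson_integrable g" for g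
    using that R unfolding poisson_integrable_def by (subst integrable_poisson_product'[OF R, symmetric]) auto
  have intB: "integrable sip_space (\<lambda>\<eta>. \<bar>f \<eta>\<bar> * B \<eta>)"
  proof -
    have "integrable sip_space (\<lambda>\<eta>. if \<eta> i = 0 then 0 else f \<eta> * pow_fact (\<lambda>_. R) (\<eta>(i := \<eta> i - 1)))"
      using intp[OF poisson_integrable_raise[OF f, of i]]
      by (subst integrable_shift[symmetric]) (simp add: raise_def)
    from Bochner_Integration.integrable_add[OF Bochner_Integration.integrable_abs[OF this] Bochner_Integration.integrable_abs[OF intp[OF f]]]
    show ?thesis
      by (rule Bochner_Integration.integrable_cong[THEN iffD1, rotated -1])
         (auto simp: B_def abs_mult algebra_simps pow_fact_nonneg[OF R])
  qed
  have "(\<lambda>n. \<integral>\<eta>. f \<eta> * q n \<eta> \<partial>sip_space) \<longlonglongrightarrow> (\<integral>\<eta>. f \<eta> * D (\<zeta> i) \<eta> \<partial>sip_space)"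
    by (rule integral_dominated_convergence[where w = "\<lambda>\<eta>. \<bar>f \<eta>\<bar> * B \<eta>"])
       (use intB q_bound in \<open>auto simp: abs_mult intro!: mult_left_mono tendsto_intros q_lim\<close>)
  also have "(\<lambda>n. \<integral>\<eta>. f \<eta> * q n \<eta> \<partial>sip_space)
      = (\<lambda>n. (poisson_intertwiner f (\<zeta>(i := Y n)) - poisson_intertwiner f (\<zeta>(i := \<zeta> i))) / (Y n - \<zeta> i))"
  proof
    fix n
    have o: "\<zeta>(i := Y n) \<in> orthant" "\<zeta>(i := \<zeta> i) \<in> orthant"
      using Y \<zeta> by (auto intro: orthant_upd)
    show "(\<integral>\<eta>. f \<eta> * q n \<eta> \<partial>sip_space)
      = (poisson_intertwiner f (\<zeta>(i := Y n)) - poisson_intertwiner f (\<zeta>(i := \<zeta> i))) / (Y n - \<zeta> i)"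
      unfolding integral_poisson_product[OF o(1)] integral_poisson_product[OF o(2)]
      unfolding Bochner_Integration.integral_diff[symmetric, OF int[OF f o(1)] int[OF f o(2)]]
        integral_divide_zero[symmetric] q_def
      by (simp only: right_diff_distrib times_divide_eq_right)
  qed
  also have "(\<integral>\<eta>. f \<eta> * D (\<zeta> i) \<eta> \<partial>sip_space)
      = poisson_intertwiner (raise i f) \<zeta> - poisson_intertwiner f \<zeta>"
  proof -
    \<comment> \<open>The density differentiates to its backward shift minus itself; reindexing
      moves the shift onto \<open>f\<close>, where it becomes \<open>raise i f\<close>.\<close>
    define H where "H \<eta> = f \<eta> * poisson_density \<zeta> (\<eta>(i := \<eta> i - 1))" for \<eta>
    have H: "H (\<eta>(i := \<eta> i + 1)) = raise i f \<eta> * poisson_density \<zeta> \<eta>" for \<eta>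
      by (simp add: H_def raise_def)
    have "integrable sip_space (\<lambda>\<eta>. H (\<eta>(i := \<eta> i + 1)))"
      unfolding H by (rule int[OF poisson_integrable_raise[OF f] \<zeta>])
    then have "integrable sip_space (\<lambda>\<eta>. if \<eta> i = 0 then 0 else H \<eta>)"
      by (subst (asm) integrable_shift)
    then have "(\<integral>\<eta>. (if \<eta> i = 0 then 0 else H \<eta>) - f \<eta> * poisson_density \<zeta> \<eta> \<partial>sip_space)
      = (\<integral>\<eta>. (if \<eta> i = 0 then 0 else H \<eta>) \<partial>sip_space) - poisson_intertwiner f \<zeta>"
      using int[OF f \<zeta>] by (subst Bochner_Integration.integral_diff) (auto simp: integral_poisson_product[OF \<zeta>])
    also have "(\<integral>\<eta>. (if \<eta> i = 0 then 0 else H \<eta>) \<partial>sip_space) = poisson_intertwiner (raise i f) \<zeta>"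
      unfolding integral_shift[symmetric] H integral_poisson_product[OF \<zeta>] ..
    also have "(\<lambda>\<eta>. (if \<eta> i = 0 then 0 else H \<eta>) - f \<eta> * poisson_density \<zeta> \<eta>) = (\<lambda>\<eta>. f \<eta> * D (\<zeta> i) \<eta>)"
      by (auto simp: fun_eq_iff D_def H_def algebra_simps)
    finally show ?thesis .
  qed
  finally show "((\<lambda>y. (poisson_intertwiner f (\<zeta>(i := y)) - poisson_intertwiner f (\<zeta>(i := \<zeta> i))) / (y - \<zeta> i)) \<circ> X)
    \<longlonglongrightarrow> poisson_intertwiner (raise i f) \<zeta> - poisson_intertwiner f \<zeta>"
    unfolding Y_def by - (rule LIMSEQ_offset[where k = N], simp only: o_def)
qed

definition delta :: "'v \<Rightarrow> (('v \<Rightarrow> nat) \<Rightarrow> real) \<Rightarrow> ('v \<Rightarrow> nat) \<Rightarrow> real" where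
  "delta i f \<eta> = raise i f \<eta> - f \<eta>"

lemma poisson_integrable_diff:
  "poisson_integrable f \<Longrightarrow> poisson_integrable g \<Longrightarrow> poisson_integrable (\<lambda>\<eta>. f \<eta> - g \<eta>)"
  by (simp add: poisson_integrable_def)

lemma poisson_integrable_delta: "poisson_integrable f \<Longrightarrow> poisson_integrable (delta i f)"
  unfolding delta_def by (intro poisson_integrable_diff poisson_integrable_raise)

lemma intertwiner_delta_derivative:
  fixes f :: "('v::finite \<Rightarrow> nat) \<Rightarrow> real"
  assumes f: "poisson_integrable f" and \<zeta>: "\<zeta> \<in> orthant"
  shows "((\<lambda>x. poisson_intertwiner f (\<zeta>(i := x))) has_real_derivative
      poisson_intertwiner (delta i f) \<zeta>) (at (\<zeta> i) within {0..})"
proof -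
  have "poisson_intertwiner (delta i f) \<zeta> = poisson_intertwiner (raise i f) \<zeta> - poisson_intertwiner f \<zeta>"
    using f poisson_integrable_raise[OF f, of i] \<zeta>
    unfolding poisson_intertwiner_def delta_def poisson_integrable_def
    by (intro Bochner_Integration.integral_diff) auto
  then show ?thesis
    using intertwiner_derivative[OF assms] by simp
qed

lemma pderivative_intertwiner:
  "poisson_integrable f \<Longrightarrow> \<zeta> \<in> orthant \<Longrightarrow>
    pderivative i (poisson_intertwiner f) \<zeta> = poisson_intertwiner (delta i f) \<zeta>"
  by (intro pderivative_eqI intertwiner_delta_derivative)

lemma C2_orthant_intertwiner:
  fixes f :: "('v::finite \<Rightarrow> nat) \<Rightarrow> real"
  assumes f: "poisson_integrable f"
  shows "C2_orthant (poisson_intertwiner f)"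
  unfolding C2_orthant_def
proof (intro conjI allI)
  show "C1_orthant (poisson_intertwiner f)"
    by (rule C1_orthantI[where f' = "\<lambda>i. poisson_intertwiner (delta i f)"])
       (auto intro: intertwiner_continuous intertwiner_delta_derivative poisson_integrable_delta f)
  fix i
  have d: "poisson_integrable (delta i f)"
    by (rule poisson_integrable_delta[OF f])
  show "C1_orthant (pderivative i (poisson_intertwiner f))"
  proof (rule C1_orthantI[where f' = "\<lambda>j. poisson_intertwiner (delta j (delta i f))"])
    show "continuous_on orthant (pderivative i (poisson_intertwiner f))"
      using intertwiner_continuous[OF d]
      by (subst continuous_on_cong[OF refl pderivative_intertwiner[OF f]]) auto
    show "continuous_on orthant (poisson_intertwiner (delta j (delta i f)))" for j
      by (intro intertwiner_continuous poisson_integrable_delta d)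
    show "((\<lambda>x. pderivative i (poisson_intertwiner f) (\<zeta>(j := x))) has_real_derivative
        poisson_intertwiner (delta j (delta i f)) \<zeta>) (at (\<zeta> j) within {0..})" if "\<zeta> \<in> orthant" for \<zeta> j
      by (rule derivative_orthant_cong[OF pderivative_intertwiner[OF f] that intertwiner_delta_derivative[OF d that]])
  qed
qed

lemma pderivative2_intertwiner:
  assumes "poisson_integrable f" "\<zeta> \<in> orthant"
  shows "pderivative j (pderivative i (poisson_intertwiner f)) \<zeta> = poisson_intertwiner (delta j (delta i f)) \<zeta>"
  using assms
  by (intro pderivative_eqI derivative_orthant_cong[OF pderivative_intertwiner] intertwiner_delta_derivative
      poisson_integrable_delta)

section \<open>The generator identity\<close>

lemma
  assumes "\<zeta> \<in> orthant" "poisson_integrable f" "poisson_integrable g"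
  shows intertwiner_diff: "poisson_intertwiner (\<lambda>\<eta>. f \<eta> - g \<eta>) \<zeta> = poisson_intertwiner f \<zeta> - poisson_intertwiner g \<zeta>"
    and intertwiner_add: "poisson_intertwiner (\<lambda>\<eta>. f \<eta> + g \<eta>) \<zeta> = poisson_intertwiner f \<zeta> + poisson_intertwiner g \<zeta>"
  using assms unfolding poisson_intertwiner_def poisson_integrable_def by auto

lemma intertwiner_cmult: "poisson_intertwiner (\<lambda>\<eta>. k * f \<eta>) \<zeta> = k * poisson_intertwiner f \<zeta>"
  unfolding poisson_intertwiner_def by simp

lemma intertwiner_sum:
  assumes "\<zeta> \<in> orthant" "\<And>i. i \<in> I \<Longrightarrow> poisson_integrable (f i)"
  shows "poisson_intertwiner (\<lambda>\<eta>. \<Sum>i\<in>I. f i \<eta>) \<zeta> = (\<Sum>i\<in>I. poisson_intertwiner (f i) \<zeta>)"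
  using assms unfolding poisson_intertwiner_def poisson_integrable_def
  by (intro Bochner_Integration.integral_sum) auto

lemma
  shows poisson_integrable_add: "poisson_integrable f \<Longrightarrow> poisson_integrable g \<Longrightarrow> poisson_integrable (\<lambda>\<eta>. f \<eta> + g \<eta>)"
    and poisson_integrable_cmult: "poisson_integrable f \<Longrightarrow> poisson_integrable (\<lambda>\<eta>. k * f \<eta>)"
    and poisson_integrable_sum: "(\<And>i. i \<in> I \<Longrightarrow> poisson_integrable (h i)) \<Longrightarrow> poisson_integrable (\<lambda>\<eta>. \<Sum>i\<in>I. h i \<eta>)"
  by (auto simp: poisson_integrable_def)

lemma intertwiner_lower_PI:
  "\<zeta> \<in> orthant \<Longrightarrow> poisson_integrable f \<Longrightarrow> poisson_intertwiner (lower i f) \<zeta> = \<zeta> i * poisson_intertwiner f \<zeta>"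
  by (simp add: poisson_integrable_def intertwiner_lower)

lemma intertwiner_delta:
  "\<zeta> \<in> orthant \<Longrightarrow> poisson_integrable f \<Longrightarrow>
    poisson_intertwiner (delta i f) \<zeta> = poisson_intertwiner (raise i f) \<zeta> - poisson_intertwiner f \<zeta>"
  unfolding delta_def[abs_def] by (intro intertwiner_diff poisson_integrable_raise)

lemma pdifference_intertwiner:
  assumes "poisson_integrable f" "\<zeta> \<in> orthant"
  shows "pdifference i j (poisson_intertwiner f) \<zeta> = poisson_intertwiner (\<lambda>\<eta>. raise i f \<eta> - raise j f \<eta>) \<zeta>"
  using assms
  by (simp add: pdifference_def pderivative_intertwiner intertwiner_delta intertwiner_diff poisson_integrable_raise)

lemma pdifference2_intertwiner:
  fixes i j :: "'v::finite"
  assumes f: "poisson_integrable f" and \<zeta>: "\<zeta> \<in> orthant"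
  defines "d \<equiv> \<lambda>\<eta>. raise i f \<eta> - raise j f \<eta>"
  shows "pdifference i j (pdifference i j (poisson_intertwiner f)) \<zeta>
    = poisson_intertwiner (\<lambda>\<eta>. raise i d \<eta> - raise j d \<eta>) \<zeta>"
proof -
  have d: "poisson_integrable d"
    unfolding d_def using f by (intro poisson_integrable_diff poisson_integrable_raise)
  have "pderivative k (pdifference i j (poisson_intertwiner f)) \<zeta> = poisson_intertwiner (delta k d) \<zeta>" for k
    using d \<zeta> unfolding d_def
    by (intro pderivative_eqI derivative_orthant_cong[OF pdifference_intertwiner[OF f]] intertwiner_delta_derivative)
  then show ?thesis
    using d \<zeta> by (simp add: pdifference_def[of i j "pdifference i j (poisson_intertwiner f)"]
        intertwiner_delta intertwiner_diff poisson_integrable_raise)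
qed

text \<open>The generator in normal order: \<open>lower\<close> outside, \<open>raise\<close>
  inside, as multiplications stand to the left of derivatives in the BEP operator. The quadratic
  part is \<open>\<eta> i * \<eta> j\<close> times a second difference of \<open>f\<close> along
  \<open>e_i - e_j\<close>; these factors vanish wherever natural subtraction truncates, which is
  what the case distinction checks.\<close>

lemma sip_edge_lower_raise:
  fixes f :: "('v \<Rightarrow> nat) \<Rightarrow> real" and i j :: 'v
  assumes "i \<noteq> j"
  defines "d \<equiv> \<lambda>\<eta>. raise i f \<eta> - raise j f \<eta>"
  shows "sip_edge s i j f \<eta> = lower i (lower j (\<lambda>\<eta>. raise i d \<eta> - raise j d \<eta>)) \<eta>
    - 2 * s * (lower i d \<eta> - lower j d \<eta>)"
proof (cases "\<eta> i"; cases "\<eta> j")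
qed (use assms in \<open>simp_all add: sip_edge_def lower_def raise_def d_def fun_upd_twist algebra_simps fun_upd_idem\<close>)

lemma sip_site_lower_raise:
  "sip_site s a g i f \<eta> = a * (lower i (delta i (delta i f)) \<eta>) + 2 * s * a * delta i f \<eta> - (g - a) * lower i (delta i f) \<eta>"
  by (cases "\<eta> i") (simp_all add: sip_site_def lower_def raise_def delta_def algebra_simps fun_upd_idem)

context
  fixes f :: "('v::finite \<Rightarrow> nat) \<Rightarrow> real"
  assumes f: "poisson_integrable f"
begin

lemma
  assumes "i \<noteq> j"
  shows poisson_integrable_sip_edge: "poisson_integrable (sip_edge s i j f)" (is ?A)
    and intertwiner_sip_edge:
      "\<zeta> \<in> orthant \<Longrightarrow> poisson_intertwiner (sip_edge s i j f) \<zeta> = bep_edge s i j (poisson_intertwiner f) \<zeta>" (is "_ \<Longrightarrow> ?B")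
proof -
  define d where "d = (\<lambda>\<eta>. raise i f \<eta> - raise j f \<eta>)"
  define dd where "dd = (\<lambda>\<eta>. raise i d \<eta> - raise j d \<eta>)"
  have d: "poisson_integrable d"
    unfolding d_def using f by (intro poisson_integrable_diff poisson_integrable_raise)
  have dd: "poisson_integrable dd"
    unfolding dd_def using d by (intro poisson_integrable_diff poisson_integrable_raise)
  have e: "sip_edge s i j f = (\<lambda>\<eta>. lower i (lower j dd) \<eta> - 2 * s * (lower i d \<eta> - lower j d \<eta>))"
    unfolding dd_def d_def by (rule ext) (rule sip_edge_lower_raise[OF assms])
  note pi = poisson_integrable_diff poisson_integrable_cmult poisson_integrable_lower d dd
  show ?A
    unfolding e by (intro pi)
  show ?B if "\<zeta> \<in> orthant"
    unfolding e using that pdifference2_intertwiner[OF f that, of i j] pdifference_intertwiner[OF f that, of i j]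
    by (simp add: intertwiner_diff intertwiner_cmult intertwiner_lower_PI pi bep_edge_def flip: d_def dd_def)
       (simp add: algebra_simps)
qed

lemma
  shows poisson_integrable_sip_site: "poisson_integrable (sip_site s a g i f)" (is ?A)
    and intertwiner_sip_site:
      "\<zeta> \<in> orthant \<Longrightarrow> poisson_intertwiner (sip_site s a g i f) \<zeta> = bep_site s a g i (poisson_intertwiner f) \<zeta>" (is "_ \<Longrightarrow> ?B")
proof -
  have e: "sip_site s a g i f = (\<lambda>\<eta>. a * (lower i (delta i (delta i f)) \<eta>) + 2 * s * a * delta i f \<eta> - (g - a) * lower i (delta i f) \<eta>)"
    by (rule ext) (rule sip_site_lower_raise)
  note pi = poisson_integrable_diff poisson_integrable_add poisson_integrable_cmult poisson_integrable_lower poisson_integrable_delta f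
  show ?A
    unfolding e by (intro pi)
  show ?B if "\<zeta> \<in> orthant"
    unfolding e using that
    by (simp add: intertwiner_diff intertwiner_add intertwiner_cmult intertwiner_lower_PI pi bep_site_def
        pderivative_intertwiner[OF f that] pderivative2_intertwiner[OF f that])
       (simp add: algebra_simps)
qed

lemma
  shows poisson_integrable_sip_generator: "poisson_integrable (sip_generator s p c \<alpha> \<gamma> f)" (is ?A)
    and intertwiner_sip_generator: "\<zeta> \<in> orthant \<Longrightarrow>
      poisson_intertwiner (sip_generator s p c \<alpha> \<gamma> f) \<zeta> = bep_generator s p c \<alpha> \<gamma> (poisson_intertwiner f) \<zeta>" (is "_ \<Longrightarrow> ?B")
proof -
  have e: "sip_generator s p c \<alpha> \<gamma> f = (\<lambda>\<eta>. (\<Sum>i\<in>UNIV. \<Sum>j\<in>UNIV - {i}. p i j * sip_edge s i j f \<eta>)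
   + (\<Sum>i\<in>UNIV. c i * sip_site s (\<alpha> i) (\<gamma> i) i f \<eta>))"
    by (rule ext) (simp add: sip_generator_def)
  have 1: "poisson_integrable (\<lambda>\<eta>. p i j * sip_edge s i j f \<eta>)" if "j \<in> UNIV - {i}" for i j
    using that by (intro poisson_integrable_cmult poisson_integrable_sip_edge) auto
  have 2: "poisson_integrable (\<lambda>\<eta>. c i * sip_site s (\<alpha> i) (\<gamma> i) i f \<eta>)" for i
    by (intro poisson_integrable_cmult poisson_integrable_sip_site)
  show ?A
    unfolding e by (intro poisson_integrable_add poisson_integrable_sum 1 2) auto
  show ?B if \<zeta>: "\<zeta> \<in> orthant"
    unfolding e bep_generator_def
    by (subst intertwiner_add[OF \<zeta>], (intro poisson_integrable_sum 1 2; assumption)+,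
        (subst intertwiner_sum[OF \<zeta>], (intro poisson_integrable_sum 1 2; assumption))+)
       (auto intro!: arg_cong2[where f = "(+)"] sum.cong
         simp: intertwiner_sum[OF \<zeta> 1] intertwiner_cmult intertwiner_sip_site[OF \<zeta>] intertwiner_sip_edge[OF _ \<zeta>])
qed

end

section \<open>Invariant laws of Markov kernels on a countable space\<close>

lemma measure_countable_density:
  fixes \<mu> :: "'x::countable measure"
  assumes "sets \<mu> = UNIV"
  shows "\<mu> = density (count_space UNIV) (\<lambda>x. emeasure \<mu> {x})"
  by (rule measure_eqI_countable[where A = UNIV])
     (use assms in \<open>auto simp: emeasure_density nn_integral_count_space_indicator[symmetric]
        nn_integral_count_space_finite\<close>)

lemma nn_integral_countable:
  fixes \<mu> :: "'x::countable measure"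
  assumes "sets \<mu> = UNIV"
  shows "(\<integral>\<^sup>+x. f x \<partial>\<mu>) = (\<integral>\<^sup>+x. emeasure \<mu> {x} * f x \<partial>count_space UNIV)"
  by (subst measure_countable_density[OF assms]) (simp add: nn_integral_density)

lemma nn_integral_count_space_swap:
  fixes f :: "'x::countable \<Rightarrow> 'y::countable \<Rightarrow> ennreal"
  shows "(\<integral>\<^sup>+x. \<integral>\<^sup>+y. f x y \<partial>count_space UNIV \<partial>count_space UNIV)
    = (\<integral>\<^sup>+y. \<integral>\<^sup>+x. f x y \<partial>count_space UNIV \<partial>count_space UNIV)"
  using nn_integral_fst_count_space[of "\<lambda>(x, y). f x y"] nn_integral_snd_count_space[of "\<lambda>(x, y). f x y"]
  by simp

text \<open>Turns subinvariance into invariance when no mass is lost: used for the minimum of two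
  invariant laws and again for the limit of the averaged laws. Finiteness is what permits
  subtracting the integrals.\<close>

lemma nn_integral_count_space_eqD:
  fixes f g :: "'x \<Rightarrow> ennreal"
  assumes le: "\<And>x. f x \<le> g x" and eq: "(\<integral>\<^sup>+x. f x \<partial>count_space UNIV) = (\<integral>\<^sup>+x. g x \<partial>count_space UNIV)"
    and fin: "(\<integral>\<^sup>+x. g x \<partial>count_space UNIV) < \<infinity>"
  shows "f x = g x"
proof -
  have "(\<integral>\<^sup>+y. g y - f y \<partial>count_space UNIV) = 0"
    using le eq fin by (subst nn_integral_diff) (auto simp: less_top)
  then have "g x - f x = 0"
    by (subst (asm) nn_integral_0_iff_AE) (auto simp: AE_count_space)
  then have "g x \<le> f x"
    by (simp add: ennreal_minus_eq_0)
  with le show ?thesis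
    by (simp add: antisym)
qed

text \<open>The minimum \<open>m\<close> of two invariant laws satisfies \<open>m P \<le> m\<close>, hence \<open>m P = m\<close> as the masses agree;
  so \<open>{x. m x < \<mu> x}\<close> is closed under transitions, and likewise for \<open>\<nu>\<close>. As both contain \<open>z\<close> unless
  empty, one of them is empty.\<close>

lemma invariant_law_unique:
  fixes P :: "'x::countable \<Rightarrow> 'x measure"
  assumes P: "\<And>x. prob_space (P x)" "\<And>x. sets (P x) = UNIV"
    and reach: "\<And>x. (x, z) \<in> {(x, y). 0 < emeasure (P x) {y}}\<^sup>*"
    and \<mu>: "prob_space \<mu>" "sets \<mu> = UNIV" "\<mu> \<bind> P = \<mu>"
    and \<nu>: "prob_space \<nu>" "sets \<nu> = UNIV" "\<nu> \<bind> P = \<nu>"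
  shows "\<mu> = \<nu>"
proof -
  let ?C = "count_space (UNIV :: 'x set)"
  have kernel: "P \<in> measurable M (subprob_algebra ?C)" if "sets M = UNIV" for M
  proof -
    have "P \<in> measurable ?C (subprob_algebra ?C)"
      using P by (auto simp: space_subprob_algebra prob_space_imp_subprob_space)
    then show ?thesis
      using that by (subst measurable_cong_sets[of _ ?C]) auto
  qed
  have inv: "emeasure M {y} = (\<integral>\<^sup>+x. emeasure M {x} * emeasure (P x) {y} \<partial>?C)"
    if "prob_space M" "sets M = UNIV" "M \<bind> P = M" for M y
  proof -
    have "emeasure (M \<bind> P) {y} = (\<integral>\<^sup>+x. emeasure (P x) {y} \<partial>M)"
      using that prob_space.not_empty[OF that(1)] by (intro emeasure_bind[OF _ kernel]) auto
    then show ?thesis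
      using that(3) by (simp add: nn_integral_countable[OF that(2)])
  qed
  have mass: "(\<integral>\<^sup>+x. emeasure M {x} \<partial>?C) = 1" if "prob_space M" "sets M = UNIV" for M
    using nn_integral_countable[OF that(2), of "\<lambda>_. 1"] prob_space.emeasure_space_1[OF that(1)]
    by simp
  define m where "m x = min (emeasure \<mu> {x}) (emeasure \<nu> {x})" for x
  have m_le: "m x \<le> emeasure \<mu> {x}" "m x \<le> emeasure \<nu> {x}" for x
    by (auto simp: m_def)
  have m_fin: "m x < \<infinity>" for x
    using m_le(1)[of x] prob_space.emeasure_le_1[OF \<mu>(1), of "{x}"]
    by (auto intro: order.strict_trans1[OF order_trans])
  define E where "E y = (\<integral>\<^sup>+x. m x * emeasure (P x) {y} \<partial>?C)" for y
  have E_le: "E y \<le> m y" for y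
    unfolding m_def[of y] min.bounded_iff inv[OF \<mu>, of y] inv[OF \<nu>, of y] E_def
    by (intro conjI nn_integral_mono mult_right_mono m_le) auto
  have "(\<integral>\<^sup>+y. E y \<partial>?C) = (\<integral>\<^sup>+x. m x * (\<integral>\<^sup>+y. emeasure (P x) {y} \<partial>?C) \<partial>?C)"
    unfolding E_def by (subst nn_integral_count_space_swap) (simp add: nn_integral_cmult)
  also have "\<dots> = (\<integral>\<^sup>+x. m x \<partial>?C)"
    by (simp add: mass P)
  finally have E_m: "(\<integral>\<^sup>+y. E y \<partial>?C) = (\<integral>\<^sup>+x. m x \<partial>?C)" .
  have m_int: "(\<integral>\<^sup>+x. m x \<partial>?C) < \<infinity>"
    using nn_integral_mono[of ?C m "\<lambda>x. emeasure \<mu> {x}"] m_le mass[OF \<mu>(1,2)]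
    by (auto intro: order.strict_trans1)
  have m_E: "m y = E y" for y
    using nn_integral_count_space_eqD[OF E_le E_m m_int] by simp
  have step: "m y < emeasure M {y}"
    if M: "prob_space M" "sets M = UNIV" "M \<bind> P = M" "\<And>x. m x \<le> emeasure M {x}"
      and x: "m x < emeasure M {x}" and xy: "0 < emeasure (P x) {y}" for M x y
  proof (rule ccontr)
    assume "\<not> ?thesis"
    then have "emeasure M {y} = m y"
      using M(4)[of y] by simp
    then have eq: "(\<integral>\<^sup>+x. emeasure M {x} * emeasure (P x) {y} \<partial>?C) = (\<integral>\<^sup>+x. m x * emeasure (P x) {y} \<partial>?C)"
      using inv[OF M(1-3), of y] m_E[of y] by (simp add: E_def)
    have fin: "(\<integral>\<^sup>+x. m x * emeasure (P x) {y} \<partial>?C) \<noteq> \<infinity>"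
      using m_E[of y] m_fin[of y] by (simp add: E_def)
    have "(\<integral>\<^sup>+x. emeasure M {x} * emeasure (P x) {y} - m x * emeasure (P x) {y} \<partial>?C) = 0"
      using fin by (subst nn_integral_diff) (auto simp: eq less_top intro!: mult_right_mono M(4))
    then have "emeasure M {x} * emeasure (P x) {y} - m x * emeasure (P x) {y} = 0"
      by (subst (asm) nn_integral_0_iff_AE) (auto simp: AE_count_space)
    then have "emeasure M {x} * emeasure (P x) {y} \<le> m x * emeasure (P x) {y}"
      by (simp add: ennreal_minus_eq_0)
    moreover have "emeasure (P x) {y} < \<infinity>"
      using prob_space.emeasure_le_1[OF P(1)[of x], of "{y}"] by (auto intro: order.strict_trans1)
    ultimately show False
      using x xy ennreal_mult_strict_right_mono[of "m x" "emeasure M {x}" "emeasure (P x) {y}"] by (simp add: not_le[symmetric])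
  qed
  have reach_z: "m z < emeasure M {z}"
    if M: "prob_space M" "sets M = UNIV" "M \<bind> P = M" "\<And>x. m x \<le> emeasure M {x}"
      and x: "m x < emeasure M {x}" for M x
    using reach[of x] x by (induction rule: converse_rtrancl_induct) (use step[OF M] in auto)
  have "(\<forall>x. emeasure \<mu> {x} = m x) \<or> (\<forall>x. emeasure \<nu> {x} = m x)"
  proof (rule ccontr)
    assume "\<not> ?thesis"
    then obtain x x' where "m x < emeasure \<mu> {x}" "m x' < emeasure \<nu> {x'}"
      using m_le by (metis order_le_less)
    from reach_z[OF \<mu> m_le(1) this(1)] reach_z[OF \<nu> m_le(2) this(2)]
    show False
      by (simp add: m_def min_def split: if_splits)
  qed
  \<comment> \<open>If one law equals \<open>m\<close>, then \<open>m\<close> has mass one, and the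
    other law lies above \<open>m\<close> with the same mass.\<close>
  moreover have eqI: "emeasure N {x} = m x"
    if M: "\<forall>x. emeasure M {x} = m x" "prob_space M" "sets M = UNIV" and N: "prob_space N" "sets N = UNIV"
      "\<And>x. m x \<le> emeasure N {x}" for M N x
  proof -
    have "(\<integral>\<^sup>+x. m x \<partial>?C) = 1"
      using mass[OF M(2,3)] unfolding M(1)[rule_format] .
    then show ?thesis
      using nn_integral_count_space_eqD[of m "\<lambda>x. emeasure N {x}", OF N(3)] mass[OF N(1,2)] by simp
  qed
  ultimately have "emeasure \<mu> {x} = emeasure \<nu> {x}" for x
    using eqI[OF _ \<mu>(1,2) \<nu>(1,2) m_le(2), of x] eqI[OF _ \<nu>(1,2) \<mu>(1,2) m_le(1), of x] by auto
  then show ?thesis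
    using \<mu> \<nu> by (intro measure_eqI_countable[where A = UNIV]) auto
qed

section \<open>Jump processes: uniqueness for the forward equation\<close>

lemma integral_finite_support:
  fixes f :: "'x \<Rightarrow> real"
  assumes "finite F" "\<And>x. x \<notin> F \<Longrightarrow> f x = 0" "sets M = UNIV" "prob_space M"
  shows "integral\<^sup>L M f = (\<Sum>x\<in>F. f x * measure M {x})"
proof -
  interpret prob_space M by fact
  have "f z = (\<Sum>x\<in>F. f x * indicator {x} z)" for z
    using assms(1,2) by (cases "z \<in> F") (auto simp: indicator_def if_distrib sum.delta' cong: if_cong)
  then have "integral\<^sup>L M f = integral\<^sup>L M (\<lambda>y. \<Sum>x\<in>F. f x * indicator {x} y)"
    by (intro arg_cong[where f = "integral\<^sup>L M"] ext)
  also have "\<dots> = (\<Sum>x\<in>F. f x * measure M {x})"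
    using assms(3) by (subst Bochner_Integration.integral_sum) (auto simp: emeasure_eq_measure)
  finally show ?thesis .
qed

text \<open>Finitely many jump types make the generator a finite sum without summability conditions.
  \<open>level_rate\<close> restrains only jumps that change the level, so exchanges of particles
  may have quadratic rates.\<close>

locale jump_process =
  fixes rate :: "'a::finite \<Rightarrow> 'x::countable \<Rightarrow> real"
    and jump :: "'a \<Rightarrow> 'x \<Rightarrow> 'x"
    and level :: "'x \<Rightarrow> nat"
    and C :: real
  assumes rate_nonneg: "0 \<le> rate a x"
    and finite_level: "finite {x. level x \<le> n}"
    and level_jump: "rate a x \<noteq> 0 \<Longrightarrow> level (jump a x) \<le> level x + 1 \<and> level x \<le> level (jump a x) + 1"
    and level_rate: "level (jump a x) \<noteq> level x \<Longrightarrow> rate a x \<le> C * (1 + real (level x))"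
begin

definition gen :: "('x \<Rightarrow> real) \<Rightarrow> 'x \<Rightarrow> real" where
  "gen f x = (\<Sum>a\<in>UNIV. rate a x * (f (jump a x) - f x))"

text \<open>Tested against points only: the generator of a point indicator has finite support, so no
  integrability of the rates is presupposed.\<close>

definition forward_solution :: "(real \<Rightarrow> 'x measure) \<Rightarrow> bool" where
  "forward_solution \<mu> \<longleftrightarrow> (\<forall>t\<ge>0. prob_space (\<mu> t) \<and> sets (\<mu> t) = UNIV) \<and>
    (\<forall>x. \<forall>t\<ge>0. ((\<lambda>u. \<integral>y. gen (indicator {x}) y \<partial>\<mu> u) has_integral
        (measure (\<mu> t) {x} - measure (\<mu> 0) {x})) {0..t})"

lemma solution_facts:
  "forward_solution \<kappa> \<Longrightarrow> 0 \<le> t \<Longrightarrow> prob_space (\<kappa> t)"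
  "forward_solution \<kappa> \<Longrightarrow> 0 \<le> t \<Longrightarrow> sets (\<kappa> t) = UNIV"
  by (auto simp: forward_solution_def)

section \<open>Test functions supported on finitely many levels\<close>

lemma gen_eq_0:
  assumes "\<And>y. n < level y \<Longrightarrow> f y = 0" and "n + 1 < level x"
  shows "gen f x = 0"
  unfolding gen_def
proof (intro sum.neutral ballI)
  fix a
  show "rate a x * (f (jump a x) - f x) = 0"
    using level_jump[of a x] assms(1)[of x] assms(1)[of "jump a x"] assms(2) by fastforce
qed

text \<open>Linearity of \<open>gen\<close> read as a transposition: it moves the generator from the
  equations for point masses onto a test function.\<close>

lemma gen_indicator_sum:
  assumes "finite F" "\<And>x. x \<notin> F \<Longrightarrow> g x = 0"
  shows "(\<Sum>x\<in>F. g x * gen (indicator {x}) y) = gen g y"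
proof -
  have g: "(\<Sum>x\<in>F. g x * indicator {x} z) = g z" for z
    using assms by (cases "z \<in> F") (auto simp: indicator_def if_distrib sum.delta' cong: if_cong)
  have "(\<Sum>x\<in>F. g x * gen (indicator {x}) y)
      = (\<Sum>a\<in>UNIV. rate a y * ((\<Sum>x\<in>F. g x * indicator {x} (jump a y)) - (\<Sum>x\<in>F. g x * indicator {x} y)))"
    unfolding gen_def sum_distrib_left sum_subtractf[symmetric]
    by (subst sum.swap) (simp add: algebra_simps)
  then show ?thesis
    by (simp add: g gen_def)
qed

text \<open>Linear between the levels \<open>R\<close> and \<open>2 * R\<close>. The slope
  \<open>1 / R\<close> is chosen to compensate the linear growth of the rates of level-changing
  jumps.\<close>

definition cutoff :: "nat \<Rightarrow> 'x \<Rightarrow> real" where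
  "cutoff R x = max 0 (min 1 (2 - real (level x) / real R))"

lemma cutoff_bounds: "0 \<le> cutoff R x" "cutoff R x \<le> 1"
  by (auto simp: cutoff_def)

lemma cutoff_1: "0 < R \<Longrightarrow> level x \<le> R \<Longrightarrow> cutoff R x = 1"
  by (simp add: cutoff_def)

lemma cutoff_0: "0 < R \<Longrightarrow> 2 * R \<le> level x \<Longrightarrow> cutoff R x = 0"
  by (simp add: cutoff_def field_simps max_def min_def)

lemma cutoff_diff:
  assumes "0 < R" "level y \<le> level x + 1" "level x \<le> level y + 1"
  shows "\<bar>cutoff R y - cutoff R x\<bar> \<le> 1 / real R"
proof -
  have "\<bar>real (level y) / real R - real (level x) / real R\<bar> \<le> 1 / real R"
    using assms by (simp add: diff_divide_distrib[symmetric] abs_divide divide_right_mono)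
  then show ?thesis
    by (auto simp: cutoff_def max_def min_def abs_if split: if_splits)
qed

text \<open>A level-changing rate is at most
  \<open>\<bar>C\<bar> * (2 * R + 2) \<le> \<bar>C\<bar> * 4 * R\<close>, and one jump changes the
  cut-off by at most \<open>1 / R\<close>; this gives \<open>4 * \<bar>C\<bar>\<close> per jump
  type, independent of \<open>R\<close>. Below level \<open>R\<close> a single jump stays where the
  cut-off is 1.\<close>

lemma gen_cutoff_bound:
  assumes "0 < R" "level x \<le> 2 * R + 1"
  shows "\<bar>gen (cutoff R) x\<bar> \<le> real CARD('a) * (4 * \<bar>C\<bar>) * indicator {x. R \<le> level x} x"
proof (cases "R \<le> level x")
  case True
  have "\<bar>rate a x * (cutoff R (jump a x) - cutoff R x)\<bar> \<le> 4 * \<bar>C\<bar>" for a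
  proof (cases "rate a x = 0 \<or> level (jump a x) = level x")
    case True
    then show ?thesis
      by (auto simp: cutoff_def)
  next
    case False
    have "rate a x \<le> C * (1 + real (level x))"
      using False level_rate by auto
    also have "\<dots> \<le> \<bar>C\<bar> * (4 * real R)"
      using assms by (intro mult_mono) auto
    finally have "\<bar>rate a x\<bar> * \<bar>cutoff R (jump a x) - cutoff R x\<bar> \<le> (\<bar>C\<bar> * (4 * real R)) * (1 / real R)"
      using rate_nonneg[of a x] level_jump[of a x] False assms
      by (intro mult_mono cutoff_diff) auto
    then show ?thesis
      using assms by (simp add: abs_mult)
  qed
  then have "(\<Sum>a\<in>UNIV. \<bar>rate a x * (cutoff R (jump a x) - cutoff R x)\<bar>) \<le> (\<Sum>a\<in>(UNIV::'a set). 4 * \<bar>C\<bar>)"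
    by (intro sum_mono)
  then show ?thesis
    using True unfolding gen_def by (auto intro: order_trans[OF sum_abs])
next
  case False
  have "rate a x * (cutoff R (jump a x) - cutoff R x) = 0" for a
    using False level_jump[of a x] cutoff_1[OF assms(1), of x] cutoff_1[OF assms(1), of "jump a x"]
    by fastforce
  then have "gen (cutoff R) x = 0"
    unfolding gen_def by (intro sum.neutral ballI)
  then show ?thesis
    by simp
qed

text \<open>The quotient is the derivative of \<open>sqrt (w\<^sup>2 + \<epsilon>\<^sup>2)\<close>,
  a differentiable substitute for \<open>\<bar>w\<bar>\<close>; replacing the sign by it costs at
  most \<open>\<epsilon>\<close>, because \<open>(\<bar>w\<bar> - \<epsilon>) * (\<bar>w\<bar> +
  \<epsilon>) \<le> w * w\<close>.\<close>

lemma sqrt_smoothing: "\<bar>w\<bar> - \<epsilon> \<le> w * (w / sqrt (w\<^sup>2 + \<epsilon>\<^sup>2))" if "0 < \<epsilon>" for w \<epsilon> :: real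
proof (cases "\<bar>w\<bar> \<le> \<epsilon>")
  case True
  then show ?thesis
    by (auto intro: order_trans[of _ 0])
next
  case False
  have "sqrt (w\<^sup>2 + \<epsilon>\<^sup>2) \<le> \<bar>w\<bar> + \<epsilon>"
    using that by (intro real_le_lsqrt) (auto simp: power2_sum)
  then have "(\<bar>w\<bar> - \<epsilon>) * sqrt (w\<^sup>2 + \<epsilon>\<^sup>2) \<le> (\<bar>w\<bar> - \<epsilon>) * (\<bar>w\<bar> + \<epsilon>)"
    using False by (intro mult_left_mono) auto
  also have "\<dots> \<le> w * w"
    using that by (simp add: algebra_simps abs_mult_self_eq)
  finally show ?thesis
    using that by (simp add: le_divide_eq add_nonneg_pos)
qed

text \<open>Kato's inequality; \<open>s\<close> is a smoothed sign of \<open>w\<close>.\<close>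

lemma gen_kato:
  fixes w s \<theta> :: "'x \<Rightarrow> real"
  assumes "\<And>x. 0 \<le> \<theta> x" "\<And>x. \<bar>s x\<bar> \<le> 1" "\<bar>w y\<bar> - \<epsilon> \<le> w y * s y"
  shows "w y * gen (\<lambda>x. \<theta> x * s x) y \<le> \<bar>w y\<bar> * gen \<theta> y + \<epsilon> * (\<Sum>a\<in>UNIV. rate a y * \<theta> y)"
proof -
  have "w y * (rate a y * (\<theta> (jump a y) * s (jump a y) - \<theta> y * s y))
      \<le> \<bar>w y\<bar> * (rate a y * (\<theta> (jump a y) - \<theta> y)) + \<epsilon> * (rate a y * \<theta> y)" for a
  proof -
    have "w y * s (jump a y) \<le> \<bar>w y\<bar> * 1"
    proof -
      have "\<bar>w y * s (jump a y)\<bar> \<le> \<bar>w y\<bar> * 1"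
        unfolding abs_mult by (intro mult_left_mono assms(2)) simp
      then show ?thesis
        by linarith
    qed
    then have "\<theta> (jump a y) * (w y * s (jump a y)) \<le> \<theta> (jump a y) * \<bar>w y\<bar>"
      using assms(1) by (intro mult_left_mono) auto
    moreover have "\<theta> y * (\<bar>w y\<bar> - \<epsilon>) \<le> \<theta> y * (w y * s y)"
      using assms by (intro mult_left_mono) auto
    ultimately have "w y * (\<theta> (jump a y) * s (jump a y) - \<theta> y * s y)
        \<le> \<bar>w y\<bar> * (\<theta> (jump a y) - \<theta> y) + \<epsilon> * \<theta> y"
      by argo
    from mult_left_mono[OF this rate_nonneg[of a y]] show ?thesis
      by argo
  qed
  then have "(\<Sum>a\<in>UNIV. w y * (rate a y * (\<theta> (jump a y) * s (jump a y) - \<theta> y * s y)))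
      \<le> (\<Sum>a\<in>UNIV. \<bar>w y\<bar> * (rate a y * (\<theta> (jump a y) - \<theta> y)) + \<epsilon> * (rate a y * \<theta> y))"
    by (intro sum_mono)
  then show ?thesis
    by (simp add: gen_def sum_distrib_left sum.distrib)
qed

context
  fixes \<mu> \<nu> :: "real \<Rightarrow> 'x measure"
  assumes \<mu>: "forward_solution \<mu>" and \<nu>: "forward_solution \<nu>"
    and start: "\<And>x. measure (\<mu> 0) {x} = measure (\<nu> 0) {x}"
begin

definition gap :: "real \<Rightarrow> 'x \<Rightarrow> real" where
  "gap t x = measure (\<mu> t) {x} - measure (\<nu> t) {x}"

lemma gap_has_integral:
  assumes "level x \<le> n" "0 \<le> t"
  shows "((\<lambda>u. \<Sum>y | level y \<le> n + 1. gap u y * gen (indicator {x}) y) has_integral gap t x) {0..t}"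
proof -
  have z: "gen (indicator {x}) y = 0" if "y \<notin> {y. level y \<le> n + 1}" for y
    using that assms by (intro gen_eq_0[where n = n]) (auto simp: indicator_def)
  have i: "(\<integral>y. gen (indicator {x}) y \<partial>\<kappa> u) = (\<Sum>y | level y \<le> n + 1. gen (indicator {x}) y * measure (\<kappa> u) {y})"
    if "forward_solution \<kappa>" "0 \<le> u" for \<kappa> u
    using that by (intro integral_finite_support finite_level z) (auto simp: solution_facts)
  have "((\<lambda>u. (\<integral>y. gen (indicator {x}) y \<partial>\<mu> u) - (\<integral>y. gen (indicator {x}) y \<partial>\<nu> u)) has_integral
      ((measure (\<mu> t) {x} - measure (\<mu> 0) {x}) - (measure (\<nu> t) {x} - measure (\<nu> 0) {x}))) {0..t}"
    using \<mu> \<nu> assms unfolding forward_solution_def by (intro has_integral_diff) auto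
  then show ?thesis
    by (rule has_integral_eq[rotated, THEN has_integral_eq_rhs])
       (auto simp: i \<mu> \<nu> start gap_def algebra_simps sum_subtractf)
qed

text \<open>Bootstrap: the forward equation makes each gap an indefinite integral, hence continuous;
  the integrand is a finite sum of gaps, hence continuous as well, and so the gap is even
  differentiable.\<close>

lemma gap_continuous: "continuous_on {0..T} (\<lambda>t. gap t x)"
proof (cases "0 \<le> T")
  case True
  define g where "g u = (\<Sum>y | level y \<le> level x + 1. gap u y * gen (indicator {x}) y)" for u
  have "gap t x = integral {0..t} g" if "t \<in> {0..T}" for t
    unfolding g_def using gap_has_integral[OF order_refl, of t x] that by (auto simp: integral_unique)
  moreover have "continuous_on {0..T} (\<lambda>t. integral {0..t} g)"
    using gap_has_integral[OF order_refl True, of x] unfolding g_def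
    by (intro indefinite_integral_continuous_1) (auto simp: integrable_on_def)
  ultimately show ?thesis
    by (subst continuous_on_cong[OF refl]) auto
qed simp

lemma gap_derivative:
  assumes "level x \<le> n" "t \<in> {0..T}"
  shows "((\<lambda>t. gap t x) has_real_derivative (\<Sum>y | level y \<le> n + 1. gap t y * gen (indicator {x}) y))
    (at t within {0..T})"
proof -
  define g where "g u = (\<Sum>y | level y \<le> n + 1. gap u y * gen (indicator {x}) y)" for u
  have "((\<lambda>t. integral {0..t} g) has_real_derivative g t) (at t within {0..T})"
    using assms unfolding g_def
    by (intro integral_has_real_derivative continuous_intros gap_continuous) auto
  moreover have "gap u x = integral {0..u} g" if "u \<in> {0..T}" for u
    unfolding g_def using gap_has_integral[OF assms(1), of u] that by (auto simp: integral_unique)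
  ultimately show ?thesis
    unfolding g_def[symmetric] using assms(2)
    by (auto intro: has_field_derivative_transform_within[where d = 1])
qed

text \<open>The term that Kato's inequality leaves over. Jumps within a level drop out of
  \<open>gen (cutoff R)\<close>, so only the layer from level \<open>R\<close> upwards
  contributes.\<close>

definition outflow :: "nat \<Rightarrow> real \<Rightarrow> real" where
  "outflow R u = (\<Sum>y | level y \<le> 2 * R + 1. \<bar>gap u y\<bar> * gen (cutoff R) y)"

lemma outflow_continuous: "continuous_on {0..T} (outflow R)"
  unfolding outflow_def by (intro continuous_intros gap_continuous)

text \<open>Differentiate the smoothed and cut-off total variation \<open>\<Phi>\<close>, integrate
  in time, and let \<open>\<epsilon>\<close> tend to 0. All sums are finite, so the errors are
  \<open>\<epsilon>\<close> times a constant depending on \<open>R\<close> and \<open>T\<close>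
  only.\<close>

lemma gap_sum_le_outflow:
  assumes R: "0 < R" and T: "0 \<le> T"
  shows "(\<Sum>x | level x \<le> 2 * R. cutoff R x * \<bar>gap T x\<bar>) \<le> integral {0..T} (outflow R)"
proof -
  let ?F = "{x. level x \<le> 2 * R}" and ?F' = "{x. level x \<le> 2 * R + 1}"
  define D where "D = (\<Sum>y\<in>?F'. \<Sum>a\<in>UNIV. rate a y * cutoff R y)"
  define K where "K = D * T + real (card ?F)"
  have "(\<Sum>x\<in>?F. cutoff R x * \<bar>gap T x\<bar>) \<le> integral {0..T} (outflow R) + \<epsilon> * K" if \<epsilon>: "0 < \<epsilon>" for \<epsilon>
  proof -
    define \<Phi> where "\<Phi> t = (\<Sum>x\<in>?F. cutoff R x * sqrt ((gap t x)\<^sup>2 + \<epsilon>\<^sup>2))" for t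
    define s where "s t x = gap t x / sqrt ((gap t x)\<^sup>2 + \<epsilon>\<^sup>2)" for t x
    define \<phi> where "\<phi> t = (\<Sum>x\<in>?F. cutoff R x * (s t x * (\<Sum>y\<in>?F'. gap t y * gen (indicator {x}) y)))" for t
    have pos: "0 < w\<^sup>2 + \<epsilon>\<^sup>2" for w :: real
      using \<epsilon> by (simp add: add_nonneg_pos)
    have "(\<Phi> has_real_derivative \<phi> t) (at t within {0..T})" if "t \<in> {0..T}" for t
    proof -
      have "((\<lambda>t. sqrt ((gap t x)\<^sup>2 + \<epsilon>\<^sup>2)) has_real_derivative
          s t x * (\<Sum>y\<in>?F'. gap t y * gen (indicator {x}) y)) (at t within {0..T})" if x: "x \<in> ?F" for x
        using gap_derivative[of x "2 * R" t T] x \<open>t \<in> {0..T}\<close> pos[of "gap t x"]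
        by (auto intro!: derivative_eq_intros simp: s_def field_simps)
      then show ?thesis
        unfolding \<Phi>_def \<phi>_def by (auto intro!: DERIV_sum DERIV_cmult)
    qed
    then have int: "(\<phi> has_integral (\<Phi> T - \<Phi> 0)) {0..T}"
      using T by (intro fundamental_theorem_of_calculus)
        (auto simp: has_real_derivative_iff_has_vector_derivative[symmetric])
    \<comment> \<open>Exchanging the sums puts the generator on the function
      \<open>cutoff R x * s t x\<close>, to which Kato's inequality applies site by site.\<close>
    have \<phi>_le: "\<phi> t \<le> outflow R t + \<epsilon> * D" for t
    proof -
      have "\<phi> t = (\<Sum>y\<in>?F'. gap t y * (\<Sum>x\<in>?F. (cutoff R x * s t x) * gen (indicator {x}) y))"
        unfolding \<phi>_def sum_distrib_left by (subst sum.swap) (simp add: mult_ac)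
      also have "\<dots> = (\<Sum>y\<in>?F'. gap t y * gen (\<lambda>x. cutoff R x * s t x) y)"
        by (intro sum.cong refl arg_cong2[where f = "(*)"] gen_indicator_sum finite_level)
           (use cutoff_0[OF R] in auto)
      also have "\<dots> \<le> (\<Sum>y\<in>?F'. \<bar>gap t y\<bar> * gen (cutoff R) y + \<epsilon> * (\<Sum>a\<in>UNIV. rate a y * cutoff R y))"
      proof (intro sum_mono gen_kato cutoff_bounds)
        show "\<bar>gap t y\<bar> - \<epsilon> \<le> gap t y * s t y" for y
          unfolding s_def by (rule sqrt_smoothing[OF \<epsilon>])
        show "\<bar>s t x\<bar> \<le> 1" for x
          using pos[of "gap t x"] by (simp add: s_def abs_divide divide_le_eq real_le_rsqrt)
      qed
      finally show ?thesis
        by (simp add: outflow_def D_def sum.distrib sum_distrib_left)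
    qed
    have "\<Phi> T - \<Phi> 0 \<le> integral {0..T} (outflow R) + \<epsilon> * D * T"
    proof (rule has_integral_le[OF int])
      have "outflow R integrable_on {0..T}"
        by (intro integrable_continuous_real outflow_continuous)
      then show "((\<lambda>t. outflow R t + \<epsilon> * D) has_integral (integral {0..T} (outflow R) + \<epsilon> * D * T)) {0..T}"
        using T has_integral_const_real[of "\<epsilon> * D" 0 T]
        by (intro has_integral_add integrable_integral) (auto simp: mult_ac)
    qed (rule \<phi>_le)
    \<comment> \<open>Both solutions start equal, so each smoothed absolute value is just
      \<open>\<epsilon>\<close> at time 0.\<close>
    moreover have "\<Phi> 0 \<le> \<epsilon> * real (card ?F)"
    proof -
      have "\<Phi> 0 \<le> (\<Sum>x\<in>?F. 1 * \<epsilon>)"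
        unfolding \<Phi>_def gap_def using start \<epsilon> cutoff_bounds by (intro sum_mono mult_mono) auto
      then show ?thesis
        by (simp add: mult_ac)
    qed
    moreover have "(\<Sum>x\<in>?F. cutoff R x * \<bar>gap T x\<bar>) \<le> \<Phi> T"
      unfolding \<Phi>_def by (intro sum_mono mult_left_mono cutoff_bounds real_le_rsqrt) auto
    ultimately show ?thesis
      by (simp add: K_def algebra_simps)
  qed
  then have ev: "\<forall>\<^sub>F \<epsilon> in at_right 0. (\<Sum>x\<in>?F. cutoff R x * \<bar>gap T x\<bar>) \<le> integral {0..T} (outflow R) + \<epsilon> * K"
    by (intro eventually_mono[OF eventually_at_right_less])
  have "((\<lambda>\<epsilon>. integral {0..T} (outflow R) + \<epsilon> * K) \<longlongrightarrow> integral {0..T} (outflow R) + 0 * K) (at_right 0)"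
    by (intro tendsto_intros)
  from tendsto_lowerbound[OF this ev] show ?thesis
    by simp
qed

text \<open>Only the probability of levels from \<open>R\<close> on enters, no moment. Hence the
  outflow tends to 0 for any two solutions that are probability laws.\<close>

lemma outflow_bound:
  assumes R: "0 < R" and u: "0 \<le> u"
  shows "\<bar>outflow R u\<bar> \<le> real CARD('a) * (4 * \<bar>C\<bar>) *
    (measure (\<mu> u) {x. R \<le> level x} + measure (\<nu> u) {x. R \<le> level x})"
proof -
  let ?F = "{y. level y \<le> 2 * R + 1 \<and> R \<le> level y}"
  have "finite ?F"
    by (rule finite_subset[OF _ finite_level[of "2 * R + 1"]]) auto
  have le: "(\<Sum>y\<in>?F. measure (\<kappa> u) {y}) \<le> measure (\<kappa> u) {x. R \<le> level x}" if "forward_solution \<kappa>" for \<kappa>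
  proof -
    interpret prob_space "\<kappa> u"
      using that u by (rule solution_facts)
    have s: "sets (\<kappa> u) = UNIV"
      using that u by (rule solution_facts)
    have "(\<Sum>y\<in>?F. measure (\<kappa> u) {y}) = measure (\<kappa> u) ?F"
      using \<open>finite ?F\<close> s by (intro finite_measure_eq_sum_singleton[symmetric]) auto
    also have "\<dots> \<le> measure (\<kappa> u) {x. R \<le> level x}"
      using s by (intro finite_measure_mono) auto
    finally show ?thesis .
  qed
  have "\<bar>outflow R u\<bar> \<le> (\<Sum>y | level y \<le> 2 * R + 1. \<bar>gap u y\<bar> * \<bar>gen (cutoff R) y\<bar>)"
    unfolding outflow_def by (rule order_trans[OF sum_abs]) (simp add: abs_mult)
  also have "\<dots> \<le> (\<Sum>y | level y \<le> 2 * R + 1. \<bar>gap u y\<bar> * (real CARD('a) * (4 * \<bar>C\<bar>) * indicator {x. R \<le> level x} y))"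
    by (intro sum_mono mult_left_mono gen_cutoff_bound R) auto
  also have "\<dots> = real CARD('a) * (4 * \<bar>C\<bar>) * (\<Sum>y | level y \<le> 2 * R + 1. if R \<le> level y then \<bar>gap u y\<bar> else 0)"
    unfolding sum_distrib_left by (intro sum.cong) (auto simp: indicator_def)
  also have "(\<Sum>y | level y \<le> 2 * R + 1. if R \<le> level y then \<bar>gap u y\<bar> else 0) = (\<Sum>y\<in>?F. \<bar>gap u y\<bar>)"
    using finite_level[of "2 * R + 1"] by (subst sum.inter_filter[symmetric]) auto
  also have "\<dots> \<le> (\<Sum>y\<in>?F. measure (\<mu> u) {y} + measure (\<nu> u) {y})"
    unfolding gap_def by (intro sum_mono) (simp add: abs_le_iff add_increasing add_increasing2)
  also have "\<dots> \<le> measure (\<mu> u) {x. R \<le> level x} + measure (\<nu> u) {x. R \<le> level x}"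
    unfolding sum.distrib by (intro add_mono le \<mu> \<nu>)
  finally show ?thesis
    by (simp add: mult_left_mono)
qed

lemma forward_solution_unique_aux:
  assumes T: "0 \<le> T"
  shows "gap T x = 0"
proof -
  have tail: "(\<lambda>R. measure (\<kappa> u) {x. Suc R \<le> level x}) \<longlonglongrightarrow> 0" if "forward_solution \<kappa>" "0 \<le> u" for \<kappa> u
  proof -
    interpret prob_space "\<kappa> u"
      using that by (rule solution_facts)
    have "(\<lambda>R. measure (\<kappa> u) {x. Suc R \<le> level x}) \<longlonglongrightarrow> measure (\<kappa> u) (\<Inter>R. {x. Suc R \<le> level x})"
      using solution_facts(2)[OF that] by (intro finite_Lim_measure_decseq) (auto simp: decseq_def)
    also have "(\<Inter>R. {x. Suc R \<le> level x}) = {}"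
      using Suc_n_not_le_n by blast
    finally show ?thesis
      by simp
  qed
  have "(\<lambda>R. integral {0..T} (outflow (Suc R))) \<longlonglongrightarrow> integral {0..T} (\<lambda>_. 0)"
  proof (rule dominated_convergence(2)[where h = "\<lambda>_. real CARD('a) * (4 * \<bar>C\<bar>) * 2"])
    show "outflow (Suc R) integrable_on {0..T}" for R
      by (intro integrable_continuous_real outflow_continuous)
    show "norm (outflow (Suc R) u) \<le> real CARD('a) * (4 * \<bar>C\<bar>) * 2" if "u \<in> {0..T}" for R u
    proof -
      have "measure (\<kappa> u) A \<le> 1" if "forward_solution \<kappa>" for \<kappa> A
        using solution_facts(1)[OF that] \<open>u \<in> {0..T}\<close> by (auto intro: prob_space.prob_le_1)
      then have "measure (\<mu> u) {x. Suc R \<le> level x} + measure (\<nu> u) {x. Suc R \<le> level x} \<le> 2"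
        using \<mu> \<nu> by (smt (verit))
      then show ?thesis
        unfolding real_norm_def using that by (intro order_trans[OF outflow_bound] mult_left_mono) auto
    qed
    show "(\<lambda>R. outflow (Suc R) u) \<longlonglongrightarrow> 0" if "u \<in> {0..T}" for u
    proof (rule Lim_null_comparison)
      show "\<forall>\<^sub>F R in sequentially. norm (outflow (Suc R) u) \<le> real CARD('a) * (4 * \<bar>C\<bar>) *
          (measure (\<mu> u) {x. Suc R \<le> level x} + measure (\<nu> u) {x. Suc R \<le> level x})"
        using that by (intro always_eventually allI) (auto intro!: outflow_bound)
      show "(\<lambda>R. real CARD('a) * (4 * \<bar>C\<bar>) *
          (measure (\<mu> u) {x. Suc R \<le> level x} + measure (\<nu> u) {x. Suc R \<le> level x})) \<longlonglongrightarrow> 0"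
        using tail[OF \<mu>] tail[OF \<nu>] that by (auto intro!: tendsto_eq_intros)
    qed
  qed auto
  \<comment> \<open>Once \<open>R\<close> exceeds the level of \<open>x\<close>, the cut-off is 1 at
    \<open>x\<close> and the single term is dominated by the nonnegative sum.\<close>
  moreover have "\<bar>gap T x\<bar> \<le> integral {0..T} (outflow (Suc R))" if "level x \<le> R" for R
  proof -
    have "\<bar>gap T x\<bar> = cutoff (Suc R) x * \<bar>gap T x\<bar>"
      using that by (subst cutoff_1) auto
    also have "\<dots> \<le> (\<Sum>x | level x \<le> 2 * Suc R. cutoff (Suc R) x * \<bar>gap T x\<bar>)"
      using that finite_level[of "2 * Suc R"] cutoff_bounds by (intro member_le_sum) auto
    also have "\<dots> \<le> integral {0..T} (outflow (Suc R))"
      using T by (intro gap_sum_le_outflow) auto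
    finally show ?thesis .
  qed
  then have "\<forall>\<^sub>F R in sequentially. \<bar>gap T x\<bar> \<le> integral {0..T} (outflow (Suc R))"
    by (intro eventually_mono[OF eventually_ge_at_top[of "level x"]])
  ultimately have "\<bar>gap T x\<bar> \<le> integral {0..T} (\<lambda>_. 0 :: real)"
    by (rule tendsto_lowerbound) simp
  then show ?thesis
    by simp
qed

end

lemma forward_solution_unique:
  assumes "forward_solution \<mu>" "forward_solution \<nu>" "\<mu> 0 = \<nu> 0" "0 \<le> t"
  shows "\<mu> t = \<nu> t"
proof -
  have start: "measure (\<mu> 0) {x} = measure (\<nu> 0) {x}" for x
    using assms(3) by simp
  have "measure (\<mu> t) {x} = measure (\<nu> t) {x}" for x
    using forward_solution_unique_aux[OF assms(1,2) start assms(4), of x]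
    unfolding gap_def[OF assms(1,2) start] by (simp only: right_minus_eq)
  then have "emeasure (\<mu> t) {x} = emeasure (\<nu> t) {x}" for x
    using solution_facts(1)[OF assms(1,4)] solution_facts(1)[OF assms(2,4)]
    by (simp add: finite_measure.emeasure_eq_measure prob_space.finite_measure)
  then show ?thesis
    using solution_facts(2)[OF assms(1,4)] solution_facts(2)[OF assms(2,4)]
    by (intro measure_eqI_countable[where A = UNIV]) auto
qed

end

section \<open>Jump semigroups\<close>

text \<open>Writes an expectation as a limit of finite sums. This allows averages over initial
  states to be exchanged with the time integral, without joint measurability in time and
  state.\<close>

lemma integral_level_truncation:
  fixes M :: "'x::countable measure" and g :: "'x \<Rightarrow> real" and level :: "'x \<Rightarrow> nat"
  assumes M: "prob_space M" "sets M = UNIV" and fin: "\<And>n. finite {x. level x \<le> n}" and g: "\<And>x. \<bar>g x\<bar> \<le> B"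
  shows "(\<lambda>n. \<Sum>x | level x \<le> n. g x * measure M {x}) \<longlonglongrightarrow> integral\<^sup>L M g"
proof -
  interpret prob_space M by fact
  have m: "f \<in> borel_measurable M" for f :: "'x \<Rightarrow> real"
    using M(2) by (simp add: measurable_def)
  have "(\<lambda>n. \<integral>x. (if level x \<le> n then g x else 0) \<partial>M) \<longlonglongrightarrow> integral\<^sup>L M g"
  proof (rule integral_dominated_convergence[where w = "\<lambda>_. B"])
    show "AE x in M. (\<lambda>n. if level x \<le> n then g x else 0) \<longlonglongrightarrow> g x"
      by (intro AE_I2 tendsto_eventually) (auto simp: eventually_sequentially)
    show "AE x in M. norm (if level x \<le> n then g x else 0) \<le> B" for n
      using g by (intro AE_I2) (auto intro: order_trans[OF abs_ge_zero])
  qed (auto intro: m)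
  moreover have "(\<integral>x. (if level x \<le> n then g x else 0) \<partial>M) = (\<Sum>x | level x \<le> n. g x * measure M {x})" for n
    by (subst integral_finite_support[OF fin[of n] _ M(2,1)]) (auto intro: sum.cong)
  ultimately show ?thesis
    by simp
qed

locale jump_semigroup = jump_process rate jump level C
  for rate :: "'a::finite \<Rightarrow> 'x::countable \<Rightarrow> real" and jump level C +
  fixes S :: "real \<Rightarrow> 'x \<Rightarrow> 'x measure"
  assumes generator: "has_generator (count_space UNIV) {f. finite {x. f x \<noteq> 0}} gen S"
begin

lemma kernel: "0 \<le> t \<Longrightarrow> S t \<in> count_space UNIV \<rightarrow>\<^sub>M prob_algebra (count_space UNIV)"
  using generator by (simp add: has_generator_def markov_semigroup_def)

lemma kernel': "0 \<le> t \<Longrightarrow> sets M = UNIV \<Longrightarrow> S t \<in> M \<rightarrow>\<^sub>M prob_algebra (count_space UNIV)"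
  using kernel[of t] by (subst measurable_cong_sets[of _ "count_space UNIV"]) auto

lemma kernel_subprob: "0 \<le> t \<Longrightarrow> sets M = UNIV \<Longrightarrow> S t \<in> M \<rightarrow>\<^sub>M subprob_algebra (count_space UNIV)"
  by (intro measurable_prob_algebraD kernel')

lemma prob: "0 \<le> t \<Longrightarrow> prob_space (S t x)"
  and sets: "0 \<le> t \<Longrightarrow> sets (S t x) = UNIV"
  using measurable_space[OF kernel[of t], of x] by (auto simp: space_prob_algebra)

lemma S_0: "S 0 x = return (count_space UNIV) x"
  using generator by (simp add: has_generator_def markov_semigroup_def)

lemma S_add: "0 \<le> t \<Longrightarrow> 0 \<le> u \<Longrightarrow> S (t + u) x = S t x \<bind> S u"
  using generator by (simp add: has_generator_def markov_semigroup_def)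

lemma dynkin:
  "finite {x. f x \<noteq> 0} \<Longrightarrow> 0 \<le> t \<Longrightarrow>
    ((\<lambda>u. \<integral>y. gen f y \<partial>S u x) has_integral ((\<integral>y. f y \<partial>S t x) - f x)) {0..t}"
  using generator by (simp add: has_generator_def)

lemma finite_support_indicator: "finite {x. indicator {z} x \<noteq> (0::real)}"
  by (simp add: indicator_def)

lemma integral_indicator_S: "0 \<le> t \<Longrightarrow> (\<integral>y. indicator {z} y \<partial>S t x) = measure (S t x) {z}"
  by (simp add: sets)

lemma dynkin_indicator:
  "0 \<le> t \<Longrightarrow> ((\<lambda>u. \<integral>y. gen (indicator {z}) y \<partial>S u x) has_integral (measure (S t x) {z} - indicator {z} x)) {0..t}"
  using dynkin[OF finite_support_indicator, of t x z] by (simp only: integral_indicator_S)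

lemma finite_support_bounded:
  fixes f :: "'x \<Rightarrow> real"
  assumes "finite {x. f x \<noteq> 0}"
  obtains B where "\<And>x. \<bar>f x\<bar> \<le> B"
proof -
  have "\<bar>f x\<bar> \<le> Max (insert 0 ((\<lambda>x. \<bar>f x\<bar>) ` {x. f x \<noteq> 0}))" for x
    using assms by (cases "f x = 0") (auto intro!: Max_ge)
  then show ?thesis
    using that by blast
qed

lemma finite_support_level:
  assumes "finite {x. f x \<noteq> (0::real)}"
  obtains n where "\<And>x. n < level x \<Longrightarrow> f x = 0"
proof -
  have "f x = 0" if "Max (insert 0 (level ` {x. f x \<noteq> 0})) < level x" for x
    using that assms by (auto )
  then show ?thesis
    using that by blast
qed

lemma gen_finite_support: "finite {x. f x \<noteq> 0} \<Longrightarrow> finite {x. gen f x \<noteq> 0}"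
proof -
  assume "finite {x. f x \<noteq> 0}"
  then obtain n where n: "\<And>x. n < level x \<Longrightarrow> f x = 0"
    by (rule finite_support_level) blast
  have "{x. gen f x \<noteq> 0} \<subseteq> {x. level x \<le> n + 1}"
    using gen_eq_0[OF n] by (force simp: not_less)
  then show ?thesis
    using finite_level finite_subset by blast
qed

lemma bind_S:
  assumes "prob_space \<pi>" "sets \<pi> = UNIV" "0 \<le> t"
  shows "prob_space (\<pi> \<bind> S t)" "sets (\<pi> \<bind> S t) = UNIV"
    "measure (\<pi> \<bind> S t) {x} = (\<integral>y. measure (S t y) {x} \<partial>\<pi>)"
proof -
  interpret prob_space \<pi> by fact
  have ne: "space \<pi> \<noteq> {}"
    by (rule not_empty)
  note k = kernel_subprob[OF assms(3,2)]
  show s: "sets (\<pi> \<bind> S t) = UNIV"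
    using sets_bind[OF sets_kernel[OF k] ne] by simp
  show p: "prob_space (\<pi> \<bind> S t)"
    using assms by (intro prob_space_bind[OF _ k] AE_I2) (auto intro: prob)
  have "measure (\<pi> \<bind> S t) {x} = (\<integral>y. measure (S t y) {x} \<partial>\<pi>)"
    using k by (intro measure_bind) auto
  then show "measure (\<pi> \<bind> S t) {x} = (\<integral>y. measure (S t y) {x} \<partial>\<pi>)" .
qed

text \<open>Dynkin's formula for point indicators, averaged over the initial law. It is first summed
  over the finitely many states up to level \<open>n\<close>; dominated convergence in time then
  lets \<open>n\<close> grow, the integrand being bounded because \<open>A\<close> has finite
  support.\<close>

lemma forward_solution_bind:
  assumes \<pi>: "prob_space \<pi>" "sets \<pi> = UNIV"
  shows "forward_solution (\<lambda>t. \<pi> \<bind> S t)"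
  unfolding forward_solution_def
proof (intro conjI allI impI)
  fix x and t :: real assume t: "0 \<le> t"
  define A where "A = gen (indicator {x})"
  have A_fin: "finite {y. A y \<noteq> 0}"
    unfolding A_def by (intro gen_finite_support finite_support_indicator)
  obtain B where B: "\<And>y. \<bar>A y\<bar> \<le> B"
    using finite_support_bounded[OF A_fin] by blast
  have B0: "0 \<le> B"
    using B[of x] by linarith
  define f where "f n u = (\<Sum>y | level y \<le> n. (\<integral>z. A z \<partial>S u y) * measure \<pi> {y})" for n u
  define g where "g u = (\<integral>y. (\<integral>z. A z \<partial>S u y) \<partial>\<pi>)" for u
  define v where "v n = (\<Sum>y | level y \<le> n. (measure (S t y) {x} - indicator {x} y) * measure \<pi> {y})" for n
  have AB: "\<bar>\<integral>z. A z \<partial>S u y\<bar> \<le> B" if "0 \<le> u" for u y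
  proof -
    interpret prob_space "S u y" using prob[OF that] .
    have "\<bar>\<integral>z. A z \<partial>S u y\<bar> \<le> (\<integral>z. \<bar>A z\<bar> \<partial>S u y)"
      by (rule integral_abs_bound)
    also have "\<dots> \<le> (\<integral>z. B \<partial>S u y)"
      using B B0 by (intro integral_mono integrable_const_bound[where B = B]) (auto simp: measurable_def sets that)
    finally show ?thesis
      by (simp add: prob_space)
  qed
  interpret \<pi>: prob_space \<pi> by fact
  have int: "(f n has_integral v n) {0..t}" for n
    unfolding f_def v_def A_def
    by (intro has_integral_sum finite_level has_integral_mult_left dynkin_indicator t)
  have f_bound: "norm (f n u) \<le> B" if "u \<in> {0..t}" for n u
  proof -
    have "norm (f n u) \<le> (\<Sum>y | level y \<le> n. \<bar>\<integral>z. A z \<partial>S u y\<bar> * measure \<pi> {y})"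
      unfolding f_def real_norm_def by (rule order_trans[OF sum_abs]) (simp add: abs_mult)
    also have "\<dots> \<le> (\<Sum>y | level y \<le> n. B * measure \<pi> {y})"
      using AB that by (intro sum_mono mult_right_mono) auto
    also have "\<dots> = B * measure \<pi> {y. level y \<le> n}"
      using \<pi>(2) by (subst \<pi>.finite_measure_eq_sum_singleton[OF finite_level]) (auto simp: sum_distrib_left)
    also have "\<dots> \<le> B"
      using B0 by (simp add: mult_left_le)
    finally show ?thesis .
  qed
  have f_lim: "(\<lambda>n. f n u) \<longlonglongrightarrow> g u" if "u \<in> {0..t}" for u
    unfolding f_def g_def using that
    by (intro integral_level_truncation[where B = B] \<pi> finite_level AB) auto
  have v_lim: "v \<longlonglongrightarrow> (\<integral>y. (measure (S t y) {x} - indicator {x} y) \<partial>\<pi>)"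
    unfolding v_def
  proof (intro integral_level_truncation[where B = 1] \<pi> finite_level)
    show "\<bar>measure (S t y) {x} - indicat_real {x} y\<bar> \<le> 1" for y
      using prob_space.prob_le_1[OF prob[OF t, of y], of "{x}"] by (auto simp: indicator_def abs_if)
  qed
  have lim: "g integrable_on {0..t}" "(\<lambda>n. integral {0..t} (f n)) \<longlonglongrightarrow> integral {0..t} g"
    using dominated_convergence[of f "{0..t}" "\<lambda>_. B" g] int f_bound f_lim by (auto simp: integrable_on_def)
  have "(g has_integral (\<integral>y. (measure (S t y) {x} - indicator {x} y) \<partial>\<pi>)) {0..t}"
    using integrable_integral[OF lim(1)] LIMSEQ_unique[OF lim(2)[unfolded integral_unique[OF int]] v_lim] by simp
  also have "(\<integral>y. (measure (S t y) {x} - indicator {x} y) \<partial>\<pi>) = measure (\<pi> \<bind> S t) {x} - measure (\<pi> \<bind> S 0) {x}"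
  proof -
    have m: "f \<in> borel_measurable \<pi>" for f :: "'x \<Rightarrow> real"
      using \<pi>(2) by (simp add: measurable_def)
    have i: "integrable \<pi> (\<lambda>y. measure (S t y) {x})" "integrable \<pi> (\<lambda>y. indicat_real {x} y)"
      by (rule \<pi>.integrable_const_bound[where B = 1];
          auto intro: m simp: prob_space.prob_le_1[OF prob[OF t]] indicator_def)+
    show ?thesis
      unfolding bind_S(3)[OF \<pi> t] bind_S(3)[OF \<pi> order_refl]
      by (subst Bochner_Integration.integral_diff[OF i]) (simp add: S_0 measure_return)
  qed
  finally have *: "(g has_integral (measure (\<pi> \<bind> S t) {x} - measure (\<pi> \<bind> S 0) {x})) {0..t}" .
  have "(\<integral>z. A z \<partial>(\<pi> \<bind> S u)) = g u" if "u \<in> {0..t}" for u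
    unfolding g_def using that
    by (intro integral_bind[where K = "count_space UNIV" and B = B and B' = 1])
       (auto simp: B prob prob_space.emeasure_space_1 \<pi>.finite_measure_axioms kernel_subprob \<pi>)
  then show "((\<lambda>u. \<integral>y. gen (indicator {x}) y \<partial>(\<pi> \<bind> S u)) has_integral
      measure (\<pi> \<bind> S t) {x} - measure (\<pi> \<bind> S 0) {x}) {0..t}"
    unfolding A_def[symmetric] by (intro has_integral_eq[OF _ *]) simp
qed (use bind_S \<pi> in auto)

text \<open>The criterion by which a curve of laws, such as the Poisson mixtures of the BEP, is
  recognised as the evolution under \<open>S\<close>.\<close>

lemma forward_solution_eq_bind:
  assumes "forward_solution \<nu>" "0 \<le> t"
  shows "\<nu> t = \<nu> 0 \<bind> S t"
proof -
  have \<nu>: "prob_space (\<nu> 0)" "sets (\<nu> 0) = UNIV"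
    using assms by (auto simp: forward_solution_def)
  have "\<nu> 0 \<bind> S 0 = \<nu> 0 \<bind> return (count_space UNIV)"
    by (simp add: S_0[abs_def])
  also have "\<dots> = \<nu> 0"
    using \<nu> by (intro bind_return'') auto
  finally show ?thesis
    using forward_solution_unique[OF assms(1) forward_solution_bind[OF \<nu>] _ assms(2)] by simp
qed

section \<open>Positivity of transition probabilities and uniqueness of the invariant law\<close>

lemma measure_S_derivative:
  assumes "0 \<le> t" "t \<le> T"
  shows "((\<lambda>t. measure (S t x) {z}) has_real_derivative (\<integral>y. gen (indicator {z}) y \<partial>S t x)) (at t within {0..T})"
    and "continuous_on {0..T} (\<lambda>t. measure (S t x) {z})"
proof -
  have cont: "continuous_on {0..T} (\<lambda>t. measure (S t x) {z})" for z
  proof -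
    have "continuous_on {0..T} (\<lambda>t. integral {0..t} (\<lambda>u. \<integral>y. gen (indicator {z}) y \<partial>S u x) + indicator {z} x)"
      using dynkin_indicator[of T x z] assms
      by (intro continuous_intros indefinite_integral_continuous_1) (auto simp: integrable_on_def)
    then show ?thesis
      by (rule continuous_on_eq) (simp add: integral_unique[OF dynkin_indicator])
  qed
  then show "continuous_on {0..T} (\<lambda>t. measure (S t x) {z})" .
  define F where "F = {y. gen (indicator {z}) y \<noteq> 0}"
  define g where "g u = (\<Sum>y\<in>F. gen (indicator {z}) y * measure (S u x) {y})" for u
  have g: "(\<integral>y. gen (indicator {z}) y \<partial>S u x) = g u" if "0 \<le> u" for u
    unfolding g_def
    by (rule integral_finite_support)
       (use that in \<open>auto simp: F_def sets prob intro: gen_finite_support finite_support_indicator\<close>)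
  have "((\<lambda>t. integral {0..t} g + indicator {z} x) has_real_derivative g t + 0) (at t within {0..T})"
    using assms unfolding g_def
    by (intro DERIV_add integral_has_real_derivative continuous_intros cont) auto
  moreover have "measure (S u x) {z} = integral {0..u} g + indicator {z} x" if "u \<in> {0..T}" for u
  proof -
    have "(g has_integral (measure (S u x) {z} - indicator {z} x)) {0..u}"
      using that by (intro has_integral_eq[OF _ dynkin_indicator[of u x z]]) (auto simp: g)
    then show ?thesis
      by (simp add: integral_unique)
  qed
  ultimately show "((\<lambda>t. measure (S t x) {z}) has_real_derivative (\<integral>y. gen (indicator {z}) y \<partial>S t x)) (at t within {0..T})"
    using assms by (subst g) (auto intro: has_field_derivative_transform_within[where d = 1])
qed

definition total_rate :: "'x \<Rightarrow> real" where
  "total_rate x = (\<Sum>a\<in>UNIV. rate a x)"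

text \<open>Keep the gain of \<open>z\<close> through the single jump \<open>a\<close> from
  \<open>x\<close>, discard the other gains, and bound the loss by the total rate at
  \<open>z\<close>.\<close>

lemma gen_indicator_lower:
  assumes "z \<noteq> x" "jump a x = z"
  shows "rate a x * indicator {x} y - total_rate z * indicator {z} y \<le> gen (indicator {z}) y"
proof -
  have "(\<Sum>b\<in>UNIV. (if b = a then rate a x * indicator {x} y else 0) - rate b z * indicator {z} y)
      \<le> (\<Sum>b\<in>UNIV. rate b y * (indicator {z} (jump b y) - indicator {z} y))"
    using assms rate_nonneg[of _ y] by (intro sum_mono) (auto simp: indicator_def)
  then show ?thesis
    by (simp add: gen_def total_rate_def sum_subtractf sum_distrib_right)
qed

lemma gen_indicator_lower':
  "- total_rate z * indicator {z} y \<le> gen (indicator {z}) y"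
proof -
  have "(\<Sum>b\<in>UNIV. - (rate b z * indicator {z} y))
      \<le> (\<Sum>b\<in>UNIV. rate b y * (indicator {z} (jump b y) - indicator {z} y))"
    using rate_nonneg[of _ y] by (intro sum_mono) (auto simp: indicator_def)
  then show ?thesis
    by (simp add: gen_def total_rate_def sum_negf sum_distrib_right)
qed

lemma integrable_finite_support:
  fixes f :: "'x \<Rightarrow> real"
  assumes "finite {x. f x \<noteq> 0}" "0 \<le> t"
  shows "integrable (S t x) f"
proof -
  obtain B where "\<And>x. \<bar>f x\<bar> \<le> B"
    using finite_support_bounded[OF assms(1)] by blast
  then show ?thesis
    using assms(2)
    by (intro finite_measure.integrable_const_bound[where B = B] prob_space.finite_measure prob)
       (auto simp: measurable_def sets)
qed

text \<open>Both positivity statements follow from \<open>y' \<ge> - q y + r\<close>, i.e. \<open>(exp (q t) y)' \<ge> r exp (q t)\<close>.\<close>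

lemma measure_S_lower_derivative:
  assumes "0 < u"
  obtains d where "((\<lambda>u. exp (total_rate z * u) * measure (S u x) {z}) has_real_derivative d) (at u)"
    and "0 \<le> d"
    and "z \<noteq> x \<Longrightarrow> jump a x = z \<Longrightarrow> exp (total_rate z * u) * (rate a x * measure (S u x) {x}) \<le> d"
proof -
  define q where "q = total_rate z"
  define m' where "m' = (\<integral>y. gen (indicator {z}) y \<partial>S u x)"
  have u: "0 \<le> u" "at u within {0..u + 1} = at u"
    using assms by (auto intro: at_within_Icc_at)
  have der: "((\<lambda>u. measure (S u x) {z}) has_real_derivative m') (at u)"
    using measure_S_derivative(1)[of u "u + 1" x z] u unfolding m'_def by simp
  have fin: "finite {y. gen (indicator {z}) y \<noteq> 0}"
    by (intro gen_finite_support finite_support_indicator)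
  note int = integrable_finite_support[OF fin u(1)] integrable_finite_support[OF finite_support_indicator u(1)]
  have "(\<integral>y. - q * indicator {z} y \<partial>S u x) \<le> m'"
    unfolding m'_def q_def by (intro integral_mono gen_indicator_lower' int integrable_mult_right)
  then have 1: "0 \<le> q * measure (S u x) {z} + m'"
    by (simp only: integral_mult_right_zero integral_indicator_S[OF u(1)])
  have 2: "rate a x * measure (S u x) {x} \<le> q * measure (S u x) {z} + m'" if "z \<noteq> x" "jump a x = z"
  proof -
    have "(\<integral>y. rate a x * indicator {x} y - q * indicator {z} y \<partial>S u x) \<le> m'"
      unfolding m'_def q_def
      by (intro integral_mono gen_indicator_lower that int integrable_mult_right Bochner_Integration.integrable_diff)
    also have "(\<integral>y. rate a x * indicator {x} y - q * indicator {z} y \<partial>S u x)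
        = rate a x * measure (S u x) {x} - q * measure (S u x) {z}"
      by (subst Bochner_Integration.integral_diff)
         (simp_all only: integral_mult_right_zero integral_indicator_S[OF u(1)] integrable_mult_right int)
    finally show ?thesis
      by simp
  qed
  have "((\<lambda>u. exp (q * u) * measure (S u x) {z}) has_real_derivative
      exp (q * u) * (q * measure (S u x) {z} + m')) (at u)"
    by (rule derivative_eq_intros der refl | simp add: algebra_simps)+
  then show ?thesis
    using 1 2 that[of "exp (q * u) * (q * measure (S u x) {z} + m')"] by (auto simp: q_def mult_left_mono)
qed

lemma continuous_exp_measure_S: "continuous_on {0..T} (\<lambda>u. exp (q * u) * measure (S u x) {z})"
proof (cases "0 \<le> T")
  case True
  then show ?thesis
    using measure_S_derivative(2)[of T T x z] by (intro continuous_intros) auto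
qed simp

lemma measure_S_diagonal_pos:
  assumes "0 \<le> t"
  shows "0 < measure (S t x) {x}"
proof (cases "t = 0")
  case False
  then have "0 < t"
    using assms by simp
  moreover have "\<exists>d. ((\<lambda>u. exp (total_rate x * u) * measure (S u x) {x}) has_real_derivative d) (at u) \<and> 0 \<le> d" if "0 < u" for u
    using measure_S_lower_derivative[OF that, of x x] by metis
  ultimately have "exp (total_rate x * 0) * measure (S 0 x) {x} \<le> exp (total_rate x * t) * measure (S t x) {x}"
    using continuous_exp_measure_S[of t "total_rate x" x x]
    by (intro DERIV_nonneg_imp_increasing_open[where f = "\<lambda>u. exp (total_rate x * u) * measure (S u x) {x}"]) auto
  then have "0 < exp (total_rate x * t) * measure (S t x) {x}"
    by (simp add: S_0 measure_return)
  then show ?thesis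
    by (simp add: zero_less_mult_iff)
qed (simp add: S_0 measure_return)

lemma measure_S_jump_pos:
  assumes "0 < rate a x" "0 < t"
  shows "0 < measure (S t x) {jump a x}"
proof (cases "jump a x = x")
  case True
  then show ?thesis
    using measure_S_diagonal_pos[of t x] assms by simp
next
  case False
  let ?z = "jump a x"
  have "\<exists>d. ((\<lambda>u. exp (total_rate ?z * u) * measure (S u x) {?z}) has_real_derivative d) (at u) \<and> 0 < d"
    if u: "0 < u" for u
  proof -
    have pos: "0 < exp (total_rate ?z * u) * (rate a x * measure (S u x) {x})"
      using assms(1) measure_S_diagonal_pos[of u x] u by (intro mult_pos_pos) auto
    show ?thesis
      by (rule measure_S_lower_derivative[OF u, of ?z x a])
         (use pos False in \<open>blast intro: order.strict_trans2\<close>)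
  qed
  then have "exp (total_rate ?z * 0) * measure (S 0 x) {?z} < exp (total_rate ?z * t) * measure (S t x) {?z}"
    using continuous_exp_measure_S[of t "total_rate ?z" x ?z] assms(2)
    by (intro DERIV_pos_imp_increasing_open[where f = "\<lambda>u. exp (total_rate ?z * u) * measure (S u x) {?z}"]) auto
  then have "0 < exp (total_rate ?z * t) * measure (S t x) {?z}"
    using False by (simp add: S_0 measure_return)
  then show ?thesis
    by (simp add: zero_less_mult_iff)
qed

text \<open>Each jump of positive rate has positive probability at time 1, so a path of jumps is a
  path of the discrete chain \<open>S 1\<close>.\<close>

lemma invariant_unique:
  assumes reach: "\<And>x. (x, z) \<in> {(x, y). \<exists>a. 0 < rate a x \<and> y = jump a x}\<^sup>*"
    and "prob_space \<mu>" "sets \<mu> = UNIV" "\<mu> \<bind> S 1 = \<mu>"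
    and "prob_space \<nu>" "sets \<nu> = UNIV" "\<nu> \<bind> S 1 = \<nu>"
  shows "\<mu> = \<nu>"
proof (rule invariant_law_unique[where P = "S 1" and z = z])
  have "{(x, y). \<exists>a. 0 < rate a x \<and> y = jump a x} \<subseteq> {(x, y). 0 < emeasure (S 1 x) {y}}"
    using measure_S_jump_pos[of _ _ 1]
    by (auto simp: finite_measure.emeasure_eq_measure[OF prob_space.finite_measure[OF prob]])
  from rtrancl_mono[OF this] show "(x, z) \<in> {(x, y). 0 < emeasure (S 1 x) {y}}\<^sup>*" for x
    using reach[of x] by blast
qed (simp_all add: assms(2-) prob sets)

lemma bind_S_add:
  assumes "sets \<mu> = UNIV" "0 \<le> t" "0 \<le> u"
  shows "\<mu> \<bind> S t \<bind> S u = \<mu> \<bind> S (t + u)"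
proof -
  have "\<mu> \<bind> S t \<bind> S u = \<mu> \<bind> (\<lambda>x. S t x \<bind> S u)"
    by (rule bind_assoc[OF kernel_subprob kernel_subprob]) (simp_all add: assms)
  also have "(\<lambda>x. S t x \<bind> S u) = S (t + u)"
    using assms S_add by (intro ext) auto
  finally show ?thesis .
qed

text \<open>Since \<open>S t\<close> and \<open>S 1\<close> commute,
  \<open>\<mu> \<bind> S t\<close> is again invariant under \<open>S 1\<close>, and uniqueness
  identifies it with \<open>\<mu>\<close>.\<close>

lemma invariant_all_times:
  assumes reach: "\<And>x. (x, z) \<in> {(x, y). \<exists>a. 0 < rate a x \<and> y = jump a x}\<^sup>*"
    and \<mu>: "prob_space \<mu>" "sets \<mu> = UNIV" "\<mu> \<bind> S 1 = \<mu>" and t: "0 \<le> t"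
  shows "\<mu> \<bind> S t = \<mu>"
proof (rule invariant_unique[OF reach])
  have "\<mu> \<bind> S t \<bind> S 1 = \<mu> \<bind> S 1 \<bind> S t"
    using \<mu>(2) t by (simp only: bind_S_add add.commute zero_le_one)
  then show "\<mu> \<bind> S t \<bind> S 1 = \<mu> \<bind> S t"
    using \<mu>(3) by simp
qed (simp_all add: bind_S[OF \<mu>(1,2) t] \<mu>)

end

section \<open>A Lyapunov bound at integer times\<close>

context jump_semigroup
begin

lemma gen_diff_const: "gen (\<lambda>y. f y - c) = gen f"
  by (simp add: gen_def fun_eq_iff)

lemma integrable_bounded:
  fixes f :: "'x \<Rightarrow> real"
  assumes "\<And>y. \<bar>f y\<bar> \<le> B" "0 \<le> t"
  shows "integrable (S t x) f"
  using assms
  by (intro finite_measure.integrable_const_bound[where B = B] prob_space.finite_measure prob)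
     (auto simp: measurable_def sets)

text \<open>Functions that are constant off a finite set become admissible in Dynkin's formula after
  subtracting the constant, which the generator does not see.\<close>

lemma expectation_increment:
  assumes fin: "finite {y. f y \<noteq> b}" and r: "0 \<le> r" "r \<le> t"
    and le: "\<And>u. r \<le> u \<Longrightarrow> u \<le> t \<Longrightarrow> (\<integral>y. gen f y \<partial>S u x) \<le> c"
  shows "(\<integral>y. f y \<partial>S t x) \<le> (\<integral>y. f y \<partial>S r x) + c * (t - r)"
proof -
  let ?g = "\<lambda>u. \<integral>y. gen f y \<partial>S u x"
  have fin': "finite {y. f y - b \<noteq> 0}"
    using fin by simp
  have int: "(?g has_integral ((\<integral>y. f y \<partial>S u x) - f x)) {0..u}" if "0 \<le> u" for u
  proof -
    interpret prob_space "S u x"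
      by (rule prob[OF that])
    have "integrable (S u x) (\<lambda>y. f y - b)"
      by (rule integrable_finite_support[OF fin' that])
    then have "integrable (S u x) f"
      using Bochner_Integration.integrable_add[of "S u x" "\<lambda>y. f y - b" "\<lambda>_. b"] by simp
    then have "(\<integral>y. f y - b \<partial>S u x) = (\<integral>y. f y \<partial>S u x) - b"
      by (simp add: prob_space)
    then show ?thesis
      using dynkin[OF fin' that, of x] by (simp add: gen_diff_const)
  qed
  have "?g integrable_on {0..t}"
    using int[of t] r by (auto simp: integrable_on_def)
  then have "integral {0..r} ?g + integral {r..t} ?g = integral {0..t} ?g"
    using r by (intro Henstock_Kurzweil_Integration.integral_combine)
  then have "(\<integral>y. f y \<partial>S t x) - (\<integral>y. f y \<partial>S r x) = integral {r..t} ?g"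
    using integral_unique[OF int[of t]] integral_unique[OF int[of r]] r by simp
  also have "\<dots> \<le> integral {r..t} (\<lambda>_. c)"
  proof (rule integral_le)
    show "?g integrable_on {r..t}"
      using \<open>?g integrable_on {0..t}\<close> r by (elim integrable_on_subinterval) auto
  qed (use le in auto)
  finally show ?thesis
    using r by (simp add: mult.commute)
qed

text \<open>\<open>h\<close> is unbounded, so it is replaced by \<open>min M h\<close>, which is
  constant off a finite set. Dynkin's formula is available only for functions independent of time,
  so instead of weighting by an exponential in time the bound is propagated over unit steps.\<close>

lemma lyapunov_bound:
  fixes h :: "'x \<Rightarrow> real"
  assumes h: "\<And>y. 0 \<le> h y" "h x = 0" and fin: "\<And>M. finite {y. h y < M}"
    and drift: "\<And>y. gen h y \<le> K - \<epsilon> * h y" and K: "0 \<le> K" and \<epsilon>: "0 < \<epsilon>" and N: "0 < N"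
  shows "(\<integral>y. min N (h y) \<partial>S (real k) x) \<le> K * (1 + \<epsilon>) / \<epsilon>"
proof -
  \<comment> \<open>\<open>B\<close> solves
    \<open>B + K * (1 + \<epsilon>) = (1 + \<epsilon>) * B\<close>: it is the fixed point of the
    recursion obtained below for \<open>M\<close> tending to infinity.\<close>
  define B where "B = K * (1 + \<epsilon>) / \<epsilon>"
  define f where "f M y = min M (h y)" for M y
  define m where "m M t = (\<integral>y. f M y \<partial>S t x)" for M t
  have fM_fin: "finite {y. f M y \<noteq> M}" for M
    by (rule finite_subset[OF _ fin[of M]]) (auto simp: f_def)
  have f_bounds: "0 \<le> f M y" "f M y \<le> M" "f M y \<le> h y" if "0 < M" for M y
    using that h(1)[of y] by (auto simp: f_def)
  have f_int: "integrable (S t x) (f M)" if "0 < M" "0 \<le> t" for M t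
    using f_bounds[OF that(1)] that(2) by (intro integrable_bounded[where B = M]) (auto simp: abs_of_nonneg)
  have gen_f1: "gen (f M) y \<le> 0" if "M \<le> h y" for M y
    using that rate_nonneg by (auto simp: gen_def f_def intro!: sum_nonpos mult_nonneg_nonpos)
  have gen_f2: "gen (f M) y \<le> gen h y" if "h y < M" for M y
    using that rate_nonneg by (auto simp: gen_def f_def intro!: sum_mono mult_left_mono)
  \<comment> \<open>Two truncation levels are used. Below \<open>M\<close> the drift bound holds;
    from \<open>M\<close> on the generator is nonpositive, \<open>f M\<close> equals
    \<open>M\<close> and \<open>f N'\<close> equals \<open>N'\<close>, so the last term exactly
    offsets \<open>- \<epsilon> * N'\<close>. Its expectation vanishes as \<open>M\<close> grows
    with \<open>N'\<close> fixed.\<close>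
  have gen_f: "gen (f M) y \<le> K - \<epsilon> * f N' y + \<epsilon> * N' / M * f M y" if "0 < N'" "N' \<le> M" for M N' y
  proof (cases "h y < M")
    case True
    then have "gen (f M) y \<le> K - \<epsilon> * h y"
      using gen_f2[OF True] drift[of y] by linarith
    also have "\<dots> \<le> K - \<epsilon> * f N' y"
      using \<epsilon> f_bounds[OF that(1)] by simp
    also have "\<dots> \<le> K - \<epsilon> * f N' y + \<epsilon> * N' / M * f M y"
      using \<epsilon> that f_bounds(1)[of M y] by simp
    finally show ?thesis .
  next
    case False
    then have "f M y = M" "f N' y = N'"
      using that by (auto simp: f_def)
    then show ?thesis
      using gen_f1[of M y] False K that \<epsilon> by simp
  qed
  have gen_K: "gen (f M) y \<le> K" if "0 < M" for M y
  proof (cases "h y < M")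
    case True
    have "gen h y \<le> K"
      using drift[of y] mult_nonneg_nonneg[of \<epsilon> "h y"] \<epsilon> h(1)[of y] by linarith
    with gen_f2[OF True] show ?thesis by linarith
  qed (use gen_f1[of M y] K in auto)
  have gen_int: "integrable (S t x) (gen (f M))" if "0 \<le> t" for M t
    using integrable_finite_support[OF gen_finite_support[of "\<lambda>y. f M y - M"] that] fM_fin[of M]
    by (simp add: gen_diff_const)
  have m_mono: "m M t \<le> m M r + K * (t - r)" if "0 < M" "0 \<le> r" "r \<le> t" for M r t
    unfolding m_def
  proof (intro expectation_increment[OF fM_fin] that)
    fix u assume u: "r \<le> u" "u \<le> t"
    then interpret prob_space "S u x"
      using that by (intro prob) auto
    have "(\<integral>y. gen (f M) y \<partial>S u x) \<le> (\<integral>y. K \<partial>S u x)"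
      using u that by (intro integral_mono gen_int gen_K) auto
    then show "(\<integral>y. gen (f M) y \<partial>S u x) \<le> K"
      by (simp add: prob_space)
  qed
  have m_0: "m M 0 = 0" if "0 < M" for M
    using that h(2) by (simp add: m_def S_0 f_def integral_return)
  \<comment> \<open>Since \<open>m N'\<close> increases at rate at most \<open>K\<close>, its value
    anywhere in the unit interval before \<open>t\<close> is at least \<open>m N' t - K\<close>; so
    the dissipation may be evaluated at the end point \<open>t\<close>.\<close>
  have step: "m M t \<le> m M (t - 1) + (K - \<epsilon> * (m N' t - K) + \<epsilon> * N' * K * t / M)"
    if "0 < N'" "N' \<le> M" "1 \<le> t" for M N' t
  proof -
    have M: "0 < M" using that by simp
    have "m M t \<le> m M (t - 1) + (K - \<epsilon> * (m N' t - K) + \<epsilon> * N' * K * t / M) * (t - (t - 1))"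
      unfolding m_def[of M]
    proof (rule expectation_increment[OF fM_fin])
      fix u assume u: "t - 1 \<le> u" "u \<le> t"
      then have u0: "0 \<le> u" using that by simp
      interpret prob_space "S u x"
        using u0 by (rule prob)
      have "(\<integral>y. gen (f M) y \<partial>S u x) \<le> (\<integral>y. K - \<epsilon> * f N' y + \<epsilon> * N' / M * f M y \<partial>S u x)"
        using f_int[OF that(1) u0] f_int[OF M u0] gen_f[OF that(1,2)] by (intro integral_mono gen_int[OF u0]) auto
      also have "\<dots> = K - \<epsilon> * m N' u + \<epsilon> * N' / M * m M u"
        using f_int[OF that(1) u0] f_int[OF M u0] by (simp add: prob_space m_def)
      also have "\<dots> \<le> K - \<epsilon> * (m N' t - K) + \<epsilon> * N' / M * (K * t)"
      proof -
        have "K * (t - u) \<le> K * 1"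
          using K u by (intro mult_left_mono) auto
        then have "m N' t - K \<le> m N' u"
          using m_mono[OF that(1) u0 u(2)] by simp
        moreover have "K * u \<le> K * t"
          using K u by (intro mult_left_mono) auto
        then have "m M u \<le> K * t"
          using m_mono[OF M order_refl u0] m_0[OF M] by simp
        ultimately show ?thesis
          using \<epsilon> that M by (intro add_mono diff_mono mult_left_mono) auto
      qed
      finally show "(\<integral>y. gen (f M) y \<partial>S u x) \<le> K - \<epsilon> * (m N' t - K) + \<epsilon> * N' * K * t / M"
        by (simp add: mult_ac)
    qed (use that in auto)
    then show ?thesis by simp
  qed
  \<comment> \<open>The induction must run for all truncations at once: the step for
    \<open>N\<close> uses the hypothesis for every larger \<open>M\<close> and then lets
    \<open>M\<close> tend to infinity.\<close>
  have "m N (real k) \<le> B" if "0 < N" for N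
    using that
  proof (induction k arbitrary: N)
    case 0
    then show ?case
      using K \<epsilon> by (simp add: m_0 B_def)
  next
    case (Suc k)
    let ?t = "real (Suc k)"
    have "m N ?t \<le> B + (K - \<epsilon> * (m N ?t - K) + \<epsilon> * N * K * ?t / M)" if "N \<le> M" for M
    proof -
      have "m N ?t \<le> m M ?t"
        unfolding m_def using Suc.prems that by (intro integral_mono f_int) (auto simp: f_def)
      also have "\<dots> \<le> m M (?t - 1) + (K - \<epsilon> * (m N ?t - K) + \<epsilon> * N * K * ?t / M)"
        using Suc.prems that by (intro step) auto
      also have "m M (?t - 1) \<le> B"
        using Suc.IH[of M] Suc.prems that by simp
      finally show ?thesis by simp
    qed
    then have ev: "\<forall>\<^sub>F M in at_top. m N ?t \<le> B + (K - \<epsilon> * (m N ?t - K) + \<epsilon> * N * K * ?t / M)"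
      by (intro eventually_mono[OF eventually_ge_at_top[of N]])
    have "((\<lambda>M. B + (K - \<epsilon> * (m N ?t - K) + \<epsilon> * N * K * ?t / M)) \<longlongrightarrow> B + (K - \<epsilon> * (m N ?t - K) + 0)) at_top"
      by (intro tendsto_intros real_tendsto_divide_at_top[OF tendsto_const] filterlim_ident)
    from tendsto_lowerbound[OF this ev] have "m N ?t \<le> B + (K - \<epsilon> * (m N ?t - K))"
      by simp
    moreover have "K * (1 + \<epsilon>) = \<epsilon> * B"
      using \<epsilon> by (simp add: B_def)
    ultimately have "(1 + \<epsilon>) * m N ?t \<le> (1 + \<epsilon>) * B"
      by (simp add: algebra_simps)
    then show ?case
      using \<epsilon> by simp
  qed
  from this[OF N] show ?thesis
    by (simp add: m_def f_def B_def)
qed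

end

section \<open>The boundary driven inclusion process as a jump process\<close>

locale boundary_driven_sip =
  fixes s :: real and p :: "'v::finite \<Rightarrow> 'v \<Rightarrow> real" and c \<alpha> \<gamma> :: "'v \<Rightarrow> real"
  assumes s_pos: "0 < s"
    and p_nonneg: "\<And>i j. 0 \<le> p i j" and p_sym: "\<And>i j. p i j = p j i"
    and irreducible: "\<And>i j. (i, j) \<in> {(k, l). 0 < p k l}\<^sup>*"
    and c_nonneg: "\<And>i. 0 \<le> c i" and c_pos: "\<exists>i. 0 < c i"
    and \<alpha>_nonneg: "\<And>i. 0 \<le> \<alpha> i" and \<gamma>_nonneg: "\<And>i. 0 \<le> \<gamma> i" and \<alpha>_less_\<gamma>: "\<And>i. \<alpha> i < \<gamma> i"
begin

text \<open>In a transition \<open>(a, b)\<close> a particle moves from \<open>a\<close> to \<open>b\<close>, where \<open>None\<close> is the reservoir.\<close>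

fun sip_rate :: "'v option \<times> 'v option \<Rightarrow> ('v \<Rightarrow> nat) \<Rightarrow> real" where
  "sip_rate (Some i, Some j) \<eta> = (if i = j then 0 else 2 * p i j * real (\<eta> i) * (2 * s + real (\<eta> j)))"
| "sip_rate (None, Some i) \<eta> = c i * \<alpha> i * (2 * s + real (\<eta> i))"
| "sip_rate (Some i, None) \<eta> = c i * \<gamma> i * real (\<eta> i)"
| "sip_rate (None, None) \<eta> = 0"

fun sip_jump :: "'v option \<times> 'v option \<Rightarrow> ('v \<Rightarrow> nat) \<Rightarrow> 'v \<Rightarrow> nat" where
  "sip_jump (Some i, Some j) \<eta> = \<eta>(i := \<eta> i - 1, j := \<eta> j + 1)"
| "sip_jump (None, Some i) \<eta> = \<eta>(i := \<eta> i + 1)"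
| "sip_jump (Some i, None) \<eta> = \<eta>(i := \<eta> i - 1)"
| "sip_jump (None, None) \<eta> = \<eta>"

definition particles :: "('v \<Rightarrow> nat) \<Rightarrow> nat" where
  "particles \<eta> = (\<Sum>i\<in>UNIV. \<eta> i)"

text \<open>The factor \<open>2 * s + 1\<close> comes from
  \<open>2 * s + \<eta> i \<le> (2 * s + 1) * (1 + particles \<eta>)\<close>.\<close>

definition boundary_rate :: real where
  "boundary_rate = (2 * s + 1) * (\<Sum>i\<in>UNIV. c i * (\<alpha> i + \<gamma> i))"

lemma particles_upd: "particles (\<eta>(i := k)) + \<eta> i = particles \<eta> + k"
  unfolding particles_def by (subst (1 2) sum.remove[of _ i]) auto

lemma component_le_particles: "\<eta> i \<le> particles \<eta>"
  unfolding particles_def by (intro member_le_sum) auto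

lemma sip_rate_le_boundary_rate:
  "c i * \<alpha> i * (2 * s + real (\<eta> i)) \<le> boundary_rate * (1 + real (particles \<eta>))"
  "c i * \<gamma> i * real (\<eta> i) \<le> boundary_rate * (1 + real (particles \<eta>))"
proof -
  have le: "c i * (\<alpha> i + \<gamma> i) \<le> (\<Sum>i\<in>UNIV. c i * (\<alpha> i + \<gamma> i))"
    by (intro member_le_sum mult_nonneg_nonneg add_nonneg_nonneg c_nonneg \<alpha>_nonneg \<gamma>_nonneg) auto
  have "real (\<eta> i) \<le> real (particles \<eta>)"
    using component_le_particles[of \<eta> i] by simp
  have r: "2 * s + real (\<eta> i) \<le> (2 * s + 1) * (1 + real (particles \<eta>))"
  proof -
    have "(2 * s + 1) * (1 + real (particles \<eta>)) = 2 * s + 1 + real (particles \<eta>) + 2 * (s * real (particles \<eta>))"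
      by (simp add: algebra_simps)
    moreover have "0 \<le> s * real (particles \<eta>)"
      using s_pos by simp
    ultimately show ?thesis
      using \<open>real (\<eta> i) \<le> real (particles \<eta>)\<close> by linarith
  qed
  have *: "k * x \<le> boundary_rate * (1 + real (particles \<eta>))"
    if "k \<le> c i * (\<alpha> i + \<gamma> i)" "x \<le> 2 * s + real (\<eta> i)" "0 \<le> x" for k x
  proof -
    have "k * x \<le> (\<Sum>i\<in>UNIV. c i * (\<alpha> i + \<gamma> i)) * ((2 * s + 1) * (1 + real (particles \<eta>)))"
      using that le r by (intro mult_mono) (auto intro!: sum_nonneg mult_nonneg_nonneg c_nonneg \<alpha>_nonneg \<gamma>_nonneg add_nonneg_nonneg)
    then show ?thesis
      by (simp add: boundary_rate_def mult_ac)
  qed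
  have "c i * \<alpha> i \<le> c i * (\<alpha> i + \<gamma> i)" "c i * \<gamma> i \<le> c i * (\<alpha> i + \<gamma> i)"
    by (simp_all add: mult_left_mono c_nonneg \<alpha>_nonneg \<gamma>_nonneg)
  then show "c i * \<alpha> i * (2 * s + real (\<eta> i)) \<le> boundary_rate * (1 + real (particles \<eta>))"
    "c i * \<gamma> i * real (\<eta> i) \<le> boundary_rate * (1 + real (particles \<eta>))"
    using s_pos by (auto intro!: *)
qed

sublocale jump_process sip_rate sip_jump particles boundary_rate
proof
  fix a :: "'v option \<times> 'v option" and \<eta> :: "'v \<Rightarrow> nat" and n :: nat
  show "0 \<le> sip_rate a \<eta>"
    using s_pos by (cases "(a, \<eta>)" rule: sip_rate.cases)
      (auto intro!: mult_nonneg_nonneg p_nonneg c_nonneg \<alpha>_nonneg \<gamma>_nonneg)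
  have "{\<eta>. particles \<eta> \<le> n} \<subseteq> {\<eta>. \<forall>i. (i \<in> UNIV \<longrightarrow> \<eta> i \<in> {..n}) \<and> (i \<notin> UNIV \<longrightarrow> \<eta> i = 0)}"
    using component_le_particles by (auto intro: order_trans)
  then show "finite {\<eta>. particles \<eta> \<le> n}"
    by (rule finite_subset) (intro finite_set_of_finite_funs; simp)
  show "particles (sip_jump a \<eta>) \<le> particles \<eta> + 1 \<and> particles \<eta> \<le> particles (sip_jump a \<eta>) + 1"
    if "sip_rate a \<eta> \<noteq> 0"
    using that
  proof (cases "(a, \<eta>)" rule: sip_rate.cases)
    case (1 i j)
    then have "i \<noteq> j" "0 < \<eta> i"
      using that by (auto split: if_splits)
    then show ?thesis
      using 1 particles_upd[of \<eta> i "\<eta> i - 1"] particles_upd[of "\<eta>(i := \<eta> i - 1)" j "\<eta> j + 1"] by auto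
  next
    case (2 i)
    then show ?thesis
      using particles_upd[of \<eta> i "\<eta> i + 1"] by auto
  next
    case (3 i)
    then show ?thesis
      using that particles_upd[of \<eta> i "\<eta> i - 1"] by auto
  qed auto
  show "sip_rate a \<eta> \<le> boundary_rate * (1 + real (particles \<eta>))"
    if "particles (sip_jump a \<eta>) \<noteq> particles \<eta>"
  proof (cases "(a, \<eta>)" rule: sip_rate.cases)
    case (1 i j)
    \<comment> \<open>An exchange changes the particle number only through truncated subtraction at
      an empty site, and then its rate is 0.\<close>
    have "\<eta> i = 0" if "i \<noteq> j"
      using that \<open>particles (sip_jump a \<eta>) \<noteq> particles \<eta>\<close> 1
        particles_upd[of \<eta> i "\<eta> i - 1"] particles_upd[of "\<eta>(i := \<eta> i - 1)" j "\<eta> j + 1"] by auto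
    moreover have "0 \<le> boundary_rate"
      unfolding boundary_rate_def using s_pos
      by (intro mult_nonneg_nonneg sum_nonneg add_nonneg_nonneg c_nonneg \<alpha>_nonneg \<gamma>_nonneg) auto
    ultimately show ?thesis
      using 1 by auto
  qed (use that sip_rate_le_boundary_rate in auto)
qed

lemma sum_option: "(\<Sum>a\<in>UNIV. F a) = F None + (\<Sum>i\<in>UNIV. F (Some i))" for F :: "'v option \<Rightarrow> real"
  by (simp add: UNIV_option_conv sum.reindex)

text \<open>The sum runs over ordered pairs and each edge operator contains both directions. With
  \<open>p\<close> symmetric, a particle therefore moves from \<open>i\<close> to \<open>j\<close>
  with weight \<open>2 * p i j\<close>, the factor 2 in \<open>sip_rate\<close>.\<close>

lemma gen_eq_sip_generator: "gen f \<eta> = sip_generator s p c \<alpha> \<gamma> f \<eta>"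
proof -
  define R where "R i j = real (\<eta> i) * (2 * s + real (\<eta> j)) * (f (\<eta>(i := \<eta> i - 1, j := \<eta> j + 1)) - f \<eta>)" for i j
  define Q where "Q i j = (if i = j then 0 else p i j * R i j)" for i j
  have e: "p i j * sip_edge s i j f \<eta> = Q i j + Q j i" if "j \<in> UNIV - {i}" for i j
  proof -
    have "\<eta>(i := \<eta> i + 1, j := \<eta> j - 1) = \<eta>(j := \<eta> j - 1, i := \<eta> i + 1)"
      using that by (auto simp: fun_upd_twist)
    then show ?thesis
      using that p_sym[of i j] by (simp add: sip_edge_def Q_def R_def algebra_simps)
  qed
  have d: "(\<Sum>j\<in>UNIV. Q i j + Q j i) = (\<Sum>j\<in>UNIV - {i}. Q i j + Q j i)" for i
    by (subst sum.remove[of _ i]) (auto simp: Q_def)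
  have "(\<Sum>i\<in>UNIV. \<Sum>j\<in>UNIV - {i}. p i j * sip_edge s i j f \<eta>) = (\<Sum>i\<in>UNIV. \<Sum>j\<in>UNIV. Q i j + Q j i)"
    unfolding d by (intro sum.cong refl e)
  also have "\<dots> = (\<Sum>i\<in>UNIV. \<Sum>j\<in>UNIV. Q i j) + (\<Sum>i\<in>UNIV. \<Sum>j\<in>UNIV. Q j i)"
    by (simp add: sum.distrib)
  also have "(\<Sum>i\<in>UNIV. \<Sum>j\<in>UNIV. Q j i) = (\<Sum>i\<in>UNIV. \<Sum>j\<in>UNIV. Q i j)"
    by (rule sum.swap)
  finally have edges: "(\<Sum>i\<in>UNIV. \<Sum>j\<in>UNIV - {i}. p i j * sip_edge s i j f \<eta>) = (\<Sum>i\<in>UNIV. \<Sum>j\<in>UNIV. 2 * Q i j)"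
    by (simp add: sum_distrib_left)
  have sites: "(\<Sum>i\<in>UNIV. c i * sip_site s (\<alpha> i) (\<gamma> i) i f \<eta>)
      = (\<Sum>i\<in>UNIV. sip_rate (None, Some i) \<eta> * (f (sip_jump (None, Some i) \<eta>) - f \<eta>))
      + (\<Sum>i\<in>UNIV. sip_rate (Some i, None) \<eta> * (f (sip_jump (Some i, None) \<eta>) - f \<eta>))"
    by (simp add: sum.distrib[symmetric] sip_site_def algebra_simps)
  have "gen f \<eta> = (\<Sum>a\<in>UNIV. \<Sum>b\<in>UNIV. sip_rate (a, b) \<eta> * (f (sip_jump (a, b) \<eta>) - f \<eta>))"
    unfolding gen_def UNIV_Times_UNIV[symmetric] sum.cartesian_product by simp
  also have "\<dots> = (\<Sum>i\<in>UNIV. sip_rate (None, Some i) \<eta> * (f (sip_jump (None, Some i) \<eta>) - f \<eta>))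
      + (\<Sum>i\<in>UNIV. sip_rate (Some i, None) \<eta> * (f (sip_jump (Some i, None) \<eta>) - f \<eta>)
         + (\<Sum>j\<in>UNIV. sip_rate (Some i, Some j) \<eta> * (f (sip_jump (Some i, Some j) \<eta>) - f \<eta>)))"
    by (simp only: sum_option) simp
  also have "(\<lambda>i j. sip_rate (Some i, Some j) \<eta> * (f (sip_jump (Some i, Some j) \<eta>) - f \<eta>)) = (\<lambda>i j. 2 * Q i j)"
    by (auto simp: fun_eq_iff Q_def R_def)
  finally show ?thesis
    unfolding sip_generator_def edges sites by (simp only: sum.distrib)
qed

lemma gen_sip: "gen = sip_generator s p c \<alpha> \<gamma>"
  by (intro ext gen_eq_sip_generator)

abbreviation transitions :: "(('v \<Rightarrow> nat) \<times> ('v \<Rightarrow> nat)) set" where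
  "transitions \<equiv> {(\<eta>, \<xi>). \<exists>a. 0 < sip_rate a \<eta> \<and> \<xi> = sip_jump a \<eta>}"

text \<open>One particle is led along a path of positive \<open>p\<close> to a site \<open>k\<close>
  with \<open>c k > 0\<close>, where \<open>\<gamma> k > \<alpha> k \<ge> 0\<close> lets it leave.
  The moves have positive rate even towards an empty site because \<open>s > 0\<close>.\<close>

lemma remove_particle:
  assumes "0 < \<eta> i"
  shows "\<exists>\<xi>. (\<eta>, \<xi>) \<in> transitions\<^sup>* \<and> particles \<xi> + 1 = particles \<eta>"
proof -
  obtain k where k: "0 < c k"
    using c_pos by blast
  have "\<forall>\<eta>. 0 < \<eta> i \<longrightarrow> (\<exists>\<xi>. (\<eta>, \<xi>) \<in> transitions\<^sup>* \<and> particles \<xi> + 1 = particles \<eta>)"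
    using irreducible[of i k]
  proof (induction rule: converse_rtrancl_induct)
    case base
    show ?case
    proof (intro allI impI)
      fix \<eta> :: "'v \<Rightarrow> nat" assume \<eta>: "0 < \<eta> k"
      have "0 < \<gamma> k"
        using \<alpha>_nonneg[of k] \<alpha>_less_\<gamma>[of k] by linarith
      then have "0 < sip_rate (Some k, None) \<eta>"
        using \<eta> k by simp
      then have "(\<eta>, \<eta>(k := \<eta> k - 1)) \<in> transitions"
        using sip_jump.simps(3)[of k \<eta>] by (metis (mono_tags, lifting) case_prodI mem_Collect_eq)
      then show "\<exists>\<xi>. (\<eta>, \<xi>) \<in> transitions\<^sup>* \<and> particles \<xi> + 1 = particles \<eta>"
        using particles_upd[of \<eta> k "\<eta> k - 1"] \<eta> by (intro exI[of _ "\<eta>(k := \<eta> k - 1)"]) auto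
    qed
  next
    case (step i j)
    show ?case
    \<comment> \<open>The path may contain a loop, since \<open>p i i\<close> can be positive; a
      loop is no transition and is skipped.\<close>
    proof (cases "i = j")
      case False
      show ?thesis
      proof (intro allI impI)
        fix \<eta> :: "'v \<Rightarrow> nat" assume \<eta>: "0 < \<eta> i"
        let ?\<eta>' = "\<eta>(i := \<eta> i - 1, j := \<eta> j + 1)"
        have "0 < sip_rate (Some i, Some j) \<eta>"
          using \<eta> False step s_pos by (auto intro!: mult_pos_pos add_pos_nonneg)
        then have 1: "(\<eta>, ?\<eta>') \<in> transitions"
          using sip_jump.simps(1)[of i j \<eta>] by (metis (mono_tags, lifting) case_prodI mem_Collect_eq)
        have 2: "particles ?\<eta>' = particles \<eta>"
          using particles_upd[of \<eta> i "\<eta> i - 1"] particles_upd[of "\<eta>(i := \<eta> i - 1)" j "\<eta> j + 1"] \<eta> False by auto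
        have "0 < ?\<eta>' j"
          by simp
        then obtain \<xi> where \<xi>: "(?\<eta>', \<xi>) \<in> transitions\<^sup>*" "particles \<xi> + 1 = particles ?\<eta>'"
          using step.IH[rule_format, of ?\<eta>'] by blast
        show "\<exists>\<xi>. (\<eta>, \<xi>) \<in> transitions\<^sup>* \<and> particles \<xi> + 1 = particles \<eta>"
          using converse_rtrancl_into_rtrancl[OF 1 \<xi>(1)] \<xi>(2) unfolding 2 by (intro exI conjI)
      qed
    qed (use step in auto)
  qed
  then show ?thesis
    using assms by blast
qed

lemma reach_empty: "(\<eta>, \<lambda>_. 0) \<in> transitions\<^sup>*"
proof (induction "particles \<eta>" arbitrary: \<eta>)
  case 0
  then have "\<eta> = (\<lambda>_. 0)"
    by (auto simp: particles_def fun_eq_iff)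
  then show ?case by simp
next
  case (Suc n)
  then obtain i where "0 < \<eta> i"
    by (metis bot_nat_0.not_eq_extremum nat.distinct(1) particles_def sum.neutral)
  then obtain \<xi> where \<xi>: "(\<eta>, \<xi>) \<in> transitions\<^sup>*" "particles \<xi> + 1 = particles \<eta>"
    using remove_particle by blast
  with Suc.hyps(2) have "n = particles \<xi>"
    by simp
  from rtrancl_trans[OF \<xi>(1) Suc.hyps(1)[OF this]] show ?case .
qed

text \<open>For \<open>h \<eta> = \<Sum>\<^sub>i u\<^sub>i \<eta>\<^sub>i\<close> the drift \<open>L h\<close> is a constant minus \<open>\<Sum>\<^sub>i (adjoint_drift u)\<^sub>i \<eta>\<^sub>i\<close>; a Lyapunov function
  comes from a positive \<open>u\<close> with \<open>adjoint_drift u = 1\<close>.\<close>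

definition killing :: "'v \<Rightarrow> real" where
  "killing i = c i * (\<gamma> i - \<alpha> i)"

definition adjoint_drift :: "('v \<Rightarrow> real) \<Rightarrow> 'v \<Rightarrow> real" where
  "adjoint_drift u i = killing i * u i + 4 * s * (\<Sum>j\<in>UNIV. p i j * (u i - u j))"

lemma killing_nonneg: "0 \<le> killing i"
  unfolding killing_def using c_nonneg[of i] \<alpha>_less_\<gamma>[of i] by (intro mult_nonneg_nonneg) auto

text \<open>At a point where a positive maximum is attained, both terms of
  \<open>adjoint_drift\<close> are nonnegative, hence zero. So the neighbours attain the maximum
  too, irreducibility carries it to a site with \<open>c k > 0\<close>, and killing is strictly
  positive there.\<close>

lemma adjoint_drift_max_principle:
  assumes "\<And>i. adjoint_drift u i = 0"
  shows "u i \<le> 0"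
proof (rule ccontr)
  assume "\<not> u i \<le> 0"
  define m where "m = Max (range u)"
  have m_ge: "u j \<le> m" for j
    by (simp add: m_def)
  have m_pos: "0 < m"
    using m_ge[of i] \<open>\<not> u i \<le> 0\<close> by linarith
  have props: "killing j = 0 \<and> (\<forall>k. 0 < p j k \<longrightarrow> u k = m)" if "u j = m" for j
  proof -
    have nn: "0 \<le> p j k * (u j - u k)" for k
      using p_nonneg[of j k] m_ge[of k] that by simp
    then have "0 \<le> 4 * s * (\<Sum>k\<in>UNIV. p j k * (u j - u k))"
      using s_pos by (intro mult_nonneg_nonneg[OF _ sum_nonneg[OF nn]]) auto
    moreover have "0 \<le> killing j * u j"
      using killing_nonneg[of j] that m_pos by simp
    moreover have "killing j * u j + 4 * s * (\<Sum>k\<in>UNIV. p j k * (u j - u k)) = 0"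
      using assms[of j] by (simp add: adjoint_drift_def)
    ultimately have "killing j * u j = 0" "4 * s * (\<Sum>k\<in>UNIV. p j k * (u j - u k)) = 0"
      by linarith+
    then have "killing j = 0" "(\<Sum>k\<in>UNIV. p j k * (u j - u k)) = 0"
      using m_pos that s_pos by auto
    moreover have "\<forall>k. p j k * (u j - u k) = 0"
      using \<open>(\<Sum>k\<in>UNIV. p j k * (u j - u k)) = 0\<close> nn by (subst (asm) sum_nonneg_eq_0_iff) auto
    then have "u k = m" if "0 < p j k" for k
      using that \<open>u j = m\<close> by (auto dest: spec[of _ k])
    ultimately show ?thesis
      by blast
  qed
  obtain k where k: "0 < c k"
    using c_pos by blast
  have "m \<in> range u"
    unfolding m_def by (intro Max_in) auto
  then obtain j where "u j = m"
    by auto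
  with irreducible[of j k] have "u k = m"
    by (induction rule: rtrancl_induct) (use props in auto)
  then have "killing k = 0"
    using props by blast
  then show False
    using k \<alpha>_less_\<gamma>[of k] by (simp add: killing_def)
qed

text \<open>The maximum principle for \<open>v\<close> and \<open>- v\<close> makes the operator
  injective, hence surjective in finite dimension.\<close>

lemma adjoint_drift_solution: "\<exists>u. (\<forall>i. 0 < u i) \<and> (\<forall>i. adjoint_drift u i = 1)"
proof -
  define A where "A = (\<lambda>v :: real ^ 'v. \<chi> i. adjoint_drift (($) v) i)"
  have lin: "linear A"
    by (rule linearI) (auto simp: A_def adjoint_drift_def vec_eq_iff algebra_simps sum.distrib sum_distrib_left sum_subtractf)
  moreover have "inj A"
    unfolding linear_injective_0[OF lin]
  proof (intro allI impI)
    fix v assume "A v = 0"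
    then have 0: "adjoint_drift (($) v) i = 0" for i
      by (simp add: A_def vec_eq_iff)
    have "adjoint_drift (\<lambda>j. - v $ j) i = - adjoint_drift (($) v) i" for i
      by (simp add: adjoint_drift_def algebra_simps sum_subtractf sum_negf sum_distrib_left)
    then have "adjoint_drift (\<lambda>j. - v $ j) i = 0" for i
      by (simp add: 0)
    from adjoint_drift_max_principle[OF this] adjoint_drift_max_principle[OF 0]
    show "v = 0"
      by (simp add: vec_eq_iff order_antisym)
  qed
  ultimately have "surj A"
    by (intro linear_injective_imp_surjective) auto
  then obtain v where "A v = (\<chi> i. 1)"
    by (metis surjD)
  then have v: "adjoint_drift (($) v) i = 1" for i
    by (simp add: A_def vec_eq_iff)
  \<comment> \<open>At a minimum point \<open>k\<close> the differences are nonpositive, so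
    \<open>1 \<le> killing k * v $ k\<close>, which forces the minimum to be positive.\<close>
  have "0 < v $ i" for i
  proof -
    obtain k where k: "\<And>j. v $ k \<le> v $ j"
    proof -
      have "Min (range (($) v)) \<in> range (($) v)"
        by (intro Min_in) auto
      then obtain k where "v $ k = Min (range (($) v))"
        by (metis rangeE)
      then show ?thesis
        using that[of k] by simp
    qed
    have "(\<Sum>j\<in>UNIV. p k j * (v $ k - v $ j)) \<le> 0"
      using k p_nonneg by (intro sum_nonpos mult_nonneg_nonpos) auto
    then have "4 * s * (\<Sum>j\<in>UNIV. p k j * (v $ k - v $ j)) \<le> 0"
      using s_pos by (simp add: mult_nonneg_nonpos)
    then have "1 \<le> killing k * v $ k"
      using v[of k] by (simp add: adjoint_drift_def)
    then have "0 < v $ k"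
      using killing_nonneg[of k] by (smt (verit) mult_nonneg_nonpos)
    then show ?thesis
      using k[of i] by linarith
  qed
  then show ?thesis
    using v by (intro exI[of _ "($) v"]) auto
qed

text \<open>The products \<open>\<eta> i * \<eta> j\<close> in the two directions of an exchange
  cancel on linear functions, leaving \<open>2 * s\<close> times a discrete gradient. Both orders of
  each pair contribute, whence the \<open>4 * s\<close> in \<open>adjoint_drift\<close>.\<close>

lemma sip_generator_linear:
  fixes u :: "'v \<Rightarrow> real"
  defines "h \<equiv> \<lambda>\<eta>. \<Sum>i\<in>UNIV. u i * real (\<eta> i)"
  shows "sip_generator s p c \<alpha> \<gamma> h \<eta> = (\<Sum>i\<in>UNIV. 2 * s * c i * \<alpha> i * u i) - (\<Sum>i\<in>UNIV. adjoint_drift u i * real (\<eta> i))"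
proof -
  have upd: "h (\<xi>(i := k)) = h \<xi> + u i * (real k - real (\<xi> i))" for \<xi> i k
    unfolding h_def by (subst (1 2) sum.remove[of _ i]) (auto simp: algebra_simps)
  have edge: "sip_edge s i j h \<eta> = 2 * s * (real (\<eta> i) - real (\<eta> j)) * (u j - u i)" if "j \<in> UNIV - {i}" for i j
    using that by (cases "\<eta> i"; cases "\<eta> j") (auto simp: sip_edge_def upd algebra_simps)
  have site: "sip_site s a g i h \<eta> = 2 * s * a * u i - (g - a) * u i * real (\<eta> i)" for a g i
    by (cases "\<eta> i") (auto simp: sip_site_def upd algebra_simps)
  define F where "F i j = 2 * s * (p i j * (u j - u i)) * real (\<eta> i)" for i j
  have "(\<Sum>i\<in>UNIV. \<Sum>j\<in>UNIV - {i}. p i j * sip_edge s i j h \<eta>) = (\<Sum>i\<in>UNIV. \<Sum>j\<in>UNIV. F i j + F j i)"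
  proof (rule sum.cong[OF refl])
    fix i
    have "(\<Sum>j\<in>UNIV. F i j + F j i) = (\<Sum>j\<in>UNIV - {i}. F i j + F j i)"
      by (subst sum.remove[of _ i]) (auto simp: F_def)
    also have "\<dots> = (\<Sum>j\<in>UNIV - {i}. p i j * sip_edge s i j h \<eta>)"
    proof (intro sum.cong refl)
      fix j assume "j \<in> UNIV - {i}"
      then show "F i j + F j i = p i j * sip_edge s i j h \<eta>"
        using p_sym[of j i] by (simp add: F_def edge algebra_simps)
    qed
    finally show "(\<Sum>j\<in>UNIV - {i}. p i j * sip_edge s i j h \<eta>) = (\<Sum>j\<in>UNIV. F i j + F j i)"
      by simp
  qed
  also have "\<dots> = (\<Sum>i\<in>UNIV. \<Sum>j\<in>UNIV. F i j) + (\<Sum>i\<in>UNIV. \<Sum>j\<in>UNIV. F j i)"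
    by (simp add: sum.distrib)
  also have "(\<Sum>i\<in>UNIV. \<Sum>j\<in>UNIV. F j i) = (\<Sum>i\<in>UNIV. \<Sum>j\<in>UNIV. F i j)"
    by (rule sum.swap)
  finally have "(\<Sum>i\<in>UNIV. \<Sum>j\<in>UNIV - {i}. p i j * sip_edge s i j h \<eta>) = (\<Sum>i\<in>UNIV. 2 * (\<Sum>j\<in>UNIV. F i j))"
    by (simp add: sum_distrib_left)
  then have "sip_generator s p c \<alpha> \<gamma> h \<eta> = (\<Sum>i\<in>UNIV. 2 * (\<Sum>j\<in>UNIV. F i j)
      + c i * (2 * s * \<alpha> i * u i - (\<gamma> i - \<alpha> i) * u i * real (\<eta> i)))"
    unfolding sip_generator_def by (simp add: site sum.distrib)
  also have "\<dots> = (\<Sum>i\<in>UNIV. 2 * s * c i * \<alpha> i * u i - adjoint_drift u i * real (\<eta> i))"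
  proof (intro sum.cong refl)
    fix i
    have "(\<Sum>j\<in>UNIV. F i j) = - (2 * s * (\<Sum>j\<in>UNIV. p i j * (u i - u j)) * real (\<eta> i))"
      unfolding F_def sum_distrib_left sum_distrib_right sum_negf[symmetric]
      by (intro sum.cong) (auto simp: algebra_simps)
    then show "2 * (\<Sum>j\<in>UNIV. F i j) + c i * (2 * s * \<alpha> i * u i - (\<gamma> i - \<alpha> i) * u i * real (\<eta> i))
        = 2 * s * c i * \<alpha> i * u i - adjoint_drift u i * real (\<eta> i)"
      by (simp add: adjoint_drift_def killing_def algebra_simps)
  qed
  finally show ?thesis
    by (simp add: sum_subtractf)
qed

lemma expected_particles_bound:
  assumes S: "sip_semigroup s p c \<alpha> \<gamma> S"
  obtains B where "\<And>N k. (\<integral>\<eta>. min (real N) (real (particles \<eta>)) \<partial>S (real k) (\<lambda>_. 0)) \<le> B"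
proof -
  interpret jump_semigroup sip_rate sip_jump particles boundary_rate S
    by unfold_locales (use S in \<open>simp add: sip_semigroup_def gen_sip\<close>)
  obtain u where u: "\<And>i. 0 < u i" "\<And>i. adjoint_drift u i = 1"
    using adjoint_drift_solution by blast
  define h where "h \<eta> = (\<Sum>i\<in>UNIV. u i * real (\<eta> i))" for \<eta>
  define K where "K = (\<Sum>i\<in>UNIV. 2 * s * c i * \<alpha> i * u i)"
  define l where "l = Min (range u)"
  \<comment> \<open>This makes \<open>\<epsilon> * h\<close> at most the number of particles, which
    is exactly the dissipation when \<open>adjoint_drift u = 1\<close>.\<close>
  define \<epsilon> where "\<epsilon> = 1 / Max (range u)"
  have "l \<in> range u"
    unfolding l_def by (intro Min_in) auto
  then have l: "0 < l" "\<And>i. l \<le> u i"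
    using u(1) by (auto simp: l_def)
  have "0 < Max (range u)"
    using u(1) by (subst Max_gr_iff) auto
  then have \<epsilon>: "0 < \<epsilon>" "\<And>i. \<epsilon> * u i \<le> 1"
    by (auto simp: \<epsilon>_def divide_le_eq)
  have l_h: "l * real (particles \<eta>) \<le> h \<eta>" for \<eta>
    unfolding h_def particles_def of_nat_sum sum_distrib_left using l by (intro sum_mono mult_right_mono) auto
  have h_particles: "\<epsilon> * h \<eta> \<le> real (particles \<eta>)" for \<eta>
    unfolding h_def particles_def of_nat_sum sum_distrib_left mult.assoc[symmetric]
    using mult_right_mono[OF \<epsilon>(2), of "real (\<eta> _)"] by (intro sum_mono) simp
  have drift: "gen h \<eta> \<le> K - \<epsilon> * h \<eta>" for \<eta>
    using sip_generator_linear[of u \<eta>] h_particles[of \<eta>]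
    by (simp add: gen_sip h_def[abs_def] K_def u(2) particles_def)
  have h_fin: "finite {\<eta>. h \<eta> < M}" for M
  proof (rule finite_subset[OF _ finite_level[of "nat \<lceil>M / l\<rceil>"]], safe)
    fix \<eta> assume "h \<eta> < M"
    then have "l * real (particles \<eta>) \<le> M"
      using l_h[of \<eta>] by linarith
    then have "real (particles \<eta>) \<le> M / l"
      using l(1) by (simp add: le_divide_eq mult.commute)
    then show "particles \<eta> \<le> nat \<lceil>M / l\<rceil>"
      using real_nat_ceiling_ge[of "M / l"] by linarith
  qed
  have h0: "0 \<le> h \<eta>" for \<eta>
    unfolding h_def using u(1) by (intro sum_nonneg mult_nonneg_nonneg) (auto intro: less_imp_le)
  have K: "0 \<le> K"
    unfolding K_def using u(1) s_pos
    by (intro sum_nonneg mult_nonneg_nonneg c_nonneg \<alpha>_nonneg) (auto intro: less_imp_le)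
  have bound: "(\<integral>\<eta>. min N (h \<eta>) \<partial>S (real k) (\<lambda>_. 0)) \<le> K * (1 + \<epsilon>) / \<epsilon>" if "0 < N" for N k
    by (rule lyapunov_bound[OF h0 _ h_fin drift K \<epsilon>(1) that]) (simp add: h_def)
  have "(\<integral>\<eta>. min (real N) (real (particles \<eta>)) \<partial>S (real k) (\<lambda>_. 0)) \<le> K * (1 + \<epsilon>) / \<epsilon> / l" for N k
  proof (cases "N = 0")
    case True
    then show ?thesis
      using K \<epsilon>(1) l(1) by simp
  next
    case False
    have "(\<integral>\<eta>. min (real N) (real (particles \<eta>)) \<partial>S (real k) (\<lambda>_. 0)) \<le> (\<integral>\<eta>. min (l * real N) (h \<eta>) / l \<partial>S (real k) (\<lambda>_. 0))"
    proof (rule integral_mono)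
      show "integrable (S (real k) (\<lambda>_. 0)) (\<lambda>\<eta>. min (real N) (real (particles \<eta>)))"
        by (rule integrable_bounded[where B = N]) auto
      show "integrable (S (real k) (\<lambda>_. 0)) (\<lambda>\<eta>. min (l * real N) (h \<eta>) / l)"
        using h0 l by (intro integrable_bounded[where B = "real N"]) (auto simp: abs_of_nonneg divide_le_eq mult.commute)
      show "min (real N) (real (particles \<eta>)) \<le> min (l * real N) (h \<eta>) / l" for \<eta>
      proof -
        have "l * min (real N) (real (particles \<eta>)) \<le> min (l * real N) (h \<eta>)"
          using l(1) by (intro min.boundedI order_trans[OF _ l_h[of \<eta>]] mult_left_mono) auto
        then show ?thesis
          using l(1) by (simp add: le_divide_eq mult.commute)
      qed
    qed
    also have "\<dots> \<le> K * (1 + \<epsilon>) / \<epsilon> / l"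
      unfolding integral_divide_zero using l(1) False by (intro divide_right_mono bound) auto
    finally show ?thesis .
  qed
  then show ?thesis
    by (rule that)
qed

end

section \<open>Radial test functions\<close>

text \<open>Stands in for polynomial growth: all that is used of the polynomial coefficients is that
  a decaying exponential of the total mass, however slow, dominates them.\<close>

definition subexponential :: "(('v::finite \<Rightarrow> real) \<Rightarrow> real) \<Rightarrow> bool" where
  "subexponential A \<longleftrightarrow> continuous_on UNIV A \<and>
    (\<forall>\<delta>>0. \<exists>C. \<forall>\<zeta>\<in>orthant. \<bar>A \<zeta>\<bar> \<le> C * exp (\<delta> * (\<Sum>i\<in>UNIV. \<zeta> i)))"

lemma orthant_sum_nonneg: "\<zeta> \<in> orthant \<Longrightarrow> 0 \<le> (\<Sum>i\<in>UNIV. \<zeta> i)" for \<zeta> :: "'v::finite \<Rightarrow> real"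
  by (auto simp: orthant_def intro: sum_nonneg)

lemma subexponential_const: "subexponential (\<lambda>_. k)"
  unfolding subexponential_def
proof (intro conjI allI impI)
  fix \<delta> :: real assume "0 < \<delta>"
  have "\<bar>k\<bar> * 1 \<le> \<bar>k\<bar> * exp (\<delta> * (\<Sum>i\<in>UNIV. \<zeta> i))" if "\<zeta> \<in> orthant" for \<zeta> :: "'a \<Rightarrow> real"
    using orthant_sum_nonneg[OF that] \<open>0 < \<delta>\<close> by (intro mult_left_mono) auto
  then show "\<exists>C. \<forall>\<zeta>\<in>orthant. \<bar>k\<bar> \<le> C * exp (\<delta> * (\<Sum>i\<in>(UNIV::'a set). \<zeta> i))"
    by auto
qed auto

lemma subexponential_add:
  assumes "subexponential A" "subexponential B"
  shows "subexponential (\<lambda>\<zeta>. A \<zeta> + B \<zeta>)"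
  unfolding subexponential_def
proof (intro conjI allI impI)
  show "continuous_on UNIV (\<lambda>\<zeta>. A \<zeta> + B \<zeta>)"
    using assms by (auto simp: subexponential_def intro!: continuous_intros)
  fix \<delta> :: real assume "0 < \<delta>"
  then obtain C D where "\<And>\<zeta>. \<zeta> \<in> orthant \<Longrightarrow> \<bar>A \<zeta>\<bar> \<le> C * exp (\<delta> * (\<Sum>i\<in>UNIV. \<zeta> i))"
    "\<And>\<zeta>. \<zeta> \<in> orthant \<Longrightarrow> \<bar>B \<zeta>\<bar> \<le> D * exp (\<delta> * (\<Sum>i\<in>UNIV. \<zeta> i))"
    using assms unfolding subexponential_def by metis
  then show "\<exists>C. \<forall>\<zeta>\<in>orthant. \<bar>A \<zeta> + B \<zeta>\<bar> \<le> C * exp (\<delta> * (\<Sum>i\<in>UNIV. \<zeta> i))"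
    by (intro exI[of _ "C + D"]) (force simp: distrib_right intro: order_trans[OF abs_triangle_ineq] add_mono)
qed

lemma subexponential_mult:
  assumes "subexponential A" "subexponential B"
  shows "subexponential (\<lambda>\<zeta>. A \<zeta> * B \<zeta>)"
  unfolding subexponential_def
proof (intro conjI allI impI)
  show "continuous_on UNIV (\<lambda>\<zeta>. A \<zeta> * B \<zeta>)"
    using assms by (auto simp: subexponential_def intro!: continuous_intros)
  fix \<delta> :: real assume "0 < \<delta>"
  then have "0 < \<delta> / 2" by simp
  then obtain C D where CD: "\<And>\<zeta>. \<zeta> \<in> orthant \<Longrightarrow> \<bar>A \<zeta>\<bar> \<le> C * exp (\<delta> / 2 * (\<Sum>i\<in>UNIV. \<zeta> i))"
    "\<And>\<zeta>. \<zeta> \<in> orthant \<Longrightarrow> \<bar>B \<zeta>\<bar> \<le> D * exp (\<delta> / 2 * (\<Sum>i\<in>UNIV. \<zeta> i))"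
    using assms unfolding subexponential_def by metis
  have "\<bar>A \<zeta> * B \<zeta>\<bar> \<le> C * D * exp (\<delta> * (\<Sum>i\<in>UNIV. \<zeta> i))" if "\<zeta> \<in> orthant" for \<zeta>
  proof -
    have "\<bar>A \<zeta>\<bar> * \<bar>B \<zeta>\<bar> \<le> (C * exp (\<delta> / 2 * (\<Sum>i\<in>UNIV. \<zeta> i))) * (D * exp (\<delta> / 2 * (\<Sum>i\<in>UNIV. \<zeta> i)))"
      using CD[OF that] by (intro mult_mono) (auto intro: order_trans[OF abs_ge_zero])
    also have "\<dots> = C * D * (exp (\<delta> / 2 * (\<Sum>i\<in>UNIV. \<zeta> i)) * exp (\<delta> / 2 * (\<Sum>i\<in>UNIV. \<zeta> i)))"
      by (simp add: mult_ac)
    also have "exp (\<delta> / 2 * (\<Sum>i\<in>UNIV. \<zeta> i)) * exp (\<delta> / 2 * (\<Sum>i\<in>UNIV. \<zeta> i)) = exp (\<delta> * (\<Sum>i\<in>UNIV. \<zeta> i))"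
      by (simp add: exp_add[symmetric])
    finally show ?thesis
      by (simp add: abs_mult)
  qed
  then show "\<exists>C. \<forall>\<zeta>\<in>orthant. \<bar>A \<zeta> * B \<zeta>\<bar> \<le> C * exp (\<delta> * (\<Sum>i\<in>UNIV. \<zeta> i))"
    by blast
qed

lemma subexponential_diff:
  "subexponential A \<Longrightarrow> subexponential B \<Longrightarrow> subexponential (\<lambda>\<zeta>. A \<zeta> - B \<zeta>)"
  using subexponential_add[OF _ subexponential_mult[OF subexponential_const[of "-1"]], of A B] by simp

lemma subexponential_sum:
  "(\<And>i. i \<in> I \<Longrightarrow> subexponential (A i)) \<Longrightarrow> subexponential (\<lambda>\<zeta>. \<Sum>i\<in>I. A i \<zeta>)"
proof (induction I rule: infinite_finite_induct)
  case (insert i I)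
  then show ?case
    by (simp add: subexponential_add)
qed (auto simp: subexponential_const)

lemma exp_ge_power_fact: "0 \<le> x \<Longrightarrow> x ^ n / fact n \<le> exp x" for x :: real
proof -
  assume x: "0 \<le> x"
  have "x ^ n / fact n = (\<Sum>k\<in>{n}. x ^ k / fact k)"
    by simp
  also have "\<dots> \<le> (\<Sum>k. x ^ k / fact k)"
    using x summable_exp[of x] by (intro sum_le_suminf) (auto simp: divide_inverse mult.commute)
  also have "\<dots> = exp x"
    by (simp add: exp_def divide_inverse mult.commute)
  finally show ?thesis .
qed

lemma continuous_pow_fact: "continuous_on UNIV (\<lambda>\<zeta>. pow_fact \<zeta> \<eta>)"
  unfolding pow_fact_def by (intro continuous_intros) auto

lemma subexponential_pow_fact: "subexponential (\<lambda>\<zeta>. pow_fact \<zeta> \<eta>)"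
  unfolding subexponential_def
proof (intro conjI allI impI continuous_pow_fact)
  fix \<delta> :: real assume \<delta>: "0 < \<delta>"
  have "\<bar>pow_fact \<zeta> \<eta>\<bar> \<le> (\<Prod>i\<in>UNIV. 1 / \<delta> ^ \<eta> i) * exp (\<delta> * (\<Sum>i\<in>UNIV. \<zeta> i))" if \<zeta>: "\<zeta> \<in> orthant" for \<zeta> :: "'a \<Rightarrow> real"
  proof -
    have "\<zeta> i ^ \<eta> i / fact (\<eta> i) \<le> 1 / \<delta> ^ \<eta> i * exp (\<delta> * \<zeta> i)" for i
    proof -
      have "(\<delta> * \<zeta> i) ^ \<eta> i / fact (\<eta> i) \<le> exp (\<delta> * \<zeta> i)"
        using \<delta> orthantD[OF \<zeta>, of i] by (intro exp_ge_power_fact) auto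
      then show ?thesis
        using \<delta> by (simp add: power_mult_distrib field_simps)
    qed
    then have "pow_fact \<zeta> \<eta> \<le> (\<Prod>i\<in>UNIV. 1 / \<delta> ^ \<eta> i * exp (\<delta> * \<zeta> i))"
      unfolding pow_fact_def using orthantD[OF \<zeta>] by (intro prod_mono) auto
    also have "\<dots> = (\<Prod>i\<in>UNIV. 1 / \<delta> ^ \<eta> i) * exp (\<delta> * (\<Sum>i\<in>UNIV. \<zeta> i))"
      unfolding prod.distrib sum_distrib_left by (subst exp_sum) auto
    finally show ?thesis
      using pow_fact_nonneg[OF \<zeta>] by simp
  qed
  then show "\<exists>C. \<forall>\<zeta>\<in>orthant. \<bar>pow_fact \<zeta> \<eta>\<bar> \<le> C * exp (\<delta> * (\<Sum>i\<in>UNIV. \<zeta> i))"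
    by blast
qed

lemma subexponential_coordinate: "subexponential (\<lambda>\<zeta>. \<zeta> i)"
proof -
  have "(\<lambda>\<zeta>. \<zeta> i) = (\<lambda>\<zeta>. pow_fact \<zeta> (\<lambda>j. if j = i then 1 else 0))"
    by (auto simp: fun_eq_iff pow_fact_remove[of _ _ i])
  then show ?thesis
    using subexponential_pow_fact[of "\<lambda>j. if j = i then 1 else 0"] by simp
qed

text \<open>Monomials divided by factorials are differentiated without numerical factors. The case
  \<open>\<eta> i = 0\<close> is separate because truncated subtraction would return the monomial
  itself instead of 0.\<close>

definition dpow :: "'v::finite \<Rightarrow> ('v \<Rightarrow> nat) \<Rightarrow> ('v \<Rightarrow> real) \<Rightarrow> real" where
  "dpow i \<eta> \<zeta> = (if \<eta> i = 0 then 0 else pow_fact \<zeta> (\<eta>(i := \<eta> i - 1)))"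

definition ddpow :: "'v::finite \<Rightarrow> 'v \<Rightarrow> ('v \<Rightarrow> nat) \<Rightarrow> ('v \<Rightarrow> real) \<Rightarrow> real" where
  "ddpow j i \<eta> \<zeta> = (if \<eta> i = 0 then 0 else dpow j (\<eta>(i := \<eta> i - 1)) \<zeta>)"

lemma subexponential_dpow: "subexponential (dpow i \<eta>)"
  by (cases "\<eta> i = 0") (simp_all add: dpow_def[abs_def] subexponential_const subexponential_pow_fact)

lemma subexponential_ddpow: "subexponential (ddpow j i \<eta>)"
  by (cases "\<eta> i = 0") (simp_all add: ddpow_def[abs_def] subexponential_const subexponential_dpow)

lemmas subexponential_intros =
  subexponential_const subexponential_add subexponential_mult subexponential_diff subexponential_sum
  subexponential_pow_fact subexponential_coordinate subexponential_dpow subexponential_ddpow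

lemma pow_fact_derivative:
  "((\<lambda>x. pow_fact (\<zeta>(i := x)) \<eta>) has_real_derivative dpow i \<eta> \<zeta>) (at (\<zeta> i) within S)"
proof -
  define k where "k = (\<Prod>j\<in>UNIV - {i}. \<zeta> j ^ \<eta> j / fact (\<eta> j))"
  have e: "pow_fact (\<zeta>(i := y)) (\<eta>(i := n)) = y ^ n / fact n * k" for y n
  proof -
    have "(\<Prod>j\<in>UNIV - {i}. (\<zeta>(i := y)) j ^ (\<eta>(i := n)) j / fact ((\<eta>(i := n)) j)) = k"
      unfolding k_def by (intro prod.cong) auto
    then show ?thesis
      by (simp add: pow_fact_remove[of _ _ i])
  qed
  have e': "pow_fact (\<zeta>(i := y)) \<eta> = y ^ \<eta> i / fact (\<eta> i) * k" for y
    using e[of y "\<eta> i"] by simp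
  show ?thesis
  proof (cases "\<eta> i")
    case 0
    then show ?thesis
      unfolding e' by (simp add: dpow_def)
  next
    case (Suc n)
    have "dpow i \<eta> \<zeta> = \<zeta> i ^ n / fact n * k"
      using e[of "\<zeta> i" n] by (simp add: dpow_def Suc)
    moreover have "((\<lambda>x. x ^ Suc n / fact (Suc n) * k) has_real_derivative \<zeta> i ^ n / fact n * k) (at (\<zeta> i) within S)"
      by (rule derivative_eq_intros refl | simp)+
    ultimately show ?thesis
      unfolding e' by (simp add: Suc del: power_Suc fact_Suc)
  qed
qed

lemma dpow_derivative:
  "((\<lambda>x. dpow i \<eta> (\<zeta>(j := x))) has_real_derivative ddpow j i \<eta> \<zeta>) (at (\<zeta> j) within S)"
  using pow_fact_derivative[of \<zeta> j "\<eta>(i := \<eta> i - 1)" S] by (simp add: dpow_def[of i \<eta>] ddpow_def)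

lemma radial_derivative:
  fixes \<zeta> :: "'v::finite \<Rightarrow> real"
  assumes "((\<lambda>x. a (\<zeta>(i := x))) has_real_derivative a') (at (\<zeta> i) within S)"
    and "\<And>x. (\<psi> has_real_derivative \<psi>' x) (at x)"
  shows "((\<lambda>x. a (\<zeta>(i := x)) * \<psi> (\<Sum>j\<in>UNIV. (\<zeta>(i := x)) j)) has_real_derivative
    a' * \<psi> (\<Sum>j\<in>UNIV. \<zeta> j) + a \<zeta> * \<psi>' (\<Sum>j\<in>UNIV. \<zeta> j)) (at (\<zeta> i) within S)"
proof -
  define d where "d = (\<Sum>j\<in>UNIV - {i}. \<zeta> j)"
  have d: "(\<Sum>j\<in>UNIV. (\<zeta>(i := x)) j) = x + d" for x
    by (subst sum.remove[of _ i]) (auto simp: d_def intro!: sum.cong)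
  have "((\<lambda>x. x + d) has_real_derivative 1) (at (\<zeta> i) within S)"
    by (auto intro!: derivative_eq_intros)
  from DERIV_chain2[OF assms(2) this]
  have "((\<lambda>x. \<psi> (x + d)) has_real_derivative \<psi>' (\<zeta> i + d)) (at (\<zeta> i) within S)"
    by simp
  from DERIV_mult[OF assms(1) this] show ?thesis
    unfolding d using d[of "\<zeta> i"] by (simp add: algebra_simps)
qed

definition edge_coeff :: "real \<Rightarrow> 'v::finite \<Rightarrow> 'v \<Rightarrow> ('v \<Rightarrow> nat) \<Rightarrow> ('v \<Rightarrow> real) \<Rightarrow> real" where
  "edge_coeff s i j \<eta> \<zeta> =
     \<zeta> i * \<zeta> j * (ddpow i i \<eta> \<zeta> - ddpow i j \<eta> \<zeta> - (ddpow j i \<eta> \<zeta> - ddpow j j \<eta> \<zeta>))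
   - 2 * s * (\<zeta> i - \<zeta> j) * (dpow i \<eta> \<zeta> - dpow j \<eta> \<zeta>)"

context
  fixes f :: "('v::finite \<Rightarrow> real) \<Rightarrow> real" and \<eta> :: "'v \<Rightarrow> nat" and \<psi> \<psi>1 \<psi>2 :: "real \<Rightarrow> real"
  assumes f: "\<And>\<zeta>. \<zeta> \<in> orthant \<Longrightarrow> f \<zeta> = pow_fact \<zeta> \<eta> * \<psi> (\<Sum>i\<in>UNIV. \<zeta> i)"
    and \<psi>1: "\<And>x. (\<psi> has_real_derivative \<psi>1 x) (at x)"
    and \<psi>2: "\<And>x. (\<psi>1 has_real_derivative \<psi>2 x) (at x)"
    and \<psi>2_cont: "continuous_on UNIV \<psi>2"
begin

lemma radial_derivative1:
  assumes "\<zeta> \<in> orthant"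
  shows "((\<lambda>x. f (\<zeta>(i := x))) has_real_derivative
    dpow i \<eta> \<zeta> * \<psi> (\<Sum>j\<in>UNIV. \<zeta> j) + pow_fact \<zeta> \<eta> * \<psi>1 (\<Sum>j\<in>UNIV. \<zeta> j)) (at (\<zeta> i) within {0..})"
  by (rule derivative_orthant_cong[OF f assms], assumption)
     (intro radial_derivative[where a = "\<lambda>\<zeta>. pow_fact \<zeta> \<eta>"] pow_fact_derivative \<psi>1)

lemma pderivative_radial:
  "\<zeta> \<in> orthant \<Longrightarrow> pderivative i f \<zeta>
    = dpow i \<eta> \<zeta> * \<psi> (\<Sum>j\<in>UNIV. \<zeta> j) + pow_fact \<zeta> \<eta> * \<psi>1 (\<Sum>j\<in>UNIV. \<zeta> j)"
  by (intro pderivative_eqI radial_derivative1)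

lemma radial_derivative2:
  assumes "\<zeta> \<in> orthant"
  shows "((\<lambda>x. pderivative i f (\<zeta>(j := x))) has_real_derivative
    ddpow j i \<eta> \<zeta> * \<psi> (\<Sum>j\<in>UNIV. \<zeta> j) + dpow i \<eta> \<zeta> * \<psi>1 (\<Sum>j\<in>UNIV. \<zeta> j)
    + (dpow j \<eta> \<zeta> * \<psi>1 (\<Sum>j\<in>UNIV. \<zeta> j) + pow_fact \<zeta> \<eta> * \<psi>2 (\<Sum>j\<in>UNIV. \<zeta> j))) (at (\<zeta> j) within {0..})"
  by (rule derivative_orthant_cong[OF pderivative_radial assms], assumption)
     (intro DERIV_add radial_derivative[where a = "\<lambda>\<zeta>. pow_fact \<zeta> \<eta>"] radial_derivative[where a = "dpow i \<eta>"]
        pow_fact_derivative dpow_derivative \<psi>1 \<psi>2)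

lemma pderivative2_radial:
  "\<zeta> \<in> orthant \<Longrightarrow> pderivative j (pderivative i f) \<zeta>
    = ddpow j i \<eta> \<zeta> * \<psi> (\<Sum>j\<in>UNIV. \<zeta> j) + dpow i \<eta> \<zeta> * \<psi>1 (\<Sum>j\<in>UNIV. \<zeta> j)
    + (dpow j \<eta> \<zeta> * \<psi>1 (\<Sum>j\<in>UNIV. \<zeta> j) + pow_fact \<zeta> \<eta> * \<psi>2 (\<Sum>j\<in>UNIV. \<zeta> j))"
  by (intro pderivative_eqI radial_derivative2)

text \<open>\<open>\<partial>_i - \<partial>_j\<close> annihilates functions of the total mass, so
  \<open>\<psi>\<close> passes through as a constant: the edge operators, with their quadratic
  coefficients, never differentiate the cut-off.\<close>

lemma pdifference_radial:
  "\<zeta> \<in> orthant \<Longrightarrow> pdifference i j f \<zeta> = (dpow i \<eta> \<zeta> - dpow j \<eta> \<zeta>) * \<psi> (\<Sum>j\<in>UNIV. \<zeta> j)"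
  by (simp add: pdifference_def pderivative_radial algebra_simps)

lemma pderivative_pdifference_radial:
  assumes "\<zeta> \<in> orthant"
  shows "pderivative k (pdifference i j f) \<zeta> = (ddpow k i \<eta> \<zeta> - ddpow k j \<eta> \<zeta>) * \<psi> (\<Sum>j\<in>UNIV. \<zeta> j)
    + (dpow i \<eta> \<zeta> - dpow j \<eta> \<zeta>) * \<psi>1 (\<Sum>j\<in>UNIV. \<zeta> j)"
proof (rule pderivative_eqI[OF assms], rule derivative_orthant_cong[OF pdifference_radial assms], assumption)
  show "((\<lambda>x. (dpow i \<eta> (\<zeta>(k := x)) - dpow j \<eta> (\<zeta>(k := x))) * \<psi> (\<Sum>j\<in>UNIV. (\<zeta>(k := x)) j)) has_real_derivative
      (ddpow k i \<eta> \<zeta> - ddpow k j \<eta> \<zeta>) * \<psi> (\<Sum>j\<in>UNIV. \<zeta> j) + (dpow i \<eta> \<zeta> - dpow j \<eta> \<zeta>) * \<psi>1 (\<Sum>j\<in>UNIV. \<zeta> j))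
      (at (\<zeta> k) within {0..})"
    by (rule radial_derivative[where a = "\<lambda>\<zeta>. dpow i \<eta> \<zeta> - dpow j \<eta> \<zeta>"])
       (intro DERIV_diff dpow_derivative \<psi>1)+
qed

lemma bep_edge_radial:
  "\<zeta> \<in> orthant \<Longrightarrow> bep_edge s i j f \<zeta> = edge_coeff s i j \<eta> \<zeta> * \<psi> (\<Sum>j\<in>UNIV. \<zeta> j)"
  unfolding bep_edge_def pdifference_def[of i j "pdifference i j f"] edge_coeff_def
  by (simp add: pdifference_radial pderivative_pdifference_radial algebra_simps)

lemma bep_site_radial:
  "\<zeta> \<in> orthant \<Longrightarrow> bep_site s a g i f \<zeta> =
     (a * \<zeta> i * ddpow i i \<eta> \<zeta> + (2 * s * a - (g - a) * \<zeta> i) * dpow i \<eta> \<zeta>) * \<psi> (\<Sum>j\<in>UNIV. \<zeta> j)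
   + (2 * a * \<zeta> i * dpow i \<eta> \<zeta> + (2 * s * a - (g - a) * \<zeta> i) * pow_fact \<zeta> \<eta>) * \<psi>1 (\<Sum>j\<in>UNIV. \<zeta> j)
   + a * \<zeta> i * pow_fact \<zeta> \<eta> * \<psi>2 (\<Sum>j\<in>UNIV. \<zeta> j)"
  unfolding bep_site_def by (simp add: pderivative_radial pderivative2_radial algebra_simps)

lemma C2_orthant_radial: "C2_orthant f"
proof -
  have \<psi>_cont: "continuous_on UNIV \<psi>" "continuous_on UNIV \<psi>1"
    using \<psi>1 \<psi>2 by (meson DERIV_isCont continuous_at_imp_continuous_on)+
  have c: "continuous_on orthant (\<lambda>\<zeta>. A \<zeta> * \<phi> (\<Sum>j\<in>UNIV. \<zeta> j))"
    if "subexponential A" "continuous_on UNIV \<phi>" for A :: "('v \<Rightarrow> real) \<Rightarrow> real" and \<phi>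
  proof (rule continuous_on_subset[OF _ subset_UNIV])
    show "continuous_on UNIV (\<lambda>\<zeta>. A \<zeta> * \<phi> (\<Sum>j\<in>UNIV. \<zeta> j))"
      using that unfolding subexponential_def
      by (intro continuous_on_mult continuous_on_compose2[OF that(2)] continuous_on_sum continuous_on_product_coordinates) auto
  qed
  have "C1_orthant f"
    by (rule C1_orthantI[OF _ _ radial_derivative1])
       (auto intro!: c continuous_on_add subexponential_intros \<psi>_cont simp: continuous_on_cong[OF refl f])
  moreover have "C1_orthant (pderivative i f)" for i
    by (rule C1_orthantI[OF _ _ radial_derivative2])
       (auto intro!: c continuous_on_add subexponential_intros \<psi>_cont \<psi>2_cont
         simp: continuous_on_cong[OF refl pderivative_radial])
  ultimately show ?thesis
    by (simp add: C2_orthant_def)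
qed

end

definition gen_coeff0 :: "real \<Rightarrow> ('v::finite \<Rightarrow> 'v \<Rightarrow> real) \<Rightarrow> ('v \<Rightarrow> real) \<Rightarrow> ('v \<Rightarrow> real) \<Rightarrow> ('v \<Rightarrow> real)
    \<Rightarrow> ('v \<Rightarrow> nat) \<Rightarrow> ('v \<Rightarrow> real) \<Rightarrow> real" where
  "gen_coeff0 s p c \<alpha> \<gamma> \<eta> \<zeta> = (\<Sum>i\<in>UNIV. \<Sum>j\<in>UNIV - {i}. p i j * edge_coeff s i j \<eta> \<zeta>)
    + (\<Sum>i\<in>UNIV. c i * (\<alpha> i * \<zeta> i * ddpow i i \<eta> \<zeta> + (2 * s * \<alpha> i - (\<gamma> i - \<alpha> i) * \<zeta> i) * dpow i \<eta> \<zeta>))"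

definition gen_coeff1 :: "real \<Rightarrow> ('v::finite \<Rightarrow> real) \<Rightarrow> ('v \<Rightarrow> real) \<Rightarrow> ('v \<Rightarrow> real)
    \<Rightarrow> ('v \<Rightarrow> nat) \<Rightarrow> ('v \<Rightarrow> real) \<Rightarrow> real" where
  "gen_coeff1 s c \<alpha> \<gamma> \<eta> \<zeta> =
    (\<Sum>i\<in>UNIV. c i * (2 * \<alpha> i * \<zeta> i * dpow i \<eta> \<zeta> + (2 * s * \<alpha> i - (\<gamma> i - \<alpha> i) * \<zeta> i) * pow_fact \<zeta> \<eta>))"

definition gen_coeff2 :: "('v::finite \<Rightarrow> real) \<Rightarrow> ('v \<Rightarrow> real) \<Rightarrow> ('v \<Rightarrow> nat) \<Rightarrow> ('v \<Rightarrow> real) \<Rightarrow> real" where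
  "gen_coeff2 c \<alpha> \<eta> \<zeta> = (\<Sum>i\<in>UNIV. c i * (\<alpha> i * \<zeta> i * pow_fact \<zeta> \<eta>))"

lemma subexponential_gen_coeff:
  "subexponential (gen_coeff0 s p c \<alpha> \<gamma> \<eta>)" "subexponential (gen_coeff1 s c \<alpha> \<gamma> \<eta>)" "subexponential (gen_coeff2 c \<alpha> \<eta>)"
  unfolding gen_coeff0_def[abs_def] gen_coeff1_def[abs_def] gen_coeff2_def[abs_def] edge_coeff_def
  by (intro subexponential_intros)+

text \<open>The three coefficients do not depend on \<open>\<psi>\<close>. The formula therefore
  applies alike to the cut-offs and to \<open>exp (- x)\<close>, and the generators converge term by
  term.\<close>

lemma bep_generator_radial:
  assumes "\<And>\<zeta>. \<zeta> \<in> orthant \<Longrightarrow> f \<zeta> = pow_fact \<zeta> \<eta> * \<psi> (\<Sum>i\<in>UNIV. \<zeta> i)"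
    and "\<And>x. (\<psi> has_real_derivative \<psi>1 x) (at x)" "\<And>x. (\<psi>1 has_real_derivative \<psi>2 x) (at x)"
    and "continuous_on UNIV \<psi>2" and \<zeta>: "\<zeta> \<in> orthant"
  shows "bep_generator s p c \<alpha> \<gamma> f \<zeta> = gen_coeff0 s p c \<alpha> \<gamma> \<eta> \<zeta> * \<psi> (\<Sum>i\<in>UNIV. \<zeta> i)
    + gen_coeff1 s c \<alpha> \<gamma> \<eta> \<zeta> * \<psi>1 (\<Sum>i\<in>UNIV. \<zeta> i) + gen_coeff2 c \<alpha> \<eta> \<zeta> * \<psi>2 (\<Sum>i\<in>UNIV. \<zeta> i)"
proof -
  have edge: "bep_edge s i j f \<zeta> = edge_coeff s i j \<eta> \<zeta> * \<psi> (\<Sum>i\<in>UNIV. \<zeta> i)" for i j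
    by (rule bep_edge_radial[OF assms])
  have site: "bep_site s a g i f \<zeta> =
     (a * \<zeta> i * ddpow i i \<eta> \<zeta> + (2 * s * a - (g - a) * \<zeta> i) * dpow i \<eta> \<zeta>) * \<psi> (\<Sum>j\<in>UNIV. \<zeta> j)
   + (2 * a * \<zeta> i * dpow i \<eta> \<zeta> + (2 * s * a - (g - a) * \<zeta> i) * pow_fact \<zeta> \<eta>) * \<psi>1 (\<Sum>j\<in>UNIV. \<zeta> j)
   + a * \<zeta> i * pow_fact \<zeta> \<eta> * \<psi>2 (\<Sum>j\<in>UNIV. \<zeta> j)" for a g i
    by (rule bep_site_radial[OF assms])
  show ?thesis
    unfolding bep_generator_def edge site gen_coeff0_def gen_coeff1_def gen_coeff2_def
    by (simp add: distrib_left distrib_right sum.distrib sum_distrib_right mult.assoc)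
qed

section \<open>Intertwining of the semigroups\<close>

lemma positive_part_power_derivative:
  "((\<lambda>x. max 0 x ^ Suc (Suc k)) has_real_derivative real (Suc (Suc k)) * max 0 x ^ Suc k) (at (x :: real))"
proof -
  consider "0 < x" | "x < 0" | "x = 0" by linarith
  then show ?thesis
  proof cases
    case 1
    have "((\<lambda>x. x ^ Suc (Suc k)) has_real_derivative real (Suc (Suc k)) * x ^ Suc k) (at x)"
      using DERIV_pow[of "Suc (Suc k)" x UNIV] by (simp add: mult_ac)
    then show ?thesis
      by (rule DERIV_cong_ev[THEN iffD1, rotated -1])
         (use 1 in \<open>auto simp: eventually_nhds intro!: exI[of _ "{0<..}"]\<close>)
  next
    case 2
    have "((\<lambda>x. 0) has_real_derivative 0) (at x)"
      by simp
    then show ?thesis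
      by (rule DERIV_cong_ev[THEN iffD1, rotated -1])
         (use 2 in \<open>auto simp: eventually_nhds intro!: exI[of _ "{..<0}"]\<close>)
  next
    case 3
    have "(\<lambda>h. max 0 h ^ Suc (Suc k) / h) \<midarrow>0\<rightarrow> (0 :: real)"
    proof (rule Lim_null_comparison[where g = "\<lambda>h. \<bar>h\<bar> ^ Suc k"])
      have "\<bar>max 0 h ^ Suc (Suc k) / h\<bar> \<le> \<bar>h\<bar> ^ Suc k" for h :: real
      proof (cases "0 < h")
        case False
        then have "max 0 h = 0"
          by simp
        then show ?thesis
          by (simp only: power_0_Suc div_0 abs_zero zero_le_power abs_ge_zero)
      qed simp
      then show "\<forall>\<^sub>F h in at 0. norm (max 0 h ^ Suc (Suc k) / h) \<le> \<bar>h :: real\<bar> ^ Suc k"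
        by (intro always_eventually) simp
      show "(\<lambda>h. \<bar>h :: real\<bar> ^ Suc k) \<midarrow>0\<rightarrow> 0"
        by (auto intro!: tendsto_eq_intros)
    qed
    then show ?thesis
      using 3 by (simp add: DERIV_def del: power_Suc)
  qed
qed

text \<open>Compactly supported \<open>C\<^sup>2\<close> approximations of \<open>exp (- x)\<close>, with their derivatives.\<close>

definition cut_base :: "nat \<Rightarrow> real \<Rightarrow> real" where
  "cut_base n x = max 0 (1 - x / real (n + 3))"

definition cut0 :: "nat \<Rightarrow> real \<Rightarrow> real" where
  "cut0 n x = cut_base n x ^ (n + 3)"

definition cut1 :: "nat \<Rightarrow> real \<Rightarrow> real" where
  "cut1 n x = - (cut_base n x ^ (n + 2))"

definition cut2 :: "nat \<Rightarrow> real \<Rightarrow> real" where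
  "cut2 n x = real (n + 2) / real (n + 3) * cut_base n x ^ (n + 1)"

lemma cut_base_power_derivative:
  "((\<lambda>x. cut_base n x ^ Suc (Suc k)) has_real_derivative
    - (real (Suc (Suc k)) / real (n + 3)) * cut_base n x ^ Suc k) (at x)"
proof -
  have "((\<lambda>x. 1 - x / real (n + 3)) has_real_derivative - (1 / real (n + 3))) (at x)"
    by (auto intro!: derivative_eq_intros)
  from DERIV_chain2[OF positive_part_power_derivative this, of k] show ?thesis
    unfolding cut_base_def by (simp add: mult_ac del: power_Suc)
qed

lemma cut0_derivative: "(cut0 n has_real_derivative cut1 n x) (at x)"
  using cut_base_power_derivative[of n "n + 1" x] unfolding cut0_def[abs_def] cut1_def
  by (simp add: eval_nat_numeral del: power_Suc)

lemma cut1_derivative: "(cut1 n has_real_derivative cut2 n x) (at x)"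
  using DERIV_minus[OF cut_base_power_derivative[of n n x]] unfolding cut1_def[abs_def] cut2_def
  by (simp add: eval_nat_numeral del: power_Suc)

text \<open>The exponent \<open>n + 3\<close> leaves at least one power of the positive part after
  two derivatives, so the cut-off is of class C2 from \<open>n = 0\<close> on.\<close>

lemma cut2_continuous: "continuous_on UNIV (cut2 n)"
  unfolding cut2_def[abs_def] cut_base_def by (intro continuous_intros) auto

text \<open>From \<open>1 - y \<le> exp (- y)\<close>. The rate \<open>1 / 3\<close> is a lower
  bound of \<open>m / (n + 3)\<close> for \<open>m \<ge> n + 1\<close>, and makes the bound uniform
  in \<open>n\<close> for the cut-off and both derivatives.\<close>

lemma cut_base_power_bound:
  assumes "0 \<le> x" "n + 1 \<le> m"
  shows "0 \<le> cut_base n x ^ m" "cut_base n x ^ m \<le> exp (- (1 / 3 * x))"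
proof -
  show "0 \<le> cut_base n x ^ m"
    by (simp add: cut_base_def)
  have "cut_base n x \<le> exp (- (x / real (n + 3)))"
    using exp_ge_add_one_self[of "- (x / real (n + 3))"] by (simp add: cut_base_def)
  then have "cut_base n x ^ m \<le> exp (- (x / real (n + 3))) ^ m"
    by (intro power_mono) (auto simp: cut_base_def)
  also have "\<dots> = exp (- (real m / real (n + 3) * x))"
    by (simp add: exp_of_nat_mult[symmetric])
  also have "\<dots> \<le> exp (- (1 / 3 * x))"
  proof -
    have "real (n + 3) \<le> 3 * real m"
      using assms(2) by linarith
    then have "1 / 3 \<le> real m / real (n + 3)"
      by (simp add: field_simps)
    then have "1 / 3 * x \<le> real m / real (n + 3) * x"
      using assms(1) by (rule mult_right_mono)
    then show ?thesis
      by simp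
  qed
  finally show "cut_base n x ^ m \<le> exp (- (1 / 3 * x))" .
qed

lemma cut_bounds:
  assumes "0 \<le> x"
  shows "\<bar>cut0 n x\<bar> \<le> exp (- (1 / 3 * x))" "\<bar>cut1 n x\<bar> \<le> exp (- (1 / 3 * x))" "\<bar>cut2 n x\<bar> \<le> exp (- (1 / 3 * x))"
proof -
  note b = cut_base_power_bound[OF assms, of n]
  show "\<bar>cut0 n x\<bar> \<le> exp (- (1 / 3 * x))" "\<bar>cut1 n x\<bar> \<le> exp (- (1 / 3 * x))"
    unfolding cut0_def cut1_def using b[of "n + 3"] b[of "n + 2"] by auto
  have "real (n + 2) / real (n + 3) * cut_base n x ^ (n + 1) \<le> 1 * exp (- (1 / 3 * x))"
    using b[of "n + 1"] by (intro mult_mono) auto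
  moreover have "0 \<le> cut2 n x"
    unfolding cut2_def using b[of "n + 1"] by (intro mult_nonneg_nonneg) auto
  ultimately show "\<bar>cut2 n x\<bar> \<le> exp (- (1 / 3 * x))"
    unfolding cut2_def by simp
qed

text \<open>The classical limit has exponent \<open>n + 3\<close>; the difference to
  \<open>n + k\<close> is a fixed number of factors tending to 1.\<close>

lemma cut_base_power_limit: "(\<lambda>n. cut_base n x ^ (n + k)) \<longlonglongrightarrow> exp (- x)" if "k \<le> 3"
proof -
  have "(\<lambda>n. (1 + (- x) / real (n + 3)) ^ (n + 3)) \<longlonglongrightarrow> exp (- x)"
    by (rule LIMSEQ_ignore_initial_segment[OF tendsto_exp_limit_sequentially])
  moreover have base: "(\<lambda>n. 1 + (- x) / real (n + 3)) \<longlonglongrightarrow> 1"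
    by real_asymp
  ultimately have "(\<lambda>n. (1 + (- x) / real (n + 3)) ^ (n + 3) / (1 + (- x) / real (n + 3)) ^ (3 - k)) \<longlonglongrightarrow> exp (- x) / 1 ^ (3 - k)"
    by (intro tendsto_divide tendsto_power) auto
  then have lim: "(\<lambda>n. (1 + (- x) / real (n + 3)) ^ (n + 3) / (1 + (- x) / real (n + 3)) ^ (3 - k)) \<longlonglongrightarrow> exp (- x)"
    by simp
  have "\<forall>\<^sub>F n in sequentially. (1 + (- x) / real (n + 3)) ^ (n + 3) / (1 + (- x) / real (n + 3)) ^ (3 - k) = cut_base n x ^ (n + k)"
    using order_tendstoD(1)[OF base zero_less_one]
  proof eventually_elim
    case (elim n)
    have "n + 3 = (n + k) + (3 - k)"
      using that by simp
    then have "y ^ (n + 3) / y ^ (3 - k) = y ^ (n + k)" if "0 < y" for y :: real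
      using that by (metis less_irrefl nonzero_mult_div_cancel_right power_add power_not_zero)
    from this[of "1 + (- x) / real (n + 3)"] show ?case
      using elim by (simp add: cut_base_def)
  qed
  from Lim_transform_eventually[OF lim this] show ?thesis .
qed

lemma cut_limits:
  "(\<lambda>n. cut0 n x) \<longlonglongrightarrow> exp (- x)" "(\<lambda>n. cut1 n x) \<longlonglongrightarrow> - exp (- x)" "(\<lambda>n. cut2 n x) \<longlonglongrightarrow> exp (- x)"
proof -
  show "(\<lambda>n. cut0 n x) \<longlonglongrightarrow> exp (- x)" "(\<lambda>n. cut1 n x) \<longlonglongrightarrow> - exp (- x)"
    unfolding cut0_def cut1_def by (intro tendsto_minus cut_base_power_limit; simp)+
  have "(\<lambda>n. real (n + 2) / real (n + 3)) \<longlonglongrightarrow> 1"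
    by real_asymp
  from tendsto_mult[OF this cut_base_power_limit[of 1 x]] show "(\<lambda>n. cut2 n x) \<longlonglongrightarrow> exp (- x)"
    unfolding cut2_def by simp
qed

lemma space_bep_space: "space bep_space = orthant"
  by (simp add: bep_space_def space_restrict_space)

lemma continuous_bep_measurable:
  fixes f :: "('v::finite \<Rightarrow> real) \<Rightarrow> real"
  shows "continuous_on orthant f \<Longrightarrow> f \<in> borel_measurable bep_space"
  unfolding bep_space_def by (rule borel_measurable_continuous_on_restrict)

lemma poisson_density_continuous: "continuous_on UNIV (\<lambda>\<zeta>. poisson_density \<zeta> \<eta>)"
  unfolding poisson_density_def by (intro continuous_intros continuous_pow_fact) auto

lemma measure_poisson_product:
  "\<zeta> \<in> orthant \<Longrightarrow> measure (poisson_product \<zeta>) {\<eta>} = poisson_density \<zeta> \<eta>"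
  unfolding poisson_product_def by (simp add: measure_pmf_single pmf_poisson_product)

lemma prob_space_poisson_product: "prob_space (poisson_product \<zeta>)"
  unfolding poisson_product_def by unfold_locales

lemma sets_poisson_product: "sets (poisson_product \<zeta>) = UNIV"
  by (simp add: poisson_product_def)

text \<open>For each configuration the density is continuous in \<open>\<zeta>\<close>, and there
  are countably many configurations, so it is jointly measurable.\<close>

lemma poisson_product_kernel: "(poisson_product :: ('v::finite \<Rightarrow> real) \<Rightarrow> _) \<in> bep_space \<rightarrow>\<^sub>M prob_algebra (count_space UNIV)"
proof (rule measurable_prob_algebraI)
  show "(poisson_product :: ('v \<Rightarrow> real) \<Rightarrow> _) \<in> bep_space \<rightarrow>\<^sub>M subprob_algebra (count_space UNIV)"
  proof (rule measurable_subprob_algebra)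
    fix A :: "('v \<Rightarrow> nat) set"
    have "(\<lambda>\<zeta>. ennreal (poisson_density \<zeta> \<eta>) * indicator A \<eta>) \<in> borel_measurable bep_space" for \<eta>
      using continuous_bep_measurable[OF continuous_on_subset[OF poisson_density_continuous subset_UNIV], of \<eta>]
      by measurable
    then have "(\<lambda>x. ennreal (poisson_density (fst x) (snd x)) * indicator A (snd x)) \<in> borel_measurable (bep_space \<Otimes>\<^sub>M count_space UNIV)"
      by (intro measurable_compose_countable[where g = snd and
            f = "\<lambda>\<eta> x. ennreal (poisson_density (fst x) \<eta>) * indicator A \<eta>"] measurable_compose[OF measurable_fst]) auto
    then have "(\<lambda>\<zeta>. \<integral>\<^sup>+\<eta>. ennreal (poisson_density \<zeta> \<eta>) * indicator A \<eta> \<partial>count_space UNIV) \<in> borel_measurable bep_space"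
      by (intro sigma_finite_measure.borel_measurable_nn_integral sigma_finite_measure_count_space)
         (simp add: case_prod_beta')
    then show "(\<lambda>\<zeta>. emeasure (poisson_product \<zeta>) A) \<in> borel_measurable bep_space"
      by (rule measurable_cong[THEN iffD1, rotated])
         (simp add: space_bep_space poisson_product_density emeasure_density)
  qed (auto simp: sets_poisson_product intro: prob_space_imp_subprob_space prob_space_poisson_product)
qed (rule prob_space_poisson_product)

lemma
  assumes "\<Xi> \<in> space (prob_algebra bep_space)"
  shows prob_space_mixture: "prob_space (poisson_mixture \<Xi>)"
    and sets_mixture: "sets (poisson_mixture \<Xi>) = UNIV"
    and measure_mixture: "measure (poisson_mixture \<Xi>) {\<eta>} = (\<integral>\<zeta>. poisson_density \<zeta> \<eta> \<partial>\<Xi>)"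
    and integral_mixture: "(\<And>\<eta>. \<bar>f \<eta>\<bar> \<le> B) \<Longrightarrow> (\<integral>\<eta>. f \<eta> \<partial>poisson_mixture \<Xi>) = (\<integral>\<zeta>. poisson_intertwiner f \<zeta> \<partial>\<Xi>)"
proof -
  interpret prob_space \<Xi>
    using assms by (simp add: space_prob_algebra)
  have s: "sets \<Xi> = sets bep_space"
    using assms by (simp add: space_prob_algebra)
  then have sp: "space \<Xi> = orthant"
    using sets_eq_imp_space_eq[OF s] by (simp add: space_bep_space)
  have k: "poisson_product \<in> \<Xi> \<rightarrow>\<^sub>M subprob_algebra (count_space UNIV)"
    using measurable_prob_algebraD[OF poisson_product_kernel] by (simp cong: measurable_cong_sets add: s)
  show "prob_space (poisson_mixture \<Xi>)" "sets (poisson_mixture \<Xi>) = UNIV"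
    using prob_space_bind'[OF assms poisson_product_kernel] sets_bind'[OF assms poisson_product_kernel]
    by (auto simp: poisson_mixture_def)
  show "measure (poisson_mixture \<Xi>) {\<eta>} = (\<integral>\<zeta>. poisson_density \<zeta> \<eta> \<partial>\<Xi>)"
  proof -
    have "measure (\<Xi> \<bind> poisson_product) {\<eta>} = (\<integral>\<zeta>. measure (poisson_product \<zeta>) {\<eta>} \<partial>\<Xi>)"
      by (rule measure_bind[OF k]) simp
    also have "\<dots> = (\<integral>\<zeta>. poisson_density \<zeta> \<eta> \<partial>\<Xi>)"
      by (intro Bochner_Integration.integral_cong refl) (simp add: sp measure_poisson_product)
    finally show ?thesis
      by (simp add: poisson_mixture_def)
  qed
  show "(\<integral>\<eta>. f \<eta> \<partial>poisson_mixture \<Xi>) = (\<integral>\<zeta>. poisson_intertwiner f \<zeta> \<partial>\<Xi>)" if "\<And>\<eta>. \<bar>f \<eta>\<bar> \<le> B"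
    unfolding poisson_mixture_def poisson_intertwiner_def
    by (rule integral_bind[OF _ _ k, where B = B and B' = 1])
       (auto simp: that prob_space.emeasure_space_1[OF prob_space_poisson_product] finite_measure_axioms)
qed

lemma poisson_integrable_bounded: "(\<And>\<eta>. \<bar>f \<eta>\<bar> \<le> B) \<Longrightarrow> poisson_integrable f"
  unfolding poisson_integrable_def
  by (intro ballI finite_measure.integrable_const_bound[where B = B] prob_space.finite_measure prob_space_poisson_product)
     (auto simp: measurable_def sets_poisson_product)

lemma intertwiner_indicator:
  assumes "\<zeta> \<in> orthant"
  shows "poisson_intertwiner (indicator {\<eta>}) \<zeta> = pow_fact \<zeta> \<eta> * exp (- (\<Sum>i\<in>UNIV. \<zeta> i))"
  unfolding poisson_intertwiner_def using measure_poisson_product[OF assms, of \<eta>]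
  by (simp add: sets_poisson_product poisson_density_def)

section \<open>Dynkin's formula for Poisson weights and the semigroup identity\<close>

context boundary_driven_sip
begin

lemma bep_dynkin_density:
  assumes K: "bep_semigroup s p c \<alpha> \<gamma> K" and \<zeta>: "\<zeta> \<in> orthant" and t: "0 \<le> t"
  shows "((\<lambda>u. \<integral>\<xi>. bep_generator s p c \<alpha> \<gamma> (poisson_intertwiner (indicator {\<eta>})) \<xi> \<partial>K u \<zeta>) has_integral
    ((\<integral>\<xi>. poisson_density \<xi> \<eta> \<partial>K t \<zeta>) - poisson_density \<zeta> \<eta>)) {0..t}"
proof -
  let ?\<Sigma> = "\<lambda>\<xi> :: 'v \<Rightarrow> real. \<Sum>i\<in>UNIV. \<xi> i"
  define A0 where "A0 = gen_coeff0 s p c \<alpha> \<gamma> \<eta>"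
  define A1 where "A1 = gen_coeff1 s c \<alpha> \<gamma> \<eta>"
  define A2 where "A2 = gen_coeff2 c \<alpha> \<eta>"
  have A: "subexponential A0" "subexponential A1" "subexponential A2"
    unfolding A0_def A1_def A2_def by (rule subexponential_gen_coeff)+
  define f where "f n \<xi> = pow_fact \<xi> \<eta> * cut0 n (?\<Sigma> \<xi>)" for n \<xi>
  define g where "g n \<xi> = A0 \<xi> * cut0 n (?\<Sigma> \<xi>) + A1 \<xi> * cut1 n (?\<Sigma> \<xi>) + A2 \<xi> * cut2 n (?\<Sigma> \<xi>)" for n \<xi>
  \<comment> \<open>The coefficients of \<open>g n\<close> with \<open>exp (- x)\<close> and its
    derivatives in place of the cut-offs: the generator applied to the limiting Poisson
    weight.\<close>
  define h where "h \<xi> = A0 \<xi> * exp (- ?\<Sigma> \<xi>) + A1 \<xi> * (- exp (- ?\<Sigma> \<xi>)) + A2 \<xi> * exp (- ?\<Sigma> \<xi>)" for \<xi>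
  have gen_f: "bep_generator s p c \<alpha> \<gamma> (f n) \<xi> = g n \<xi>" if "\<xi> \<in> orthant" for n \<xi>
    unfolding g_def A0_def A1_def A2_def
    by (rule bep_generator_radial[OF _ cut0_derivative cut1_derivative cut2_continuous that]) (simp add: f_def)
  have gen_h: "bep_generator s p c \<alpha> \<gamma> (poisson_intertwiner (indicator {\<eta>})) \<xi> = h \<xi>" if "\<xi> \<in> orthant" for \<xi>
    unfolding h_def A0_def A1_def A2_def
  proof (rule bep_generator_radial[OF intertwiner_indicator _ _ _ that])
    show "((\<lambda>x. exp (- x)) has_real_derivative - exp (- x)) (at x)" for x :: real
      by (auto intro!: derivative_eq_intros)
    show "((\<lambda>x. - exp (- x)) has_real_derivative exp (- x)) (at x)" for x :: real
      by (auto intro!: derivative_eq_intros)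
  qed (auto intro!: continuous_intros)
  have test: "f n \<in> bep_test_functions" for n
  proof -
    have "C2_orthant (f n)"
      by (rule C2_orthant_radial[OF _ cut0_derivative cut1_derivative cut2_continuous]) (simp add: f_def)
    moreover have "\<xi> i \<le> real (n + 3)" if "\<xi> \<in> orthant" "f n \<xi> \<noteq> 0" for \<xi> i
    proof -
      have "cut_base n (?\<Sigma> \<xi>) \<noteq> 0"
        using that(2) by (auto simp: f_def cut0_def)
      then have "?\<Sigma> \<xi> \<le> real (n + 3)"
        by (auto simp: cut_base_def max_def divide_le_eq split: if_splits)
      moreover have "\<xi> i \<le> ?\<Sigma> \<xi>"
        using orthantD[OF that(1)] by (intro member_le_sum) auto
      ultimately show ?thesis
        by linarith
    qed
    ultimately show ?thesis
      unfolding bep_test_functions_def by blast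
  qed
  have K_prob: "prob_space (K u \<zeta>)" and K_sets: "sets (K u \<zeta>) = sets bep_space" if "0 \<le> u" for u
    using K that \<zeta> measurable_space[of "K u" bep_space "prob_algebra bep_space" \<zeta>]
    by (auto simp: bep_semigroup_def has_generator_def markov_semigroup_def space_bep_space space_prob_algebra)
  have K_space: "space (K u \<zeta>) = orthant" if "0 \<le> u" for u
    using sets_eq_imp_space_eq[OF K_sets[OF that]] by (simp add: space_bep_space)
  have meas: "k \<in> borel_measurable (K u \<zeta>)" if "continuous_on UNIV k" "0 \<le> u" for k :: "('v \<Rightarrow> real) \<Rightarrow> real" and u
    using continuous_bep_measurable[OF continuous_on_subset[OF that(1) subset_UNIV]]
    by (simp cong: measurable_cong_sets add: K_sets[OF that(2)])
  have cont: "continuous_on UNIV (\<lambda>\<xi>. k \<xi> * \<phi> (?\<Sigma> \<xi>))" if "subexponential k" "continuous_on UNIV \<phi>" for k \<phi>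
    using that unfolding subexponential_def
    by (intro continuous_on_mult continuous_on_compose2[OF that(2)] continuous_on_sum continuous_on_product_coordinates) auto
  have cut_cont: "continuous_on UNIV (cut0 n)" "continuous_on UNIV (cut1 n)" for n
    by (meson cut0_derivative cut1_derivative DERIV_isCont continuous_at_imp_continuous_on)+
  have f_cont: "continuous_on UNIV (f n)" for n
    unfolding f_def by (intro cont subexponential_pow_fact cut_cont)
  have g_cont: "continuous_on UNIV (g n)" for n
    unfolding g_def by (intro continuous_on_add cont A cut_cont cut2_continuous)
  have h_cont: "continuous_on UNIV h"
    unfolding h_def by (intro continuous_on_add cont[where \<phi> = "\<lambda>x. exp (- x)"] cont[where \<phi> = "\<lambda>x. - exp (- x)"] A)
      (auto intro!: continuous_intros)
  \<comment> \<open>A subexponential coefficient times the common bound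
    \<open>exp (- \<bar>\<zeta>\<bar> / 3)\<close> of the cut-offs is bounded. This supplies
    constant majorants both under \<open>K u \<zeta>\<close> and in time.\<close>
  have damp: "\<exists>C. \<forall>\<phi> \<xi>. \<xi> \<in> orthant \<longrightarrow> \<bar>\<phi>\<bar> \<le> exp (- (1 / 3 * ?\<Sigma> \<xi>)) \<longrightarrow> \<bar>k \<xi> * \<phi>\<bar> \<le> C"
    if k: "subexponential k" for k
  proof -
    obtain C where C: "\<And>\<xi>. \<xi> \<in> orthant \<Longrightarrow> \<bar>k \<xi>\<bar> \<le> C * exp (1 / 3 * ?\<Sigma> \<xi>)"
      using k[unfolded subexponential_def, THEN conjunct2, rule_format, of "1 / 3"] by auto
    have "\<bar>k \<xi> * \<phi>\<bar> \<le> C" if "\<xi> \<in> orthant" "\<bar>\<phi>\<bar> \<le> exp (- (1 / 3 * ?\<Sigma> \<xi>))" for \<phi> \<xi>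
    proof -
      have "\<bar>k \<xi>\<bar> * \<bar>\<phi>\<bar> \<le> C * exp (1 / 3 * ?\<Sigma> \<xi>) * exp (- (1 / 3 * ?\<Sigma> \<xi>))"
        using C[OF that(1)] that(2) by (intro mult_mono) (auto intro: order_trans[OF abs_ge_zero])
      also have "\<dots> = C"
        by (simp add: mult.assoc exp_add[symmetric])
      finally show ?thesis
        by (simp add: abs_mult)
    qed
    then show ?thesis by blast
  qed
  obtain C0 where C0: "\<And>\<phi> \<xi>. \<xi> \<in> orthant \<Longrightarrow> \<bar>\<phi>\<bar> \<le> exp (- (1 / 3 * ?\<Sigma> \<xi>)) \<Longrightarrow> \<bar>A0 \<xi> * \<phi>\<bar> \<le> C0"
    using damp[OF A(1)] by blast
  obtain C1 where C1: "\<And>\<phi> \<xi>. \<xi> \<in> orthant \<Longrightarrow> \<bar>\<phi>\<bar> \<le> exp (- (1 / 3 * ?\<Sigma> \<xi>)) \<Longrightarrow> \<bar>A1 \<xi> * \<phi>\<bar> \<le> C1"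
    using damp[OF A(2)] by blast
  obtain C2 where C2: "\<And>\<phi> \<xi>. \<xi> \<in> orthant \<Longrightarrow> \<bar>\<phi>\<bar> \<le> exp (- (1 / 3 * ?\<Sigma> \<xi>)) \<Longrightarrow> \<bar>A2 \<xi> * \<phi>\<bar> \<le> C2"
    using damp[OF A(3)] by blast
  obtain Cf where Cf: "\<And>\<phi> \<xi>. \<xi> \<in> orthant \<Longrightarrow> \<bar>\<phi>\<bar> \<le> exp (- (1 / 3 * ?\<Sigma> \<xi>)) \<Longrightarrow> \<bar>pow_fact \<xi> \<eta> * \<phi>\<bar> \<le> Cf"
    using damp[OF subexponential_pow_fact[of \<eta>]] by blast
  have f_bound: "\<bar>f n \<xi>\<bar> \<le> Cf" if "\<xi> \<in> orthant" for n \<xi>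
    unfolding f_def by (intro Cf that cut_bounds orthant_sum_nonneg)
  have g_bound: "\<bar>g n \<xi>\<bar> \<le> C0 + C1 + C2" if "\<xi> \<in> orthant" for n \<xi>
  proof -
    have "\<bar>A0 \<xi> * cut0 n (?\<Sigma> \<xi>)\<bar> \<le> C0" "\<bar>A1 \<xi> * cut1 n (?\<Sigma> \<xi>)\<bar> \<le> C1" "\<bar>A2 \<xi> * cut2 n (?\<Sigma> \<xi>)\<bar> \<le> C2"
      by (intro C0 C1 C2 that cut_bounds orthant_sum_nonneg)+
    then show ?thesis
      unfolding g_def by linarith
  qed
  have "0 \<le> C0 + C1 + C2"
    using g_bound[of "\<lambda>_. 0" 0] by (simp add: orthant_def)
  have lim_f: "(\<lambda>n. \<integral>\<xi>. f n \<xi> \<partial>K u \<zeta>) \<longlonglongrightarrow> (\<integral>\<xi>. poisson_density \<xi> \<eta> \<partial>K u \<zeta>)" if "0 \<le> u" for u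
  proof -
    interpret prob_space "K u \<zeta>" by (rule K_prob[OF that])
    show ?thesis
    proof (rule integral_dominated_convergence[where w = "\<lambda>_. Cf"])
      show "AE \<xi> in K u \<zeta>. (\<lambda>n. f n \<xi>) \<longlonglongrightarrow> poisson_density \<xi> \<eta>"
        unfolding f_def poisson_density_def by (intro AE_I2 tendsto_intros cut_limits)
      show "AE \<xi> in K u \<zeta>. norm (f n \<xi>) \<le> Cf" for n
        using f_bound by (intro AE_I2) (simp add: K_space that)
    qed (auto intro!: meas f_cont poisson_density_continuous that)
  qed
  have g_K_bound: "\<bar>\<integral>\<xi>. g n \<xi> \<partial>K u \<zeta>\<bar> \<le> C0 + C1 + C2" if "0 \<le> u" for n u
  proof -
    interpret prob_space "K u \<zeta>" by (rule K_prob[OF that])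
    have "\<bar>\<integral>\<xi>. g n \<xi> \<partial>K u \<zeta>\<bar> \<le> (\<integral>\<xi>. \<bar>g n \<xi>\<bar> \<partial>K u \<zeta>)"
      by (rule integral_abs_bound)
    also have "\<dots> \<le> (\<integral>\<xi>. C0 + C1 + C2 \<partial>K u \<zeta>)"
      using g_bound \<open>0 \<le> C0 + C1 + C2\<close>
      by (intro integral_mono integrable_abs integrable_const_bound[where B = "C0 + C1 + C2"] meas g_cont that AE_I2)
         (auto simp: K_space that)
    finally show ?thesis
      by (simp add: prob_space)
  qed
  have lim_g: "(\<lambda>n. \<integral>\<xi>. g n \<xi> \<partial>K u \<zeta>) \<longlonglongrightarrow> (\<integral>\<xi>. h \<xi> \<partial>K u \<zeta>)" if "0 \<le> u" for u
  proof -
    interpret prob_space "K u \<zeta>" by (rule K_prob[OF that])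
    show ?thesis
    proof (rule integral_dominated_convergence[where w = "\<lambda>_. C0 + C1 + C2"])
      show "AE \<xi> in K u \<zeta>. (\<lambda>n. g n \<xi>) \<longlonglongrightarrow> h \<xi>"
        unfolding g_def h_def by (intro AE_I2 tendsto_intros cut_limits)
      show "AE \<xi> in K u \<zeta>. norm (g n \<xi>) \<le> C0 + C1 + C2" for n
        using g_bound by (intro AE_I2) (simp add: K_space that)
    qed (auto intro!: meas g_cont h_cont that)
  qed
  have int: "((\<lambda>u. \<integral>\<xi>. g n \<xi> \<partial>K u \<zeta>) has_integral ((\<integral>\<xi>. f n \<xi> \<partial>K t \<zeta>) - f n \<zeta>)) {0..t}" for n
  proof (rule has_integral_eq)
    show "((\<lambda>u. \<integral>\<xi>. bep_generator s p c \<alpha> \<gamma> (f n) \<xi> \<partial>K u \<zeta>) has_integral ((\<integral>\<xi>. f n \<xi> \<partial>K t \<zeta>) - f n \<zeta>)) {0..t}"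
      using K test[of n] \<zeta> t by (auto simp: bep_semigroup_def has_generator_def space_bep_space)
    show "(\<integral>\<xi>. bep_generator s p c \<alpha> \<gamma> (f n) \<xi> \<partial>K u \<zeta>) = (\<integral>\<xi>. g n \<xi> \<partial>K u \<zeta>)" if "u \<in> {0..t}" for u
      using that by (intro Bochner_Integration.integral_cong refl gen_f) (auto simp: K_space)
  qed
  have "(\<lambda>u. \<integral>\<xi>. h \<xi> \<partial>K u \<zeta>) integrable_on {0..t}"
    "(\<lambda>n. integral {0..t} (\<lambda>u. \<integral>\<xi>. g n \<xi> \<partial>K u \<zeta>)) \<longlonglongrightarrow> integral {0..t} (\<lambda>u. \<integral>\<xi>. h \<xi> \<partial>K u \<zeta>)"
    by (rule dominated_convergence[where h = "\<lambda>_. C0 + C1 + C2" and f = "\<lambda>n u. \<integral>\<xi>. g n \<xi> \<partial>K u \<zeta>"];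
        use int g_K_bound lim_g in \<open>auto simp: integrable_on_def\<close>)+
  note dc = this
  have "(\<lambda>n. (\<integral>\<xi>. f n \<xi> \<partial>K t \<zeta>) - f n \<zeta>) \<longlonglongrightarrow> (\<integral>\<xi>. poisson_density \<xi> \<eta> \<partial>K t \<zeta>) - poisson_density \<zeta> \<eta>"
    unfolding f_def[of _ \<zeta>] poisson_density_def[of \<zeta>] by (intro tendsto_intros lim_f t cut_limits)
  then have "integral {0..t} (\<lambda>u. \<integral>\<xi>. h \<xi> \<partial>K u \<zeta>) = (\<integral>\<xi>. poisson_density \<xi> \<eta> \<partial>K t \<zeta>) - poisson_density \<zeta> \<eta>"
    using LIMSEQ_unique[OF dc(2)[unfolded integral_unique[OF int]]] by blast
  then have *: "((\<lambda>u. \<integral>\<xi>. h \<xi> \<partial>K u \<zeta>) has_integral (\<integral>\<xi>. poisson_density \<xi> \<eta> \<partial>K t \<zeta>) - poisson_density \<zeta> \<eta>) {0..t}"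
    using integrable_integral[OF dc(1)] by simp
  show ?thesis
    by (rule has_integral_eq[OF _ *], rule Bochner_Integration.integral_cong[OF refl])
       (auto simp: K_space gen_h)
qed

end

context boundary_driven_sip
begin

lemma bep_kernel:
  "bep_semigroup s p c \<alpha> \<gamma> K \<Longrightarrow> 0 \<le> t \<Longrightarrow> K t \<in> bep_space \<rightarrow>\<^sub>M prob_algebra bep_space"
  by (simp add: bep_semigroup_def has_generator_def markov_semigroup_def)

lemma bep_kernel_space:
  "bep_semigroup s p c \<alpha> \<gamma> K \<Longrightarrow> 0 \<le> t \<Longrightarrow> \<zeta> \<in> orthant \<Longrightarrow> K t \<zeta> \<in> space (prob_algebra bep_space)"
  using measurable_space[OF bep_kernel] by (simp add: space_bep_space)

lemma semigroup_intertwining: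
  assumes S: "sip_semigroup s p c \<alpha> \<gamma> S" and K: "bep_semigroup s p c \<alpha> \<gamma> K"
    and \<zeta>: "\<zeta> \<in> orthant" and t: "0 \<le> t"
  shows "poisson_product \<zeta> \<bind> S t = poisson_mixture (K t \<zeta>)"
proof -
  interpret jump_semigroup sip_rate sip_jump particles boundary_rate S
    by unfold_locales (use S in \<open>simp add: sip_semigroup_def gen_sip\<close>)
  have K0: "poisson_mixture (K 0 \<zeta>) = poisson_product \<zeta>"
    using K \<zeta> bind_return[OF measurable_prob_algebraD[OF poisson_product_kernel], of \<zeta>]
    by (simp add: bep_semigroup_def has_generator_def markov_semigroup_def space_bep_space poisson_mixture_def)
  have "forward_solution (\<lambda>t. poisson_mixture (K t \<zeta>))"
    unfolding forward_solution_def
  proof (intro conjI allI impI)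
    fix \<eta> and t :: real assume t: "0 \<le> t"
    let ?A = "gen (indicator {\<eta>})"
    have m: "K u \<zeta> \<in> space (prob_algebra bep_space)" if "0 \<le> u" for u
      by (rule bep_kernel_space[OF K that \<zeta>])
    \<comment> \<open>The generator of an indicator has finite support, hence is bounded, as
      exchanging the integrals in \<open>integral_mixture\<close> requires.\<close>
    obtain B where B: "\<And>\<xi>. \<bar>?A \<xi>\<bar> \<le> B"
      using finite_support_bounded[OF gen_finite_support[OF finite_support_indicator]] by blast
    have PI: "poisson_integrable (indicator {\<eta>})"
      by (rule poisson_integrable_bounded[where B = 1]) (simp add: indicator_def)
    have "(\<integral>\<xi>. bep_generator s p c \<alpha> \<gamma> (poisson_intertwiner (indicator {\<eta>})) \<xi> \<partial>K u \<zeta>)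
        = (\<integral>\<xi>. ?A \<xi> \<partial>poisson_mixture (K u \<zeta>))" if "u \<in> {0..t}" for u
    proof -
      have u: "0 \<le> u" using that by simp
      then have "space (K u \<zeta>) = orthant"
        using m[OF u] sets_eq_imp_space_eq[of "K u \<zeta>" bep_space] by (simp add: space_prob_algebra space_bep_space)
      then have "(\<integral>\<xi>. bep_generator s p c \<alpha> \<gamma> (poisson_intertwiner (indicator {\<eta>})) \<xi> \<partial>K u \<zeta>)
          = (\<integral>\<xi>. poisson_intertwiner ?A \<xi> \<partial>K u \<zeta>)"
        by (intro Bochner_Integration.integral_cong refl)
           (simp add: gen_sip intertwiner_sip_generator[OF PI])
      also have "\<dots> = (\<integral>\<xi>. ?A \<xi> \<partial>poisson_mixture (K u \<zeta>))"
        by (rule integral_mixture[OF m[OF u] B, symmetric])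
      finally show ?thesis .
    qed
    from has_integral_eq[OF this bep_dynkin_density[OF K \<zeta> t]]
    show "((\<lambda>u. \<integral>y. ?A y \<partial>poisson_mixture (K u \<zeta>)) has_integral
        measure (poisson_mixture (K t \<zeta>)) {\<eta>} - measure (poisson_mixture (K 0 \<zeta>)) {\<eta>}) {0..t}"
      by (simp add: measure_mixture[OF m[OF t]] K0 measure_poisson_product[OF \<zeta>])
  qed (simp_all add: prob_space_mixture sets_mixture bep_kernel_space[OF K _ \<zeta>])
  from forward_solution_eq_bind[OF this t] show ?thesis
    by (simp add: K0)
qed

end

section \<open>Injectivity of the Poisson mixture\<close>

lemma pow_exp_bound: "0 \<le> x \<Longrightarrow> 0 < \<delta> \<Longrightarrow> x ^ k * exp (- (\<delta> * x)) \<le> fact k / \<delta> ^ k" for x \<delta> :: real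
proof -
  assume x: "0 \<le> x" and \<delta>: "0 < \<delta>"
  have "(\<delta> * x) ^ k / fact k \<le> exp (\<delta> * x)"
    using x \<delta> by (intro exp_ge_power_fact) simp
  then have "(\<delta> * x) ^ k / fact k * exp (- (\<delta> * x)) \<le> exp (\<delta> * x) * exp (- (\<delta> * x))"
    by (rule mult_right_mono) simp
  then have "\<delta> ^ k * (x ^ k * exp (- (\<delta> * x))) \<le> fact k"
    by (simp add: exp_minus power_mult_distrib field_simps)
  then show ?thesis
    using \<delta> by (simp add: le_divide_eq mult.commute)
qed

text \<open>Expanding \<open>exp (- b x) = exp (- a x) * exp ((a - b) x)\<close> in powers of \<open>(a - b) x\<close> is legitimate for
  \<open>0 < b < 2 a\<close>; iterating over \<open>a = (3/2)\<^sup>n\<close> reaches every \<open>b > 0\<close>.\<close>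

locale nonneg_finite_borel = finite_measure M for M :: "real measure" +
  assumes sets_borel: "sets M = sets borel" and nonneg: "AE x in M. 0 \<le> x"
begin

lemma measurable_borel: "f \<in> borel_measurable borel \<Longrightarrow> f \<in> borel_measurable M"
  by (simp cong: measurable_cong_sets add: sets_borel)

lemma integrable_pow_exp: "0 < a \<Longrightarrow> integrable M (\<lambda>x. x ^ k * exp (- (a * x)))"
  by (rule integrable_const_bound[where B = "fact k / a ^ k"])
     (use nonneg in \<open>auto intro!: measurable_borel pow_exp_bound elim!: eventually_mono\<close>)

lemma pow_exp_expansion:
  assumes a: "0 < b" "b < 2 * a"
  shows "(\<lambda>n. \<Sum>j<n. (a - b) ^ j / fact j * (\<integral>x. x ^ (k + j) * exp (- (a * x)) \<partial>M)) \<longlonglongrightarrow> (\<integral>x. x ^ k * exp (- (b * x)) \<partial>M)"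
proof -
  \<comment> \<open>Dominating the partial sums by \<open>exp (\<bar>a - b\<bar> * x)\<close> leaves
    decay at rate \<open>\<delta>\<close>, which is positive exactly for
    \<open>0 < b < 2 * a\<close>.\<close>
  define \<delta> where "\<delta> = a - \<bar>a - b\<bar>"
  have \<delta>: "0 < \<delta>" "0 < a"
    using a by (auto simp: \<delta>_def abs_if)
  define f where "f n x = (\<Sum>j<n. (a - b) ^ j / fact j * (x ^ (k + j) * exp (- (a * x))))" for n and x :: real
  have f: "f n x = x ^ k * exp (- (a * x)) * (\<Sum>j<n. ((a - b) * x) ^ j / fact j)" for n x
    unfolding f_def sum_distrib_left by (intro sum.cong) (auto simp: power_add power_mult_distrib)
  have "(\<lambda>n. \<integral>x. f n x \<partial>M) \<longlonglongrightarrow> (\<integral>x. x ^ k * exp (- (b * x)) \<partial>M)"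
  proof (rule integral_dominated_convergence[where w = "\<lambda>x. x ^ k * exp (- (\<delta> * x))"])
    show "integrable M (\<lambda>x. x ^ k * exp (- (\<delta> * x)))"
      by (rule integrable_pow_exp[OF \<delta>(1)])
    have "(\<lambda>n. f n x) \<longlonglongrightarrow> x ^ k * exp (- (b * x))" for x
    proof -
      have "(\<lambda>j. ((a - b) * x) ^ j / fact j) sums exp ((a - b) * x)"
        using exp_converges[of "(a - b) * x"] by (simp add: divide_inverse mult.commute)
      then have "(\<lambda>n. f n x) \<longlonglongrightarrow> x ^ k * exp (- (a * x)) * exp ((a - b) * x)"
        unfolding f sums_def by (intro tendsto_mult tendsto_const)
      also have "x ^ k * exp (- (a * x)) * exp ((a - b) * x) = x ^ k * exp (- (b * x))"
        by (simp add: mult.assoc exp_add[symmetric] algebra_simps)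
      finally show ?thesis .
    qed
    then show "AE x in M. (\<lambda>n. f n x) \<longlonglongrightarrow> x ^ k * exp (- (b * x))"
      by simp
    have "norm (f n x) \<le> x ^ k * exp (- (\<delta> * x))" if x: "0 \<le> x" for n x
    proof -
      have "\<bar>\<Sum>j<n. ((a - b) * x) ^ j / fact j\<bar> \<le> (\<Sum>j<n. (\<bar>a - b\<bar> * x) ^ j / fact j)"
        by (rule order_trans[OF sum_abs]) (simp add: power_abs abs_mult x)
      also have "\<dots> \<le> (\<Sum>j. (\<bar>a - b\<bar> * x) ^ j / fact j)"
        using x summable_exp[of "\<bar>a - b\<bar> * x"]
        by (intro sum_le_suminf) (auto simp: divide_inverse mult.commute)
      also have "\<dots> = exp (\<bar>a - b\<bar> * x)"
        by (simp add: exp_def divide_inverse mult.commute)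
      finally have "norm (f n x) \<le> x ^ k * exp (- (a * x)) * exp (\<bar>a - b\<bar> * x)"
        unfolding f using x by (simp add: abs_mult mult_left_mono)
      also have "\<dots> = x ^ k * exp (- (\<delta> * x))"
        by (simp add: mult.assoc exp_add[symmetric] \<delta>_def algebra_simps)
      finally show ?thesis .
    qed
    then show "AE x in M. norm (f n x) \<le> x ^ k * exp (- (\<delta> * x))" for n
      using nonneg by (auto elim!: eventually_mono)
  qed (auto intro!: measurable_borel simp: f_def)
  also have "(\<lambda>n. \<integral>x. f n x \<partial>M) = (\<lambda>n. \<Sum>j<n. (a - b) ^ j / fact j * (\<integral>x. x ^ (k + j) * exp (- (a * x)) \<partial>M))"
    unfolding f_def using integrable_pow_exp[OF \<delta>(2)]
    by (intro ext, subst Bochner_Integration.integral_sum) auto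
  finally show ?thesis .
qed

end

section \<open>Uniqueness of Laplace transforms on the half-line\<close>

context
  fixes M N :: "real measure"
  assumes M: "nonneg_finite_borel M" and N: "nonneg_finite_borel N"
    and moments: "\<And>k. (\<integral>x. x ^ k * exp (- x) \<partial>M) = (\<integral>x. x ^ k * exp (- x) \<partial>N)"
begin

interpretation M: nonneg_finite_borel M by (rule M)
interpretation N: nonneg_finite_borel N by (rule N)

lemma pow_exp_eq_step:
  assumes "\<And>k. (\<integral>x. x ^ k * exp (- (a * x)) \<partial>M) = (\<integral>x. x ^ k * exp (- (a * x)) \<partial>N)" "0 < b" "b < 2 * a"
  shows "(\<integral>x. x ^ k * exp (- (b * x)) \<partial>M) = (\<integral>x. x ^ k * exp (- (b * x)) \<partial>N)"
  using M.pow_exp_expansion[OF assms(2,3), of k] N.pow_exp_expansion[OF assms(2,3), of k]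
  unfolding assms(1) by (rule LIMSEQ_unique)

lemma pow_exp_eq:
  assumes "0 < b"
  shows "(\<integral>x. x ^ k * exp (- (b * x)) \<partial>M) = (\<integral>x. x ^ k * exp (- (b * x)) \<partial>N)"
proof -
  have pow: "(\<integral>x. x ^ k * exp (- ((3 / 2) ^ n * x)) \<partial>M) = (\<integral>x. x ^ k * exp (- ((3 / 2) ^ n * x)) \<partial>N)" for n k
  proof (induction n arbitrary: k)
    case (Suc n)
    show ?case
      by (rule pow_exp_eq_step[OF Suc.IH]) auto
  qed (simp add: moments)
  obtain n where "b < (3 / 2) ^ n"
    using real_arch_pow[of "3 / 2" b] by auto
  then have "b < 2 * (3 / 2) ^ n"
    using assms by linarith
  then show ?thesis
    by (rule pow_exp_eq_step[OF pow assms])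
qed

text \<open>Only exponents \<open>b > 0\<close> are reached by the expansion. Hence functions of
  \<open>y = exp (- x)\<close> are first handled with an extra factor \<open>y\<close>, which is
  divided out near the end.\<close>

lemma exp_poly_eq: "(\<integral>x. exp (- x) * exp (- x) ^ n \<partial>M) = (\<integral>x. exp (- x) * exp (- x) ^ n \<partial>N)"
proof -
  have "exp (- x) * exp (- x) ^ n = x ^ 0 * exp (- (real (Suc n) * x))" for x :: real
    by (simp add: exp_of_nat_mult[symmetric] exp_add[symmetric] algebra_simps)
  then show ?thesis
    using pow_exp_eq[of "real (Suc n)" 0] by simp
qed

lemma integrable_exp_bounded:
  assumes "nonneg_finite_borel L" "F \<in> borel_measurable borel" "\<And>y. y \<in> {0..1} \<Longrightarrow> \<bar>F y\<bar> \<le> B"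
  shows "integrable L (\<lambda>x. exp (- x) * F (exp (- x)))"
proof -
  interpret L: nonneg_finite_borel L by fact
  note assms(2)[measurable]
  have "norm (exp (- x) * F (exp (- x))) \<le> B" if "0 \<le> x" for x :: real
  proof -
    have "\<bar>exp (- x)\<bar> * \<bar>F (exp (- x))\<bar> \<le> 1 * B"
      using that assms(3)[of "exp (- x)"] by (intro mult_mono) auto
    then show ?thesis
      by (simp add: abs_mult)
  qed
  then show ?thesis
    using L.nonneg by (intro L.integrable_const_bound[where B = B]) (auto intro!: L.measurable_borel elim!: eventually_mono)
qed

lemma integral_exp_polynomial_eq:
  "(\<integral>x. exp (- x) * (\<Sum>k\<le>n. a k * Bernstein n k (exp (- x))) \<partial>M)
    = (\<integral>x. exp (- x) * (\<Sum>k\<le>n. a k * Bernstein n k (exp (- x))) \<partial>N)"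
proof -
  have B: "Bernstein n k y = (\<Sum>j\<le>n - k. real (n choose k) * (real ((n - k) choose j) * (-1) ^ j) * y ^ (k + j))"
    if "k \<le> n" for k and y :: real
  proof -
    have "(1 - y) ^ (n - k) = (\<Sum>j\<le>n - k. real ((n - k) choose j) * (- y) ^ j * 1 ^ (n - k - j))"
      using binomial_ring[of "- y" 1 "n - k"] by simp
    then show ?thesis
      by (simp add: Bernstein_def sum_distrib_left sum_distrib_right power_add power_minus[of y] mult_ac)
  qed
  have e: "exp (- x) * (\<Sum>k\<le>n. a k * Bernstein n k (exp (- x)))
    = (\<Sum>k\<le>n. \<Sum>j\<le>n - k. a k * (real (n choose k) * (real ((n - k) choose j) * (-1) ^ j)) * (exp (- x) * exp (- x) ^ (k + j)))" for x :: real
    unfolding sum_distrib_left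
    by (intro sum.cong refl) (simp add: B sum_distrib_left mult_ac)
  have i: "integrable L (\<lambda>x. exp (- x) * exp (- x) ^ m)" if "nonneg_finite_borel L" for L m
    by (rule integrable_exp_bounded[OF that, where B = 1 and F = "\<lambda>y. y ^ m"]) (auto simp: power_le_one abs_of_nonneg)
  show ?thesis
    unfolding e
    by (subst (1 2) Bochner_Integration.integral_sum, (auto intro!: i M N)[2])
       (simp add: Bochner_Integration.integral_sum i M N exp_poly_eq)
qed

text \<open>The substitution \<open>y = exp (- x)\<close> compactifies the half-line into the unit
  interval, where Bernstein polynomials approximate \<open>F\<close> uniformly.\<close>

lemma integral_exp_continuous_eq:
  assumes F: "continuous_on UNIV F"
  shows "(\<integral>x. exp (- x) * F (exp (- x)) \<partial>M) = (\<integral>x. exp (- x) * F (exp (- x)) \<partial>N)"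
proof -
  define P where "P n y = (\<Sum>k\<le>n. F (real k / real n) * Bernstein n k y)" for n y
  obtain B where B: "\<And>y. y \<in> {0..1} \<Longrightarrow> \<bar>F y\<bar> \<le> B"
    using compact_imp_bounded[OF compact_continuous_image[OF continuous_on_subset[OF F subset_UNIV] compact_Icc[of 0 1]]]
    by (fastforce simp: bounded_iff)
  have uni: "\<exists>m. \<forall>n x. m \<le> n \<and> x \<in> {0..1} \<longrightarrow> \<bar>F x - P n x\<bar> < e" if "0 < e" for e
    unfolding P_def using Bernstein_Weierstrass[OF continuous_on_subset[OF F subset_UNIV] that] by blast
  then obtain m where m: "\<And>n x. m \<le> n \<Longrightarrow> x \<in> {0..1} \<Longrightarrow> \<bar>F x - P n x\<bar> < 1"
    using zero_less_one by blast
  have P_meas: "P n \<in> borel_measurable borel" for n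
    unfolding P_def Bernstein_def by measurable
  have P_bound: "\<bar>P (n + m) y\<bar> \<le> B + 1" if "y \<in> {0..1}" for n y
    using m[of "n + m" y] B[OF that] that by (simp add: abs_less_iff abs_le_iff)
  have P_lim: "(\<lambda>n. P (n + m) y) \<longlonglongrightarrow> F y" if "y \<in> {0..1}" for y
  proof (rule LIMSEQ_ignore_initial_segment, rule LIMSEQ_I)
    fix e :: real assume "0 < e"
    from uni[OF this] show "\<exists>no. \<forall>n\<ge>no. norm (P n y - F y) < e"
      using that by (auto simp: abs_minus_commute)
  qed
  have lim: "(\<lambda>n. \<integral>x. exp (- x) * P (n + m) (exp (- x)) \<partial>L) \<longlonglongrightarrow> (\<integral>x. exp (- x) * F (exp (- x)) \<partial>L)"
    if L: "nonneg_finite_borel L" for L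
  proof -
    interpret L: nonneg_finite_borel L by fact
    have [measurable]: "F \<in> borel_measurable borel" "P n \<in> borel_measurable borel" for n
      using F P_meas by (auto intro: borel_measurable_continuous_onI)
    show ?thesis
    proof (rule integral_dominated_convergence[where w = "\<lambda>_. B + 1"])
      show "AE x in L. (\<lambda>n. exp (- x) * P (n + m) (exp (- x))) \<longlonglongrightarrow> exp (- x) * F (exp (- x))"
        using L.nonneg by eventually_elim (intro tendsto_intros P_lim, simp)
      have "norm (exp (- x) * P (n + m) (exp (- x))) \<le> B + 1" if "0 \<le> x" for n x
      proof -
        have "\<bar>exp (- x)\<bar> * \<bar>P (n + m) (exp (- x))\<bar> \<le> 1 * (B + 1)"
          using that by (intro mult_mono P_bound) auto
        then show ?thesis
          by (simp add: abs_mult)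
      qed
      then show "AE x in L. norm (exp (- x) * P (n + m) (exp (- x))) \<le> B + 1" for n
        using L.nonneg by (auto elim!: eventually_mono)
    qed (auto intro!: L.measurable_borel)
  qed
  show ?thesis
    using lim[OF M] lim[OF N] unfolding P_def integral_exp_polynomial_eq by (rule LIMSEQ_unique)
qed

lemma laplace_measure_atMost_eq: "measure M {..a} = measure N {..a}"
proof -
  define d where "d = exp (- a)"
  have d: "0 < d" by (simp add: d_def)
  \<comment> \<open>The numerator is a continuous ramp increasing to the indicator of
    \<open>y \<ge> d\<close>, that is of \<open>x \<le> a\<close>. The denominator cancels the extra
    factor \<open>y\<close> where it matters, and stays away from 0 so that \<open>F n\<close> is
    continuous and bounded.\<close>
  define F where "F n y = max 0 (min 1 (1 + real n * (y - d))) / max y (d / 2)" for n y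
  have F_cont: "continuous_on UNIV (F n)" for n
    unfolding F_def using d by (intro continuous_intros) (auto simp: max_def)
  have F_bound: "\<bar>F n y\<bar> \<le> 2 / d" for n y
  proof -
    have "\<bar>F n y\<bar> \<le> 1 / (d / 2)"
      unfolding F_def abs_divide using d by (intro frac_le) auto
    then show ?thesis by simp
  qed
  have F_lim: "(\<lambda>n. y * F n y) \<longlonglongrightarrow> indicator {d..} y" if "0 < y" for y
  proof (cases "d \<le> y")
    case True
    then have "y * F n y = 1" for n
      using d by (simp add: F_def max_def)
    then show ?thesis
      using True by simp
  next
    case False
    have "\<forall>\<^sub>F n in sequentially. 1 / (d - y) \<le> real n"
      using filterlim_real_sequentially by (rule filterlim_at_top[THEN iffD1, rule_format])
    then have "\<forall>\<^sub>F n in sequentially. y * F n y = 0"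
    proof eventually_elim
      case (elim n)
      then have "1 + real n * (y - d) \<le> 0"
        using False by (simp add: divide_le_eq algebra_simps)
      then show ?case
        by (simp add: F_def)
    qed
    then show ?thesis
      using False by (simp add: tendsto_eventually)
  qed
  have lim: "(\<lambda>n. \<integral>x. exp (- x) * F n (exp (- x)) \<partial>L) \<longlonglongrightarrow> measure L {..a}" if L: "nonneg_finite_borel L" for L
  proof -
    interpret L: nonneg_finite_borel L by fact
    have [measurable]: "F n \<in> borel_measurable borel" for n
      using F_cont by (rule borel_measurable_continuous_onI)
    have "(\<lambda>n. \<integral>x. exp (- x) * F n (exp (- x)) \<partial>L) \<longlonglongrightarrow> (\<integral>x. indicator {d..} (exp (- x)) \<partial>L)"
    proof (rule integral_dominated_convergence[where w = "\<lambda>_. 2 / d"])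
      show "AE x in L. (\<lambda>n. exp (- x) * F n (exp (- x))) \<longlonglongrightarrow> indicator {d..} (exp (- x))"
        by (intro AE_I2 F_lim) simp
      have "norm (exp (- x) * F n (exp (- x))) \<le> 2 / d" if "0 \<le> x" for n x
      proof -
        have "\<bar>exp (- x)\<bar> * \<bar>F n (exp (- x))\<bar> \<le> 1 * (2 / d)"
          using that by (intro mult_mono F_bound) auto
        then show ?thesis
          by (simp add: abs_mult)
      qed
      then show "AE x in L. norm (exp (- x) * F n (exp (- x))) \<le> 2 / d" for n
        using L.nonneg by (auto elim!: eventually_mono)
    qed (auto intro!: L.measurable_borel)
    also have "(\<lambda>x. indicator {d..} (exp (- x)) :: real) = indicator {..a}"
      by (auto simp: fun_eq_iff d_def indicator_def)
    also have "integral\<^sup>L L (indicator {..a}) = measure L {..a}"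
      using L.sets_borel sets_eq_imp_space_eq[OF L.sets_borel] by simp
    finally show ?thesis .
  qed
  show ?thesis
    using lim[OF M] lim[OF N] unfolding integral_exp_continuous_eq[OF F_cont] by (rule LIMSEQ_unique)
qed

lemma laplace_measure_eq: "M = N"
proof (rule cdf_unique')
  show "finite_borel_measure M" "finite_borel_measure N"
    by (unfold_locales; simp add: M.sets_borel N.sets_borel)+
  show "cdf M = cdf N"
    by (simp add: cdf_def fun_eq_iff laplace_measure_atMost_eq)
qed

end

text \<open>Interpolates between the Poisson weights (\<open>F\<close> empty) and indicators of
  boxes (\<open>F\<close> everything), so that coordinates can be converted one at a time.\<close>

definition coordinate_weight :: "'v set \<Rightarrow> ('v \<Rightarrow> nat) \<Rightarrow> ('v \<Rightarrow> real set) \<Rightarrow> 'v \<Rightarrow> real \<Rightarrow> real" where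
  "coordinate_weight F k A i x = (if i \<in> F then indicator (A i) x else x ^ k i * exp (- x))"

lemma coordinate_weight_measurable:
  "(\<And>i. A i \<in> sets borel) \<Longrightarrow> coordinate_weight F k A i \<in> borel_measurable borel"
  unfolding coordinate_weight_def[abs_def] by (cases "i \<in> F") auto

lemma coordinate_weight_bounds:
  "0 \<le> x \<Longrightarrow> 0 \<le> coordinate_weight F k A i x" "0 \<le> x \<Longrightarrow> coordinate_weight F k A i x \<le> fact (k i)"
  using pow_exp_bound[of x 1 "k i"] by (auto simp: coordinate_weight_def indicator_def fact_ge_1)

locale orthant_prob = prob_space \<Xi> for \<Xi> :: "('v::finite \<Rightarrow> real) measure" +
  assumes sets_bep: "sets \<Xi> = sets bep_space"
begin

lemma space_orthant: "space \<Xi> = orthant"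
  using sets_eq_imp_space_eq[OF sets_bep] by (simp add: space_bep_space)

lemma coordinate_measurable: "(\<lambda>\<zeta>. \<zeta> i) \<in> borel_measurable \<Xi>"
  using continuous_bep_measurable[OF continuous_on_subset[OF continuous_on_product_coordinates subset_UNIV]]
  by (simp cong: measurable_cong_sets add: sets_bep)

lemma weight_measurable:
  "(\<And>i. A i \<in> sets borel) \<Longrightarrow> (\<lambda>\<zeta>. \<Prod>j\<in>J. coordinate_weight F k A j (\<zeta> j)) \<in> borel_measurable \<Xi>"
  by (intro borel_measurable_prod measurable_compose[OF coordinate_measurable coordinate_weight_measurable])

lemma weight_bounds:
  assumes "\<zeta> \<in> orthant"
  shows "0 \<le> (\<Prod>j\<in>J. coordinate_weight F k A j (\<zeta> j))"
    and "(\<Prod>j\<in>J. coordinate_weight F k A j (\<zeta> j)) \<le> (\<Prod>j\<in>J. fact (k j))"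
  by (auto intro!: prod_nonneg prod_mono coordinate_weight_bounds orthantD[OF assms])

text \<open>The law of one coordinate weighted by the others: a finite measure on the half-line, to
  which the one-dimensional uniqueness applies.\<close>

definition marginal :: "'v set \<Rightarrow> ('v \<Rightarrow> nat) \<Rightarrow> ('v \<Rightarrow> real set) \<Rightarrow> 'v \<Rightarrow> real measure" where
  "marginal F k A i = distr (density \<Xi> (\<lambda>\<zeta>. \<Prod>j\<in>UNIV - {i}. coordinate_weight F k A j (\<zeta> j))) borel (\<lambda>\<zeta>. \<zeta> i)"

lemma marginal_nonneg_finite_borel:
  assumes A: "\<And>i. A i \<in> sets borel"
  shows "nonneg_finite_borel (marginal F k A i)"
proof -
  define w where "w \<zeta> = (\<Prod>j\<in>UNIV - {i}. coordinate_weight F k A j (\<zeta> j))" for \<zeta>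
  have w: "w \<in> borel_measurable \<Xi>"
    unfolding w_def by (rule weight_measurable[OF A])
  have wb: "0 \<le> w \<zeta>" "w \<zeta> \<le> (\<Prod>j\<in>UNIV - {i}. fact (k j))" if "\<zeta> \<in> orthant" for \<zeta>
    unfolding w_def using weight_bounds[OF that] by auto
  have "emeasure (marginal F k A i) (space (marginal F k A i)) = (\<integral>\<^sup>+\<zeta>. ennreal (w \<zeta>) \<partial>\<Xi>)"
  proof -
    have "emeasure (marginal F k A i) (space (marginal F k A i)) = emeasure (density \<Xi> w) (space \<Xi>)"
      unfolding marginal_def w_def[symmetric] using coordinate_measurable[of i] by (subst emeasure_distr) auto
    also have "\<dots> = (\<integral>\<^sup>+\<zeta>. ennreal (w \<zeta>) * indicator (space \<Xi>) \<zeta> \<partial>\<Xi>)"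
      using w by (intro emeasure_density) auto
    also have "\<dots> = (\<integral>\<^sup>+\<zeta>. ennreal (w \<zeta>) \<partial>\<Xi>)"
      by (intro nn_integral_cong) simp
    finally show ?thesis .
  qed
  also have "\<dots> \<le> (\<integral>\<^sup>+\<zeta>. ennreal (\<Prod>j\<in>UNIV - {i}. fact (k j)) \<partial>\<Xi>)"
    using wb by (intro nn_integral_mono ennreal_leI) (simp add: space_orthant)
  also have "\<dots> < \<infinity>"
    by (simp add: emeasure_space_1)
  finally have fin: "finite_measure (marginal F k A i)"
    by (intro finite_measureI) simp
  have "AE x in marginal F k A i. 0 \<le> x"
    unfolding marginal_def using coordinate_measurable[of i] w
    by (subst AE_distr_iff) (auto simp: AE_density w_def[symmetric] space_orthant orthantD intro!: AE_I2)
  moreover have "sets (marginal F k A i) = sets borel"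
    by (simp add: marginal_def)
  ultimately show ?thesis
    using fin by (simp add: nonneg_finite_borel_def nonneg_finite_borel_axioms_def)
qed

lemma integral_marginal:
  assumes A: "\<And>i. A i \<in> sets borel" and f: "f \<in> borel_measurable borel"
  shows "(\<integral>x. f x \<partial>marginal F k A i) = (\<integral>\<zeta>. (\<Prod>j\<in>UNIV - {i}. coordinate_weight F k A j (\<zeta> j)) * f (\<zeta> i) \<partial>\<Xi>)"
proof -
  note coordinate_measurable[measurable] f[measurable] weight_measurable[OF A, measurable]
  have "(\<integral>x. f x \<partial>marginal F k A i) = (\<integral>\<zeta>. f (\<zeta> i) \<partial>density \<Xi> (\<lambda>\<zeta>. \<Prod>j\<in>UNIV - {i}. coordinate_weight F k A j (\<zeta> j)))"
    unfolding marginal_def by (subst integral_distr) auto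
  also have "\<dots> = (\<integral>\<zeta>. (\<Prod>j\<in>UNIV - {i}. coordinate_weight F k A j (\<zeta> j)) *\<^sub>R f (\<zeta> i) \<partial>\<Xi>)"
    using weight_bounds by (intro integral_density) (auto intro!: AE_I2 simp: space_orthant)
  finally show ?thesis
    by simp
qed

lemma integral_weight_moment:
  assumes A: "\<And>i. A i \<in> sets borel" and i: "i \<notin> F"
  shows "(\<integral>x. x ^ n * exp (- x) \<partial>marginal F k A i) = (\<integral>\<zeta>. (\<Prod>j\<in>UNIV. coordinate_weight F (k(i := n)) A j (\<zeta> j)) \<partial>\<Xi>)"
proof -
  have "(\<Prod>j\<in>UNIV - {i}. coordinate_weight F k A j (\<zeta> j)) * (\<zeta> i ^ n * exp (- \<zeta> i))
      = (\<Prod>j\<in>UNIV. coordinate_weight F (k(i := n)) A j (\<zeta> j))" for \<zeta>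
  proof -
    have "(\<Prod>j\<in>UNIV - {i}. coordinate_weight F k A j (\<zeta> j)) = (\<Prod>j\<in>UNIV - {i}. coordinate_weight F (k(i := n)) A j (\<zeta> j))"
      by (intro prod.cong) (auto simp: coordinate_weight_def)
    then show ?thesis
      using i by (subst (2) prod.remove[of _ i]) (simp_all add: coordinate_weight_def[of F _ _ i])
  qed
  then show ?thesis
    by (subst integral_marginal[OF A]) simp_all
qed

lemma integral_weight_indicator:
  assumes A: "\<And>i. A i \<in> sets borel" and i: "i \<notin> F"
  shows "(\<integral>x. indicator (A i) x \<partial>marginal F k A i) = (\<integral>\<zeta>. (\<Prod>j\<in>UNIV. coordinate_weight (insert i F) k A j (\<zeta> j)) \<partial>\<Xi>)"
proof -
  have "(\<Prod>j\<in>UNIV - {i}. coordinate_weight F k A j (\<zeta> j)) * indicator (A i) (\<zeta> i)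
      = (\<Prod>j\<in>UNIV. coordinate_weight (insert i F) k A j (\<zeta> j))" for \<zeta>
  proof -
    have "(\<Prod>j\<in>UNIV - {i}. coordinate_weight F k A j (\<zeta> j)) = (\<Prod>j\<in>UNIV - {i}. coordinate_weight (insert i F) k A j (\<zeta> j))"
      by (intro prod.cong) (auto simp: coordinate_weight_def)
    then show ?thesis
      using i by (subst (2) prod.remove[of _ i]) (simp_all add: coordinate_weight_def[of "insert i F" _ _ i])
  qed
  then show ?thesis
    using A by (subst integral_marginal[OF A]) simp_all
qed

lemma poisson_density_weight:
  "(\<Prod>j\<in>UNIV. coordinate_weight {} k A j (\<zeta> j)) = (\<Prod>j\<in>UNIV. fact (k j)) * poisson_density \<zeta> k"
  by (simp add: coordinate_weight_def poisson_density_def pow_fact_def prod.distrib prod_dividef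
      exp_sum flip: sum_negf)

lemma measure_box:
  assumes "\<And>i. A i \<in> sets borel"
  shows "(\<integral>\<zeta>. (\<Prod>j\<in>UNIV. coordinate_weight UNIV k A j (\<zeta> j)) \<partial>\<Xi>) = measure (distr \<Xi> (PiM UNIV (\<lambda>_. borel)) (\<lambda>\<zeta>. \<zeta>)) (PiE UNIV A)"
proof -
  have m: "(\<lambda>\<zeta>. \<zeta>) \<in> measurable \<Xi> (PiM UNIV (\<lambda>_. borel))"
    by (rule measurable_PiM_single') (auto intro: coordinate_measurable)
  have b: "PiE UNIV A \<in> sets (PiM UNIV (\<lambda>_. borel))"
    using assms by (intro sets_PiM_I_finite) auto
  have "(\<Prod>j\<in>UNIV. coordinate_weight UNIV k A j (\<zeta> j)) = indicator (PiE UNIV A) \<zeta>" for \<zeta>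
    by (auto simp: coordinate_weight_def indicator_def PiE_def Pi_def extensional_def intro!: prod_zero)
  then have "(\<integral>\<zeta>. (\<Prod>j\<in>UNIV. coordinate_weight UNIV k A j (\<zeta> j)) \<partial>\<Xi>) = (\<integral>\<zeta>. indicator (PiE UNIV A) \<zeta> \<partial>distr \<Xi> (PiM UNIV (\<lambda>_. borel)) (\<lambda>\<zeta>. \<zeta>))"
    using b by (subst integral_distr[OF m]) auto
  also have "\<dots> = measure (distr \<Xi> (PiM UNIV (\<lambda>_. borel)) (\<lambda>\<zeta>. \<zeta>)) (PiE UNIV A)"
    using b by simp
  finally show ?thesis .
qed

text \<open>The measures are compared on the product sigma-algebra, which boxes generate. It agrees
  with the Borel sets of the function space, and the orthant is closed, so nothing is lost.\<close>

lemma emeasure_eq_distr: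
  assumes "X \<in> sets bep_space"
  shows "emeasure \<Xi> X = emeasure (distr \<Xi> (PiM UNIV (\<lambda>_. borel)) (\<lambda>\<zeta>. \<zeta>)) X"
proof -
  have m: "(\<lambda>\<zeta>. \<zeta>) \<in> measurable \<Xi> (PiM UNIV (\<lambda>_. borel))"
    by (rule measurable_PiM_single') (auto intro: coordinate_measurable)
  have "closed (orthant :: ('v \<Rightarrow> real) set)"
    unfolding orthant_def Collect_all_eq
    by (intro closed_INT ballI closed_Collect_le continuous_on_const continuous_on_product_coordinates)
  then have "X \<in> sets borel"
    using assms unfolding bep_space_def by (subst (asm) sets_restrict_space_iff) auto
  then have "X \<in> sets (PiM UNIV (\<lambda>_. borel))"
    by (simp add: sets_PiM_equal_borel)
  moreover have "X \<subseteq> space \<Xi>"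
    using sets.sets_into_space[OF assms] by (simp add: space_orthant space_bep_space)
  ultimately show ?thesis
    by (subst emeasure_distr[OF m]) (auto simp: Int_absorb2)
qed

end

text \<open>Induction over the coordinates already converted. For fixed weights on the others,
  varying the exponent at \<open>i\<close> gives all exponentially weighted moments of a marginal;
  these determine it, so the weight at \<open>i\<close> may be replaced by an indicator.\<close>

lemma poisson_mixture_inj:
  assumes "\<Xi> \<in> space (prob_algebra bep_space)" "\<Theta> \<in> space (prob_algebra bep_space)"
    and eq: "poisson_mixture \<Xi> = poisson_mixture \<Theta>"
  shows "\<Xi> = \<Theta>"
proof -
  interpret X: orthant_prob \<Xi>
    using assms(1) by (simp add: orthant_prob_def orthant_prob_axioms_def space_prob_algebra)
  interpret T: orthant_prob \<Theta>
    using assms(2) by (simp add: orthant_prob_def orthant_prob_axioms_def space_prob_algebra)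
  have weights: "(\<integral>\<zeta>. (\<Prod>j\<in>UNIV. coordinate_weight F k A j (\<zeta> j)) \<partial>\<Xi>) = (\<integral>\<zeta>. (\<Prod>j\<in>UNIV. coordinate_weight F k A j (\<zeta> j)) \<partial>\<Theta>)"
    if A: "\<And>i. A i \<in> sets borel" for F k and A :: "'a \<Rightarrow> real set"
    using finite[of F]
  proof (induction F arbitrary: k rule: finite_induct)
    case empty
    show ?case
      using measure_mixture[OF assms(1), of k] measure_mixture[OF assms(2), of k] eq
      by (simp add: X.poisson_density_weight)
  next
    case (insert i F)
    have "X.marginal F k A i = T.marginal F k A i"
    proof (rule laplace_measure_eq)
      show "(\<integral>x. x ^ n * exp (- x) \<partial>X.marginal F k A i) = (\<integral>x. x ^ n * exp (- x) \<partial>T.marginal F k A i)" for n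
        using insert by (simp add: X.integral_weight_moment[OF A] T.integral_weight_moment[OF A])
    qed (intro X.marginal_nonneg_finite_borel T.marginal_nonneg_finite_borel A)+
    then show ?case
      using X.integral_weight_indicator[where A = A, OF A insert.hyps(2), of k] T.integral_weight_indicator[where A = A, OF A insert.hyps(2), of k]
      by simp
  qed
  let ?D = "\<lambda>M. distr M (PiM UNIV (\<lambda>_. borel)) (\<lambda>\<zeta>. \<zeta>)"
  have m: "(\<lambda>\<zeta>. \<zeta>) \<in> measurable \<Xi> (PiM UNIV (\<lambda>_. borel))" "(\<lambda>\<zeta>. \<zeta>) \<in> measurable \<Theta> (PiM UNIV (\<lambda>_. borel))"
    by (rule measurable_PiM_single'; auto intro: X.coordinate_measurable T.coordinate_measurable)+
  interpret DX: prob_space "?D \<Xi>" by (rule X.prob_space_distr[OF m(1)])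
  interpret DT: prob_space "?D \<Theta>" by (rule T.prob_space_distr[OF m(2)])
  have D: "?D \<Xi> = ?D \<Theta>"
  proof (rule measure_eqI_PiM_finite[where A = "\<lambda>_. UNIV"])
    fix A :: "'a \<Rightarrow> real set" assume "\<And>i. i \<in> UNIV \<Longrightarrow> A i \<in> sets borel"
    then have A: "A i \<in> sets borel" for i by simp
    show "emeasure (?D \<Xi>) (PiE UNIV A) = emeasure (?D \<Theta>) (PiE UNIV A)"
    proof -
      let ?w = "\<lambda>\<zeta>. \<Prod>j\<in>UNIV. coordinate_weight UNIV (\<lambda>_. 0) A j (\<zeta> j)"
      have "integral\<^sup>L \<Xi> ?w = integral\<^sup>L \<Theta> ?w"
        by (rule weights[OF A])
      moreover have "integral\<^sup>L \<Xi> ?w = measure (?D \<Xi>) (PiE UNIV A)"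
        by (rule X.measure_box[OF A])
      moreover have "integral\<^sup>L \<Theta> ?w = measure (?D \<Theta>) (PiE UNIV A)"
        by (rule T.measure_box[OF A])
      ultimately show ?thesis
        by (simp add: DX.emeasure_eq_measure DT.emeasure_eq_measure)
    qed
  next
    have "PiE UNIV (\<lambda>_. UNIV) \<in> prod_algebra UNIV (\<lambda>_ :: 'a. borel :: real measure)"
      by (rule prod_algebraI_finite) auto
    then show "range (\<lambda>_. UNIV) \<subseteq> prod_algebra UNIV (\<lambda>_ :: 'a. borel :: real measure)"
      by (auto simp: PiE_UNIV_domain)
  qed (auto simp: space_PiM PiE_UNIV_domain)
  show ?thesis
  proof (rule measure_eqI)
    show "sets \<Xi> = sets \<Theta>"
      by (simp only: X.sets_bep T.sets_bep)
    fix X assume "X \<in> sets \<Xi>"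
    then have "X \<in> sets bep_space"
      by (simp only: X.sets_bep)
    then show "emeasure \<Xi> X = emeasure \<Theta> X"
      by (simp only: X.emeasure_eq_distr T.emeasure_eq_distr D)
  qed
qed

section \<open>Compactness of Poisson mixtures\<close>

definition binary_digit :: "real \<Rightarrow> nat \<Rightarrow> nat" where
  "binary_digit x k = nat (\<lfloor>2 ^ Suc k * x\<rfloor> mod 2)"

lemma binary_digit_cases: "binary_digit x k = 0 \<or> binary_digit x k = 1"
  by (auto simp: binary_digit_def)

lemma binary_digit_le_1: "binary_digit x k \<le> 1"
  using binary_digit_cases[of x k] by auto

lemma binary_partial_sum:
  assumes "0 \<le> x" "x < 1"
  shows "(\<Sum>k<n. real (binary_digit x k) / 2 ^ Suc k) = real_of_int \<lfloor>2 ^ n * x\<rfloor> / 2 ^ n"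
proof (induction n)
  case 0
  then show ?case
    using assms by (simp add: floor_eq_iff)
next
  case (Suc n)
  have "\<lfloor>2 ^ Suc n * x\<rfloor> div 2 = \<lfloor>2 ^ n * x\<rfloor>"
    using floor_divide_real_eq_div[of 2 "2 ^ Suc n * x"] by simp
  then have "\<lfloor>2 ^ Suc n * x\<rfloor> = 2 * \<lfloor>2 ^ n * x\<rfloor> + int (binary_digit x n)"
    unfolding binary_digit_def using div_mult_mod_eq[of "\<lfloor>2 ^ Suc n * x\<rfloor>" 2] by simp
  then have "real_of_int \<lfloor>2 ^ Suc n * x\<rfloor> = 2 * real_of_int \<lfloor>2 ^ n * x\<rfloor> + real (binary_digit x n)"
    by simp
  then show ?case
    unfolding sum.lessThan_Suc Suc.IH by (simp add: add_divide_distrib)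
qed

lemma binary_expansion:
  assumes "0 \<le> x" "x < 1"
  shows "(\<lambda>k. real (binary_digit x k) / 2 ^ Suc k) sums x"
  unfolding sums_def binary_partial_sum[OF assms]
proof (rule tendsto_sandwich[where h = "\<lambda>_. x" and f = "\<lambda>n. x - (1 / 2) ^ n"])
  show "\<forall>\<^sub>F n in sequentially. x - (1 / 2) ^ n \<le> real_of_int \<lfloor>2 ^ n * x\<rfloor> / 2 ^ n"
  proof (intro always_eventually allI)
    fix n
    have "(2 ^ n * x - 1) / 2 ^ n \<le> real_of_int \<lfloor>2 ^ n * x\<rfloor> / 2 ^ n"
      by (intro divide_right_mono) (linarith, simp)
    then show "x - (1 / 2) ^ n \<le> real_of_int \<lfloor>2 ^ n * x\<rfloor> / 2 ^ n"
      by (simp add: diff_divide_distrib power_divide)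
  qed
  show "\<forall>\<^sub>F n in sequentially. real_of_int \<lfloor>2 ^ n * x\<rfloor> / 2 ^ n \<le> x"
    by (intro always_eventually allI) (simp add: divide_le_eq mult.commute)
  show "(\<lambda>n. x - (1 / 2) ^ n) \<longlonglongrightarrow> x"
    by (auto intro!: tendsto_eq_intros LIMSEQ_realpow_zero)
qed auto

section \<open>A space-filling curve and weak limits on the cube\<close>

text \<open>Schoenberg's trick: a continuous function of period 2 which is 0 on \<open>[0, 1/3]\<close> and 1 on \<open>[2/3, 1]\<close>
  reads the digit \<open>A m\<close> off from \<open>3\<^sup>m t\<close>, where \<open>t = \<Sum>\<^sub>m 2 A m / 3\<^sup>m\<^sup>+\<^sup>1\<close>.\<close>

definition digit_reader :: "real \<Rightarrow> real" where
  "digit_reader t = max 0 (min 1 (1 / 2 - cos (pi * t)))"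

lemma digit_reader_bounds: "0 \<le> digit_reader t" "digit_reader t \<le> 1"
  by (auto simp: digit_reader_def)

lemma digit_reader_period: "digit_reader (2 * real n + t) = digit_reader t"
proof -
  have "pi * (2 * real n + t) = 2 * real n * pi + pi * t"
    by (simp add: algebra_simps)
  then show ?thesis
    unfolding digit_reader_def by (simp only: cos_add cos_2npi sin_2npi mult_zero_left diff_zero mult_1)
qed

text \<open>The clipping levels are matched to \<open>cos (pi / 3) = 1 / 2\<close> and
  \<open>cos (2 * pi / 3) = - 1 / 2\<close>, the ends of the two outer thirds.\<close>

lemma digit_reader_0: "0 \<le> t \<Longrightarrow> t \<le> 1 / 3 \<Longrightarrow> digit_reader t = 0"
  using cos_monotone_0_pi_le[of "pi * t" "pi / 3"] mult_left_mono[of t "1/3" pi]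
  by (auto simp: digit_reader_def cos_60 max_def min_def)

lemma digit_reader_1: "2 / 3 \<le> t \<Longrightarrow> t \<le> 1 \<Longrightarrow> digit_reader t = 1"
  using cos_monotone_0_pi_le[of "2 * pi / 3" "pi * t"] mult_left_mono[of "2/3" t pi] mult_left_mono[of t 1 pi]
  by (auto simp: digit_reader_def cos_120 max_def min_def)

definition ternary_code :: "(nat \<Rightarrow> nat) \<Rightarrow> real" where
  "ternary_code A = (\<Sum>m. 2 * real (A m) / 3 ^ Suc m)"

context
  fixes A :: "nat \<Rightarrow> nat"
  assumes A: "\<And>m. A m \<le> 1"
begin

lemma ternary_term_bounds: "0 \<le> 2 * real (A m) / 3 ^ Suc m" "2 * real (A m) / 3 ^ Suc m \<le> 2 / 3 * (1 / 3) ^ m"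
  using A[of m] by (auto simp: power_divide field_simps)

lemma ternary_bound_sums: "(\<lambda>m. 2 / 3 * (1 / 3 :: real) ^ m) sums 1"
  using sums_mult[OF geometric_sums[of "1/3 :: real"], of "2/3"] by simp

lemma ternary_summable: "summable (\<lambda>m. 2 * real (A m) / 3 ^ Suc m)"
  by (rule summable_comparison_test'[OF sums_summable[OF ternary_bound_sums], of 0])
     (use ternary_term_bounds in \<open>auto simp del: power_Suc\<close>)

lemma ternary_code_bounds: "0 \<le> ternary_code A" "ternary_code A \<le> 1"
proof -
  show "0 \<le> ternary_code A"
    unfolding ternary_code_def by (intro suminf_nonneg ternary_summable ternary_term_bounds)
  have "ternary_code A \<le> (\<Sum>m. 2 / 3 * (1 / 3) ^ m)"
    unfolding ternary_code_def
    by (intro suminf_le ternary_summable ternary_term_bounds sums_summable[OF ternary_bound_sums])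
  then show "ternary_code A \<le> 1"
    using sums_unique[OF ternary_bound_sums] by simp
qed

end

lemma ternary_code_Suc:
  assumes A: "\<And>m. A m \<le> 1"
  shows "3 * ternary_code A = 2 * real (A 0) + ternary_code (\<lambda>m. A (Suc m))"
proof -
  have s: "summable (\<lambda>m. 2 * real (A m) / 3 ^ Suc m)"
    by (rule ternary_summable[OF A])
  have "3 * ternary_code A = 3 * (2 * real (A 0) / 3 ^ Suc 0) + 3 * (\<Sum>m. 2 * real (A (Suc m)) / 3 ^ Suc (Suc m))"
    unfolding ternary_code_def using suminf_split_head[OF s] by simp
  also have "3 * (\<Sum>m. 2 * real (A (Suc m)) / 3 ^ Suc (Suc m)) = (\<Sum>m. 3 * (2 * real (A (Suc m)) / 3 ^ Suc (Suc m)))"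
    by (rule suminf_mult[symmetric]) (use s in \<open>subst (asm) summable_Suc_iff[symmetric]\<close>)
  finally show ?thesis
    by (simp add: ternary_code_def)
qed

text \<open>The ternary digits are 0 and 2, so each shift splits off an even integer, and three
  times an even integer is even; the period 2 of the reader removes it.\<close>

lemma ternary_code_shift:
  assumes A: "\<And>m. A m \<le> 1"
  shows "\<exists>n. 3 ^ m * ternary_code A = 2 * real n + ternary_code (\<lambda>k. A (m + k))"
proof (induction m)
  case (Suc m)
  then obtain n where "3 ^ m * ternary_code A = 2 * real n + ternary_code (\<lambda>k. A (m + k))"
    by blast
  then have "3 ^ Suc m * ternary_code A = 2 * real (3 * n) + 3 * ternary_code (\<lambda>k. A (m + k))"
    by simp
  also have "\<dots> = 2 * real (3 * n + A m) + ternary_code (\<lambda>k. A (Suc m + k))"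
    using ternary_code_Suc[of "\<lambda>k. A (m + k)"] A by simp
  finally show ?case
    by blast
qed (auto intro: exI[of _ 0])

lemma digit_reader_code:
  assumes A: "\<And>m. A m \<le> 1"
  shows "digit_reader (3 ^ m * ternary_code A) = real (A m)"
proof -
  obtain n where n: "3 ^ m * ternary_code A = 2 * real n + ternary_code (\<lambda>k. A (m + k))"
    using ternary_code_shift[of A, OF A] by blast
  have r: "3 * ternary_code (\<lambda>k. A (m + k)) = 2 * real (A m) + ternary_code (\<lambda>k. A (m + Suc k))"
    using ternary_code_Suc[of "\<lambda>k. A (m + k)"] A by simp
  have b: "0 \<le> ternary_code (\<lambda>k. A (m + Suc k))" "ternary_code (\<lambda>k. A (m + Suc k)) \<le> 1"
    using ternary_code_bounds[of "\<lambda>k. A (m + Suc k)"] A by auto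
  have "digit_reader (ternary_code (\<lambda>k. A (m + k))) = real (A m)"
  proof (cases "A m = 0")
    case True
    then show ?thesis
      using r b by (subst digit_reader_0) auto
  next
    case False
    then have "A m = 1"
      using A[of m] by simp
    then show ?thesis
      using r b by (subst digit_reader_1) auto
  qed
  then show ?thesis
    by (simp add: n digit_reader_period)
qed

text \<open>Binary digit \<open>k\<close> of coordinate \<open>i\<close> is stored at the position
  \<open>prod_encode (to_nat i, k)\<close> of a single digit sequence.\<close>

definition schoenberg :: "'v::countable \<Rightarrow> real \<Rightarrow> real" where
  "schoenberg i t = (\<Sum>k. digit_reader (3 ^ prod_encode (to_nat i, k) * t) / 2 ^ Suc k)"

lemma half_sums: "(\<lambda>k. 1 / 2 ^ Suc k :: real) sums 1"
  using power_half_series by (simp add: power_divide)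

lemma schoenberg_summable: "summable (\<lambda>k. digit_reader (3 ^ prod_encode (to_nat i, k) * t) / 2 ^ Suc k)"
  by (rule summable_comparison_test'[OF sums_summable[OF half_sums], of 0])
     (use digit_reader_bounds in \<open>auto simp: divide_right_mono\<close>)

lemma schoenberg_bounds: "0 \<le> schoenberg i t" "schoenberg i t \<le> 1"
proof -
  show "0 \<le> schoenberg i t"
    unfolding schoenberg_def
    by (intro suminf_nonneg schoenberg_summable divide_nonneg_nonneg digit_reader_bounds) auto
  have "schoenberg i t \<le> (\<Sum>k. 1 / 2 ^ Suc k)"
    unfolding schoenberg_def
    by (intro suminf_le schoenberg_summable sums_summable[OF half_sums] divide_right_mono digit_reader_bounds) auto
  then show "schoenberg i t \<le> 1"
    using sums_unique[OF half_sums] by simp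
qed

lemma schoenberg_continuous: "continuous_on UNIV (schoenberg i)"
proof -
  have "uniform_limit UNIV (\<lambda>n t. \<Sum>k<n. digit_reader (3 ^ prod_encode (to_nat i, k) * t) / 2 ^ Suc k) (schoenberg i) sequentially"
    unfolding schoenberg_def[abs_def]
    by (rule Weierstrass_m_test[where M = "\<lambda>k. 1 / 2 ^ Suc k"])
       (use digit_reader_bounds sums_summable[OF half_sums] in \<open>auto simp: divide_right_mono\<close>)
  then show ?thesis
    by (rule uniform_limit_theorem[rotated])
       (auto intro!: always_eventually continuous_intros simp: digit_reader_def)
qed

text \<open>A section of the curve over the half-open cube. It is measurable but need not be
  continuous; continuity is required only of the curve itself.\<close>

definition cube_code :: "('v::countable \<Rightarrow> real) \<Rightarrow> real" where
  "cube_code x = ternary_code (\<lambda>m. binary_digit (x (from_nat (fst (prod_decode m)))) (snd (prod_decode m)))"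

lemma schoenberg_cube_code:
  assumes "0 \<le> x i" "x i < 1"
  shows "schoenberg i (cube_code x) = x i"
proof -
  have "schoenberg i (cube_code x) = (\<Sum>k. real (binary_digit (x i) k) / 2 ^ Suc k)"
    unfolding schoenberg_def cube_code_def by (subst digit_reader_code[OF binary_digit_le_1]) simp
  then show ?thesis
    using sums_unique[OF binary_expansion[OF assms]] by simp
qed

lemma cube_code_bounds: "0 \<le> cube_code x" "cube_code x \<le> 1"
  unfolding cube_code_def by (rule ternary_code_bounds[OF binary_digit_le_1])+

lemma cube_code_measurable:
  assumes [measurable]: "\<And>i. X i \<in> borel_measurable M"
  shows "(\<lambda>\<omega>. cube_code (\<lambda>i. X i \<omega>)) \<in> borel_measurable M"
  unfolding cube_code_def ternary_code_def binary_digit_def by measurable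

text \<open>The codes lie in the unit interval, so their laws are tight at once, and a continuous
  \<open>F\<close> becomes a bounded continuous function of the curve parameter. The limit is
  expressed by a law of this parameter; it may charge points with a coordinate equal to 1 although
  every \<open>X i\<close> stays below 1.\<close>

lemma weakly_convergent_subsequence_cube:
  fixes M :: "nat \<Rightarrow> 'b measure" and X :: "'v::countable \<Rightarrow> 'b \<Rightarrow> real"
  assumes M: "\<And>n. prob_space (M n)"
    and X: "\<And>n i. X i \<in> borel_measurable (M n)" "\<And>n i \<omega>. \<omega> \<in> space (M n) \<Longrightarrow> 0 \<le> X i \<omega> \<and> X i \<omega> < 1"
  obtains r :: "nat \<Rightarrow> nat" and \<rho> where "strict_mono r" "real_distribution \<rho>"
    and "\<forall>F :: ('v \<Rightarrow> real) \<Rightarrow> real. continuous_on UNIV F \<longrightarrow> (\<exists>B. \<forall>x. (\<forall>i. 0 \<le> x i \<and> x i \<le> 1) \<longrightarrow> \<bar>F x\<bar> \<le> B) \<longrightarrow>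
      (\<lambda>n. \<integral>\<omega>. F (\<lambda>i. X i \<omega>) \<partial>M (r n)) \<longlonglongrightarrow> (\<integral>t. F (\<lambda>i. schoenberg i t) \<partial>\<rho>)"
proof -
  define e where "e \<omega> = cube_code (\<lambda>i. X i \<omega>)" for \<omega>
  define \<mu> where "\<mu> n = distr (M n) borel e" for n
  have e[measurable]: "e \<in> borel_measurable (M n)" for n
    unfolding e_def by (intro cube_code_measurable X)
  have rd: "real_distribution (\<mu> n)" for n
    unfolding \<mu>_def using M by (intro prob_space.real_distribution_distr) auto
  have "tight \<mu>"
    unfolding tight_def
  proof (intro conjI allI impI rd)
    fix \<epsilon> :: real assume "0 < \<epsilon>"
    have "measure (\<mu> n) {-1<..1} = 1" for n
    proof -
      interpret prob_space "M n" by (rule M)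
      have "e -` {-1<..1} \<inter> space (M n) = space (M n)"
        using cube_code_bounds by (auto simp: e_def intro!: less_le_trans[of "-1" 0 "cube_code _"])
      then show ?thesis
        by (simp add: \<mu>_def measure_distr prob_space)
    qed
    then show "\<exists>a b. a < b \<and> (\<forall>n. 1 - \<epsilon> < measure (\<mu> n) {a<..b})"
      using \<open>0 < \<epsilon>\<close> by (intro exI[of _ "-1"] exI[of _ 1]) auto
  qed
  from tight_imp_convergent_subsubsequence[OF this strict_mono_id]
  obtain r \<rho> where r: "strict_mono r" "real_distribution \<rho>" "weak_conv_m (\<mu> \<circ> r) \<rho>"
    by auto
  show thesis
  proof (rule that[OF r(1,2)], intro allI impI)
    fix F :: "('v \<Rightarrow> real) \<Rightarrow> real"
    assume F: "continuous_on UNIV F" and "\<exists>B. \<forall>x. (\<forall>i. 0 \<le> x i \<and> x i \<le> 1) \<longrightarrow> \<bar>F x\<bar> \<le> B"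
    then obtain B where B: "\<And>x. (\<forall>i. 0 \<le> x i \<and> x i \<le> 1) \<Longrightarrow> \<bar>F x\<bar> \<le> B"
      by blast
    define f where "f t = F (\<lambda>i. schoenberg i t)" for t
    have f_cont: "continuous_on UNIV f"
      unfolding f_def
      by (intro continuous_on_compose2[OF F] continuous_on_coordinatewise_then_product schoenberg_continuous) auto
    then have [measurable]: "f \<in> borel_measurable borel"
      by (rule borel_measurable_continuous_onI)
    have "(\<lambda>n. integral\<^sup>L ((\<mu> \<circ> r) n) f) \<longlonglongrightarrow> integral\<^sup>L \<rho> f"
    proof (rule weak_conv_imp_integral_bdd_continuous_conv)
      show "isCont f x" for x
        using f_cont by (simp add: continuous_on_eq_continuous_at)
      show "norm (f x) \<le> B" for x
        using B[of "\<lambda>i. schoenberg i x"] schoenberg_bounds by (auto simp: f_def)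
    qed (use r rd in \<open>auto simp: o_def\<close>)
    also have "(\<lambda>n. integral\<^sup>L ((\<mu> \<circ> r) n) f) = (\<lambda>n. \<integral>\<omega>. F (\<lambda>i. X i \<omega>) \<partial>M (r n))"
    proof
      fix n
      have "integral\<^sup>L ((\<mu> \<circ> r) n) f = (\<integral>\<omega>. f (e \<omega>) \<partial>M (r n))"
        by (simp add: \<mu>_def integral_distr)
      also have "\<dots> = (\<integral>\<omega>. F (\<lambda>i. X i \<omega>) \<partial>M (r n))"
        by (intro Bochner_Integration.integral_cong refl) (use X in \<open>simp add: f_def e_def schoenberg_cube_code\<close>)
      finally show "integral\<^sup>L ((\<mu> \<circ> r) n) f = (\<integral>\<omega>. F (\<lambda>i. X i \<omega>) \<partial>M (r n))" .
    qed
    finally show "(\<lambda>n. \<integral>\<omega>. F (\<lambda>i. X i \<omega>) \<partial>M (r n)) \<longlonglongrightarrow> (\<integral>t. F (\<lambda>i. schoenberg i t) \<partial>\<rho>)"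
      by (simp add: f_def[abs_def])
  qed
qed

text \<open>The Poisson weight of rate \<open>x / (1 - x)\<close>, extended continuously by \<open>0\<close> to the rate \<open>\<infinity>\<close>.\<close>

definition compact_poisson :: "nat \<Rightarrow> real \<Rightarrow> real" where
  "compact_poisson k x = (if x < 1 then (x / (1 - x)) ^ k / fact k * exp (- (x / (1 - x))) else 0)"

lemma poisson_weight_bound: "0 \<le> y \<Longrightarrow> y ^ k / fact k * exp (- y) \<le> 1" for y :: real
  using exp_ge_power_fact[of y k] by (simp add: exp_minus field_simps)

lemma compact_poisson_bounds:
  assumes "0 \<le> x"
  shows "0 \<le> compact_poisson k x" "compact_poisson k x \<le> 1"
  using assms poisson_weight_bound[of "x / (1 - x)" k] by (auto simp: compact_poisson_def)

text \<open>With \<open>y = x / (1 - x)\<close>, the weight at \<open>k\<close> is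
  \<open>(k + 1) / y\<close> times the weight at \<open>k + 1\<close>, which is at most 1; and
  \<open>1 / y \<le> 2 * (1 - x)\<close> for \<open>x > 1 / 2\<close>.\<close>

lemma compact_poisson_near_1:
  assumes "1 / 2 < x"
  shows "\<bar>compact_poisson k x\<bar> \<le> real (k + 1) * (2 * \<bar>1 - x\<bar>)"
proof (cases "x < 1")
  case True
  define y where "y = x / (1 - x)"
  have "(1 - x) / x \<le> (1 - x) / (1 / 2)"
    using assms True by (intro divide_left_mono) auto
  then have y: "0 < y" "1 / y \<le> 2 * (1 - x)"
    using assms True by (auto simp: y_def)
  have "y ^ k / fact k * exp (- y) = real (k + 1) / y * (y ^ (k + 1) / fact (k + 1) * exp (- y))"
  proof -
    have "a / f * e = r / y * (y * a / (r * f) * e)" if "r \<noteq> 0" for a e f r :: real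
      using that y(1) by (simp add: field_simps)
    from this[of "real (Suc k)" "y ^ k" "fact k" "exp (- y)"] show ?thesis
      by (simp only: Suc_eq_plus1[symmetric] power_Suc fact_Suc)
  qed
  also have "\<dots> \<le> real (k + 1) / y * 1"
    using y poisson_weight_bound[of y "k + 1"] by (intro mult_left_mono) auto
  also have "\<dots> \<le> real (k + 1) * (2 * (1 - x))"
    using mult_left_mono[OF y(2), of "real (k + 1)"] by simp
  finally show ?thesis
    using True y by (simp add: compact_poisson_def y_def)
qed (simp add: compact_poisson_def)

lemma compact_poisson_continuous: "continuous_on UNIV (compact_poisson k)"
proof -
  have "isCont (compact_poisson k) x" for x
  proof -
    consider "x < 1" | "x = 1" | "1 < x" by linarith
    then show ?thesis
    proof cases
      case 1
      have "isCont (\<lambda>x. (x / (1 - x)) ^ k / fact k * exp (- (x / (1 - x)))) x"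
        using 1 by (intro continuous_intros) auto
      moreover have "\<forall>\<^sub>F y in nhds x. compact_poisson k y = (y / (1 - y)) ^ k / fact k * exp (- (y / (1 - y)))"
        unfolding eventually_nhds using 1 by (intro exI[of _ "{..<1}"]) (auto simp: compact_poisson_def)
      ultimately show ?thesis
        by (subst isCont_cong)
    next
      case 2
      have "(compact_poisson k \<longlongrightarrow> 0) (at 1)"
      proof (rule Lim_null_comparison)
        have "\<forall>\<^sub>F x in at (1 :: real). 1 / 2 < x"
          by (rule order_tendstoD(1)[OF tendsto_ident_at]) simp
        then show "\<forall>\<^sub>F x in at 1. norm (compact_poisson k x) \<le> real (k + 1) * (2 * \<bar>1 - x\<bar>)"
          by eventually_elim (use compact_poisson_near_1 in simp)
        show "((\<lambda>x. real (k + 1) * (2 * \<bar>1 - x\<bar>)) \<longlongrightarrow> 0) (at (1 :: real))"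
          by (auto intro!: tendsto_eq_intros)
      qed
      then show ?thesis
        using 2 by (simp add: isCont_def compact_poisson_def)
    next
      case 3
      have "\<forall>\<^sub>F y in nhds x. compact_poisson k y = 0"
        unfolding eventually_nhds using 3 by (intro exI[of _ "{1<..}"]) (auto simp: compact_poisson_def)
      then show ?thesis
        by (subst isCont_cong) auto
    qed
  qed
  then show ?thesis
    by (simp add: continuous_at_imp_continuous_on)
qed

lemma compact_poisson_prod_lt_1:
  fixes x :: "'v::finite \<Rightarrow> real"
  assumes "\<And>i. x i < (1 :: real)"
  shows "(\<Prod>i\<in>UNIV. compact_poisson (\<eta> i) (x i)) = poisson_density (\<lambda>i. x i / (1 - x i)) \<eta>"
  unfolding poisson_density_def pow_fact_def sum_negf[symmetric] exp_sum[OF finite] prod.distrib[symmetric]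
  using assms by (intro prod.cong) (auto simp: compact_poisson_def)

lemma compact_poisson_prod_eq_0:
  "\<not> x i < (1 :: real) \<Longrightarrow> (\<Prod>i\<in>UNIV. compact_poisson (\<eta> i) (x i)) = 0" for x :: "'v::finite \<Rightarrow> real"
  by (rule prod_zero) (auto simp: compact_poisson_def)

lemma poisson_density_sum_le_1:
  assumes "\<zeta> \<in> orthant" "finite F"
  shows "(\<Sum>\<eta>\<in>F. poisson_density \<zeta> \<eta>) \<le> 1"
proof -
  interpret prob_space "poisson_product \<zeta>"
    by (rule prob_space_poisson_product)
  have "(\<Sum>\<eta>\<in>F. poisson_density \<zeta> \<eta>) = measure (poisson_product \<zeta>) F"
    using assms by (subst finite_measure_eq_sum_singleton) (auto simp: measure_poisson_product sets_poisson_product)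
  then show ?thesis
    by simp
qed

text \<open>Tightness of the Poisson mixtures prevents mass of the mixing measures from escaping to the rate \<open>\<infinity>\<close>.\<close>

lemma poisson_mixture_limit:
  fixes X :: "nat \<Rightarrow> ('v::finite \<Rightarrow> real) measure" and F :: "nat \<Rightarrow> ('v \<Rightarrow> nat) set"
  assumes X: "\<And>n. X n \<in> space (prob_algebra bep_space)"
    and F: "\<And>N. finite (F N)" and \<delta>: "\<delta> \<longlonglongrightarrow> 0"
    and tight: "\<And>n N. 1 - \<delta> N \<le> measure (poisson_mixture (X n)) (F N)"
  obtains r :: "nat \<Rightarrow> nat" and \<Xi> where "strict_mono r" "\<Xi> \<in> space (prob_algebra bep_space)"
    "\<And>\<eta>. (\<lambda>n. measure (poisson_mixture (X (r n))) {\<eta>}) \<longlonglongrightarrow> measure (poisson_mixture \<Xi>) {\<eta>}"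
proof -
  interpret X: orthant_prob "X n" for n
    using X[of n] by (simp add: orthant_prob_def orthant_prob_axioms_def space_prob_algebra)
  \<comment> \<open>The inverse of \<open>x / (1 - x)\<close>, identifying the half-line of rates
    with the half-open unit interval.\<close>
  define Y where "Y i \<zeta> = \<zeta> i / (1 + \<zeta> i)" for i and \<zeta> :: "'v \<Rightarrow> real"
  define \<Phi> where "\<Phi> \<eta> x = (\<Prod>i\<in>UNIV. compact_poisson (\<eta> i) (x i))" for \<eta> and x :: "'v \<Rightarrow> real"
  have Y: "Y i \<in> borel_measurable (X n)" for i n
    unfolding Y_def using X.coordinate_measurable by measurable
  have Y_bounds: "0 \<le> Y i \<zeta> \<and> Y i \<zeta> < 1" if "\<zeta> \<in> space (X n)" for n i \<zeta>
    using orthantD[of \<zeta> i] that by (simp add: Y_def X.space_orthant divide_less_eq)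
  obtain r \<rho> where r: "strict_mono r" "real_distribution \<rho>"
    and lim: "\<forall>F :: ('v \<Rightarrow> real) \<Rightarrow> real. continuous_on UNIV F \<longrightarrow> (\<exists>B. \<forall>x. (\<forall>i. 0 \<le> x i \<and> x i \<le> 1) \<longrightarrow> \<bar>F x\<bar> \<le> B) \<longrightarrow>
      (\<lambda>n. \<integral>\<zeta>. F (\<lambda>i. Y i \<zeta>) \<partial>X (r n)) \<longlonglongrightarrow> (\<integral>t. F (\<lambda>i. schoenberg i t) \<partial>\<rho>)"
    by (rule weakly_convergent_subsequence_cube[where M = X and X = Y, OF X.prob_space_axioms Y Y_bounds that])
  interpret \<rho>: real_distribution \<rho> by (rule r(2))
  have \<Phi>_cont: "continuous_on UNIV (\<Phi> \<eta>)" for \<eta>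
    unfolding \<Phi>_def
    by (intro continuous_on_prod continuous_on_compose2[OF compact_poisson_continuous] continuous_on_product_coordinates) auto
  have \<Phi>_bound: "0 \<le> \<Phi> \<eta> x \<and> \<Phi> \<eta> x \<le> 1" if "\<forall>i. 0 \<le> x i \<and> x i \<le> 1" for \<eta> x
    unfolding \<Phi>_def using that by (auto intro!: prod_nonneg prod_le_1 compact_poisson_bounds)
  have \<Phi>_Y: "\<Phi> \<eta> (\<lambda>i. Y i \<zeta>) = poisson_density \<zeta> \<eta>" if "\<zeta> \<in> orthant" for \<zeta> \<eta>
  proof -
    have "Y i \<zeta> < 1" "Y i \<zeta> / (1 - Y i \<zeta>) = \<zeta> i" for i
      using orthantD[OF that, of i] by (auto simp: Y_def field_simps)
    then show ?thesis
      unfolding \<Phi>_def by (subst compact_poisson_prod_lt_1) auto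
  qed
  define m where "m \<eta> = (\<integral>t. \<Phi> \<eta> (\<lambda>i. schoenberg i t) \<partial>\<rho>)" for \<eta>
  have m_lim: "(\<lambda>n. measure (poisson_mixture (X (r n))) {\<eta>}) \<longlonglongrightarrow> m \<eta>" for \<eta>
  proof -
    have "(\<lambda>n. \<integral>\<zeta>. \<Phi> \<eta> (\<lambda>i. Y i \<zeta>) \<partial>X (r n)) \<longlonglongrightarrow> m \<eta>"
      unfolding m_def using \<Phi>_bound by (intro lim[rule_format] \<Phi>_cont exI[of _ 1]) (auto simp: abs_of_nonneg)
    also have "(\<lambda>n. \<integral>\<zeta>. \<Phi> \<eta> (\<lambda>i. Y i \<zeta>) \<partial>X (r n)) = (\<lambda>n. measure (poisson_mixture (X (r n))) {\<eta>})"
      unfolding measure_mixture[OF X]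
      by (intro ext Bochner_Integration.integral_cong refl \<Phi>_Y) (simp add: X.space_orthant)
    finally show ?thesis .
  qed
  have sch_meas[measurable]: "schoenberg i \<in> borel_measurable borel" for i :: 'v
    by (rule borel_measurable_continuous_onI[OF schoenberg_continuous])
  define G where "G = {t. \<forall>i :: 'v. schoenberg i t < 1}"
  have G[measurable]: "G \<in> sets borel"
    unfolding G_def by measurable
  \<comment> \<open>Off \<open>G\<close> a denominator vanishes and division by zero yields the rate
    0. Thus \<open>Z\<close> maps into the orthant everywhere, and the arbitrary value will not
    matter because \<open>G\<close> turns out to have full measure.\<close>
  define Z where "Z t = (\<lambda>i :: 'v. schoenberg i t / (1 - schoenberg i t))" for t
  have Z_orthant: "Z t \<in> orthant" for t
    by (auto simp: Z_def orthant_def intro!: divide_nonneg_nonneg schoenberg_bounds)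
  have \<Phi>_G: "\<Phi> \<eta> (\<lambda>i. schoenberg i t) = indicator G t * poisson_density (Z t) \<eta>" for \<eta> t
  proof (cases "t \<in> G")
    case True
    then show ?thesis
      unfolding \<Phi>_def by (subst compact_poisson_prod_lt_1) (auto simp: G_def Z_def)
  next
    case False
    then obtain i :: 'v where "\<not> schoenberg i t < 1"
      by (auto simp: G_def)
    from compact_poisson_prod_eq_0[of "\<lambda>i. schoenberg i t", OF this] show ?thesis
      using False by (simp add: \<Phi>_def)
  qed
  have \<Phi>_meas[measurable]: "(\<lambda>t. \<Phi> \<eta> (\<lambda>i. schoenberg i t)) \<in> borel_measurable \<rho>" for \<eta>
  proof -
    have [measurable]: "compact_poisson k \<in> borel_measurable borel" for k
      by (rule borel_measurable_continuous_onI[OF compact_poisson_continuous])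
    show ?thesis
      unfolding \<Phi>_def by measurable
  qed
  have \<Phi>_int: "integrable \<rho> (\<lambda>t. \<Phi> \<eta> (\<lambda>i. schoenberg i t))" for \<eta>
    using \<Phi>_bound by (intro \<rho>.integrable_const_bound[where B = 1]) (auto simp: schoenberg_bounds abs_of_nonneg)
  \<comment> \<open>The limiting weights sum over \<open>F N\<close> to at most the indicator of
    \<open>G\<close>, since they are Poisson weights on \<open>G\<close> and 0 elsewhere; the sum
    retains mass \<open>1 - \<delta> N\<close> by tightness.\<close>
  have "1 - \<delta> N \<le> measure \<rho> G" for N
  proof -
    have "1 - \<delta> N \<le> (\<Sum>\<eta>\<in>F N. measure (poisson_mixture (X (r n))) {\<eta>})" for n
      using tight[of N "r n"] F[of N] sets_mixture[OF X]
        finite_measure.finite_measure_eq_sum_singleton[OF prob_space.finite_measure[OF prob_space_mixture[OF X]], of "F N" "r n"]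
      by auto
    moreover have "(\<lambda>n. \<Sum>\<eta>\<in>F N. measure (poisson_mixture (X (r n))) {\<eta>}) \<longlonglongrightarrow> (\<Sum>\<eta>\<in>F N. m \<eta>)"
      by (intro tendsto_sum m_lim)
    ultimately have "1 - \<delta> N \<le> (\<Sum>\<eta>\<in>F N. m \<eta>)"
      by (intro LIMSEQ_le_const) auto
    also have "\<dots> = (\<integral>t. (\<Sum>\<eta>\<in>F N. \<Phi> \<eta> (\<lambda>i. schoenberg i t)) \<partial>\<rho>)"
      unfolding m_def by (rule Bochner_Integration.integral_sum[symmetric]) (rule \<Phi>_int)
    also have "\<dots> \<le> (\<integral>t. indicator G t \<partial>\<rho>)"
    proof (rule integral_mono)
      show "(\<Sum>\<eta>\<in>F N. \<Phi> \<eta> (\<lambda>i. schoenberg i t)) \<le> indicator G t" for t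
        unfolding \<Phi>_G sum_distrib_left[symmetric]
        using poisson_density_sum_le_1[OF Z_orthant F] by (simp add: mult_left_le)
    qed (auto intro: \<Phi>_int Bochner_Integration.integrable_sum simp: \<rho>.emeasure_eq_measure)
    also have "\<dots> = measure \<rho> G"
      using G by simp
    finally show ?thesis .
  qed
  moreover have "(\<lambda>N. 1 - \<delta> N) \<longlonglongrightarrow> 1 - 0"
    by (intro tendsto_intros \<delta>)
  ultimately have "1 - 0 \<le> measure \<rho> G"
    by (intro LIMSEQ_le_const2) auto
  then have G1: "measure \<rho> G = 1"
    using \<rho>.prob_le_1[of G] by simp
  have AE_G: "AE t in \<rho>. t \<in> G"
    using G1 G by (intro \<rho>.AE_prob_1)
  define \<Xi> where "\<Xi> = distr \<rho> bep_space Z"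
  have Z_meas: "Z \<in> \<rho> \<rightarrow>\<^sub>M bep_space"
    unfolding bep_space_def
  proof (rule measurable_restrict_space2)
    show "Z \<in> borel_measurable \<rho>"
      unfolding Z_def by (intro measurable_coordinatewise_then_product) measurable
  qed (use Z_orthant in auto)
  have \<Xi>: "\<Xi> \<in> space (prob_algebra bep_space)"
    unfolding \<Xi>_def space_prob_algebra using \<rho>.prob_space_distr[OF Z_meas] by simp
  have "measure (poisson_mixture \<Xi>) {\<eta>} = m \<eta>" for \<eta>
  proof -
    have "measure (poisson_mixture \<Xi>) {\<eta>} = (\<integral>\<zeta>. poisson_density \<zeta> \<eta> \<partial>\<Xi>)"
      by (rule measure_mixture[OF \<Xi>])
    also have "\<dots> = (\<integral>t. poisson_density (Z t) \<eta> \<partial>\<rho>)"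
      unfolding \<Xi>_def
      by (intro integral_distr[OF Z_meas] continuous_bep_measurable continuous_on_subset[OF poisson_density_continuous]) auto
    also have "\<dots> = m \<eta>"
      unfolding m_def
    proof (rule integral_cong_AE)
      show "(\<lambda>t. poisson_density (Z t) \<eta>) \<in> borel_measurable \<rho>"
        by (rule measurable_compose[OF Z_meas])
           (intro continuous_bep_measurable continuous_on_subset[OF poisson_density_continuous] subset_UNIV)
      show "AE t in \<rho>. poisson_density (Z t) \<eta> = \<Phi> \<eta> (\<lambda>i. schoenberg i t)"
        using AE_G by eventually_elim (simp add: \<Phi>_G)
    qed measurable
    finally show ?thesis .
  qed
  then show thesis
    using that[OF r(1) \<Xi>] m_lim by simp
qed

section \<open>Stationary measures\<close>

context boundary_driven_sip
begin

context
  fixes S :: "real \<Rightarrow> ('v \<Rightarrow> nat) \<Rightarrow> ('v \<Rightarrow> nat) measure"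
    and K :: "real \<Rightarrow> ('v \<Rightarrow> real) \<Rightarrow> ('v \<Rightarrow> real) measure"
  assumes S: "sip_semigroup s p c \<alpha> \<gamma> S" and K: "bep_semigroup s p c \<alpha> \<gamma> K"
begin

interpretation jump_semigroup sip_rate sip_jump particles boundary_rate S
  by unfold_locales (use S in \<open>simp add: sip_semigroup_def gen_sip\<close>)

text \<open>The pointwise intertwining integrated over \<open>\<Xi>\<close>, by associativity of
  \<open>bind\<close>; it lets invariance be transported in both directions.\<close>

lemma mixture_bind:
  assumes \<Xi>: "\<Xi> \<in> space (prob_algebra bep_space)" and t: "0 \<le> t"
  shows "\<Xi> \<bind> K t \<in> space (prob_algebra bep_space)"
    and "poisson_mixture (\<Xi> \<bind> K t) = poisson_mixture \<Xi> \<bind> S t"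
proof -
  have sp: "space \<Xi> = orthant"
    using \<Xi> sets_eq_imp_space_eq[of \<Xi> bep_space] by (simp add: space_prob_algebra space_bep_space)
  have k: "K t \<in> \<Xi> \<rightarrow>\<^sub>M subprob_algebra bep_space" "poisson_product \<in> \<Xi> \<rightarrow>\<^sub>M subprob_algebra (count_space UNIV)"
    using measurable_prob_algebraD[OF bep_kernel[OF K t]] measurable_prob_algebraD[OF poisson_product_kernel] \<Xi>
    by (simp_all cong: measurable_cong_sets add: space_prob_algebra)
  show "\<Xi> \<bind> K t \<in> space (prob_algebra bep_space)"
    using prob_space_bind'[OF \<Xi> bep_kernel[OF K t]] sets_bind'[OF \<Xi> bep_kernel[OF K t]]
    by (simp add: space_prob_algebra)
  have "poisson_mixture (\<Xi> \<bind> K t) = \<Xi> \<bind> (\<lambda>\<zeta>. poisson_mixture (K t \<zeta>))"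
    unfolding poisson_mixture_def
    by (rule bind_assoc[OF k(1) measurable_prob_algebraD[OF poisson_product_kernel]])
  also have "\<dots> = \<Xi> \<bind> (\<lambda>\<zeta>. poisson_product \<zeta> \<bind> S t)"
    by (rule bind_cong[OF refl]) (simp add: sp semigroup_intertwining[OF S K _ t])
  also have "\<dots> = poisson_mixture \<Xi> \<bind> S t"
    unfolding poisson_mixture_def
    by (rule bind_assoc[OF k(2) kernel_subprob[OF t], symmetric]) simp
  finally show "poisson_mixture (\<Xi> \<bind> K t) = poisson_mixture \<Xi> \<bind> S t" .
qed

lemma stationary_sip_D:
  assumes "stationary_measure sip_space S \<mu>"
  shows "prob_space \<mu>" "sets \<mu> = UNIV" "0 \<le> t \<Longrightarrow> \<mu> \<bind> S t = \<mu>"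
  using assms by (auto simp: stationary_measure_def space_prob_algebra)

lemma stationary_mixture:
  assumes "stationary_measure bep_space K \<Xi>"
  shows "stationary_measure sip_space S (poisson_mixture \<Xi>)"
proof -
  have \<Xi>: "\<Xi> \<in> space (prob_algebra bep_space)" "\<And>t. 0 \<le> t \<Longrightarrow> \<Xi> \<bind> K t = \<Xi>"
    using assms by (auto simp: stationary_measure_def)
  show ?thesis
    using mixture_bind(2)[OF \<Xi>(1)] \<Xi> prob_space_mixture[OF \<Xi>(1)] sets_mixture[OF \<Xi>(1)]
    by (auto simp: stationary_measure_def space_prob_algebra)
qed

lemma stationary_sip_unique:
  assumes "stationary_measure sip_space S \<mu>" "stationary_measure sip_space S \<nu>"
  shows "\<mu> = \<nu>"
  by (rule invariant_unique[OF reach_empty])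
     (use stationary_sip_D[OF assms(1)] stationary_sip_D[OF assms(2)] in auto)

lemma stationary_bep_unique:
  assumes "stationary_measure bep_space K \<Xi>" "stationary_measure bep_space K \<Theta>"
  shows "\<Xi> = \<Theta>"
  using assms stationary_sip_unique[OF stationary_mixture stationary_mixture, OF assms]
  by (intro poisson_mixture_inj) (auto simp: stationary_measure_def)

text \<open>A finite average over integer times, so that no measurability of \<open>K\<close> in
  time is involved. The start at 0 corresponds to the empty configuration, where the Lyapunov
  function vanishes.\<close>

definition empirical_law :: "nat \<Rightarrow> ('v \<Rightarrow> real) measure" where
  "empirical_law n = measure_pmf (pmf_of_set {..n}) \<bind> (\<lambda>k. K (real k) (\<lambda>_. 0))"

lemma zero_orthant: "(\<lambda>_. 0) \<in> orthant"
  by (simp add: orthant_def)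

lemma poisson_product_0: "poisson_product (\<lambda>_ :: 'v. 0) = return (count_space UNIV) (\<lambda>_. 0)"
proof -
  have "poisson_product (\<lambda>_ :: 'v. 0) = measure_pmf (return_pmf (\<lambda>_ :: 'v. 0 :: nat))"
    by (simp add: poisson_product_def poisson_def)
  then show ?thesis
    by (simp add: return_pmf.rep_eq)
qed

lemma mixture_K_0: "0 \<le> t \<Longrightarrow> poisson_mixture (K t (\<lambda>_. 0)) = S t (\<lambda>_. 0)"
  using semigroup_intertwining[OF S K zero_orthant, of t]
    bind_return[OF kernel_subprob[of t "count_space UNIV"], of "\<lambda>_. 0"]
  by (simp add: poisson_product_0)

lemma
  shows empirical_law_space: "empirical_law n \<in> space (prob_algebra bep_space)"
    and measure_empirical_mixture: "measure (poisson_mixture (empirical_law n)) {\<eta>}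
      = (\<Sum>k\<le>n. measure (S (real k) (\<lambda>_. 0)) {\<eta>}) / real (Suc n)"
proof -
  let ?P = "measure_pmf (pmf_of_set {..n})"
  have P: "?P \<in> space (prob_algebra (count_space UNIV))"
    by (simp add: space_prob_algebra measure_pmf.prob_space_axioms)
  have k: "(\<lambda>k. K (real k) (\<lambda>_. 0)) \<in> count_space UNIV \<rightarrow>\<^sub>M prob_algebra bep_space"
    using bep_kernel_space[OF K _ zero_orthant] by auto
  then have k': "(\<lambda>k. K (real k) (\<lambda>_. 0)) \<in> ?P \<rightarrow>\<^sub>M subprob_algebra bep_space"
    using measurable_prob_algebraD[OF k] by (simp cong: measurable_cong_sets)
  show e: "empirical_law n \<in> space (prob_algebra bep_space)"
    unfolding empirical_law_def using prob_space_bind'[OF P k] sets_bind'[OF P k]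
    by (simp add: space_prob_algebra)
  have "poisson_mixture (empirical_law n) = ?P \<bind> (\<lambda>k. poisson_mixture (K (real k) (\<lambda>_. 0)))"
    unfolding poisson_mixture_def empirical_law_def
    by (rule bind_assoc[OF k' measurable_prob_algebraD[OF poisson_product_kernel]])
  also have "(\<lambda>k. poisson_mixture (K (real k) (\<lambda>_. 0))) = (\<lambda>k. S (real k) (\<lambda>_. 0))"
    by (simp add: mixture_K_0)
  finally have m: "poisson_mixture (empirical_law n) = ?P \<bind> (\<lambda>k. S (real k) (\<lambda>_. 0))" .
  have "(\<lambda>k. S (real k) (\<lambda>_. 0)) \<in> ?P \<rightarrow>\<^sub>M subprob_algebra (count_space UNIV)"
    by (auto simp: space_subprob_algebra prob sets intro: prob_space_imp_subprob_space)
  then have "measure (poisson_mixture (empirical_law n)) {\<eta>} = (\<integral>k. measure (S (real k) (\<lambda>_. 0)) {\<eta>} \<partial>?P)"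
    unfolding m by (intro subprob_space.measure_bind prob_space_imp_subprob_space measure_pmf.prob_space_axioms) auto
  also have "\<dots> = (\<Sum>k\<le>n. measure (S (real k) (\<lambda>_. 0)) {\<eta>}) / real (Suc n)"
    by (subst integral_pmf_of_set) auto
  finally show "measure (poisson_mixture (empirical_law n)) {\<eta>} = (\<Sum>k\<le>n. measure (S (real k) (\<lambda>_. 0)) {\<eta>}) / real (Suc n)" .
qed

lemma empirical_mixture_tight:
  obtains B where "\<And>n N. 1 - B / real (Suc N) \<le> measure (poisson_mixture (empirical_law n)) {\<eta>. particles \<eta> \<le> N}"
proof -
  obtain B where B: "\<And>N k. (\<integral>\<eta>. min (real N) (real (particles \<eta>)) \<partial>S (real k) (\<lambda>_. 0)) \<le> B"
    using expected_particles_bound[OF S] by blast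
  have one: "1 - B / real (Suc N) \<le> measure (S (real k) (\<lambda>_. 0)) {\<eta>. particles \<eta> \<le> N}" for k N
  proof -
    interpret prob_space "S (real k) (\<lambda>_. 0)"
      by (rule prob) simp
    \<comment> \<open>Markov's inequality with the truncated particle number, the only form in which
      the expectation has been bounded.\<close>
    have "real (Suc N) * measure (S (real k) (\<lambda>_. 0)) {\<eta>. N < particles \<eta>}
        = (\<integral>\<eta>. real (Suc N) * indicator {\<eta>. N < particles \<eta>} \<eta> \<partial>S (real k) (\<lambda>_. 0))"
      by (simp add: sets)
    also have "\<dots> \<le> (\<integral>\<eta>. min (real (Suc N)) (real (particles \<eta>)) \<partial>S (real k) (\<lambda>_. 0))"
      by (intro integral_mono integrable_bounded[where B = "real (Suc N)"]) (auto simp: indicator_def)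
    also have "\<dots> \<le> B"
      by (rule B)
    finally have "measure (S (real k) (\<lambda>_. 0)) {\<eta>. N < particles \<eta>} \<le> B / real (Suc N)"
      by (simp add: le_divide_eq mult.commute)
    moreover have "measure (S (real k) (\<lambda>_. 0)) {\<eta>. N < particles \<eta>} = 1 - measure (S (real k) (\<lambda>_. 0)) {\<eta>. particles \<eta> \<le> N}"
      by (subst prob_compl[symmetric]) (auto simp: sets sets_eq_imp_space_eq[of _ "count_space UNIV"] intro!: arg_cong[where f = "measure _"])
    ultimately show ?thesis
      by simp
  qed
  have "1 - B / real (Suc N) \<le> measure (poisson_mixture (empirical_law n)) {\<eta>. particles \<eta> \<le> N}" for n N
  proof -
    have fin: "measure M {\<eta>. particles \<eta> \<le> N} = (\<Sum>\<eta> | particles \<eta> \<le> N. measure M {\<eta>})"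
      if "prob_space M" "sets M = UNIV" for M
      using that finite_level[of N]
      by (intro finite_measure.finite_measure_eq_sum_singleton prob_space.finite_measure) auto
    have "real (Suc n) * (1 - B / real (Suc N)) = (\<Sum>k\<le>n. 1 - B / real (Suc N))"
      by simp
    also have "\<dots> \<le> (\<Sum>k\<le>n. measure (S (real k) (\<lambda>_. 0)) {\<eta>. particles \<eta> \<le> N})"
      by (intro sum_mono one)
    also have "\<dots> = (\<Sum>k\<le>n. \<Sum>\<eta> | particles \<eta> \<le> N. measure (S (real k) (\<lambda>_. 0)) {\<eta>})"
      by (intro sum.cong refl fin prob sets) auto
    also have "\<dots> = (\<Sum>\<eta> | particles \<eta> \<le> N. \<Sum>k\<le>n. measure (S (real k) (\<lambda>_. 0)) {\<eta>})"
      by (rule sum.swap)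
    also have "\<dots> = real (Suc n) * measure (poisson_mixture (empirical_law n)) {\<eta>. particles \<eta> \<le> N}"
      unfolding fin[OF prob_space_mixture[OF empirical_law_space] sets_mixture[OF empirical_law_space]]
      unfolding measure_empirical_mixture sum_divide_distrib[symmetric] by simp
    finally show ?thesis
      by (simp only: mult_le_cancel_left_pos of_nat_0_less_iff zero_less_Suc)
  qed
  then show thesis
    by (rule that)
qed

text \<open>One application of \<open>S 1\<close> shifts the average by one time step, and
  telescoping leaves an error of at most \<open>1 / (n + 1)\<close>. The sum is restricted to a
  finite \<open>F\<close> so that the limit in \<open>n\<close> can be taken termwise.\<close>

lemma empirical_mixture_almost_invariant:
  assumes F: "finite F"
  shows "(\<Sum>\<xi>\<in>F. measure (poisson_mixture (empirical_law n)) {\<xi>} * measure (S 1 \<xi>) {\<eta>})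
    \<le> measure (poisson_mixture (empirical_law n)) {\<eta>} + 1 / real (Suc n)"
proof -
  let ?m = "\<lambda>k \<eta>. measure (S (real k) (\<lambda>_. 0)) {\<eta>}"
  have step: "(\<Sum>\<xi>\<in>F. ?m k \<xi> * measure (S 1 \<xi>) {\<eta>}) \<le> ?m (Suc k) \<eta>" for k
  proof -
    interpret prob_space "S (real k) (\<lambda>_. 0)"
      by (rule prob) simp
    have le1: "measure (S 1 \<xi>) {\<eta>} \<le> 1" for \<xi>
      by (rule prob_space.prob_le_1[OF prob]) simp
    have "(\<Sum>\<xi>\<in>F. ?m k \<xi> * measure (S 1 \<xi>) {\<eta>})
        = (\<integral>\<xi>. indicator F \<xi> * measure (S 1 \<xi>) {\<eta>} \<partial>S (real k) (\<lambda>_. 0))"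
      using F by (subst integral_finite_support[OF F]) (auto simp: sets prob_space_axioms mult.commute intro!: sum.cong)
    also have "\<dots> \<le> (\<integral>\<xi>. measure (S 1 \<xi>) {\<eta>} \<partial>S (real k) (\<lambda>_. 0))"
      using le1 by (intro integral_mono integrable_bounded[where B = 1]) (auto simp: indicator_def)
    also have "\<dots> = measure (S (real k) (\<lambda>_. 0) \<bind> S 1) {\<eta>}"
      by (rule bind_S(3)[symmetric]) (auto simp: sets prob_space_axioms)
    also have "S (real k) (\<lambda>_. 0) \<bind> S 1 = S (real (Suc k)) (\<lambda>_. 0)"
      using S_add[of "real k" 1 "\<lambda>_. 0"] by (simp add: add.commute)
    finally show ?thesis .
  qed
  have "(\<Sum>\<xi>\<in>F. (\<Sum>k\<le>n. ?m k \<xi>) * measure (S 1 \<xi>) {\<eta>}) = (\<Sum>k\<le>n. \<Sum>\<xi>\<in>F. ?m k \<xi> * measure (S 1 \<xi>) {\<eta>})"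
    unfolding sum_distrib_right by (rule sum.swap)
  also have "\<dots> \<le> (\<Sum>k\<le>n. ?m (Suc k) \<eta>)"
    by (intro sum_mono step)
  also have "\<dots> \<le> (\<Sum>k\<le>n. ?m k \<eta>) + 1"
  proof -
    have "(\<Sum>k\<le>n. ?m (Suc k) \<eta>) + ?m 0 \<eta> = (\<Sum>k\<le>Suc n. ?m k \<eta>)"
      by (subst sum.atMost_Suc_shift) simp
    moreover have "?m (Suc n) \<eta> \<le> 1"
      by (rule prob_space.prob_le_1[OF prob]) simp
    moreover have "0 \<le> ?m 0 \<eta>"
      by simp
    ultimately show ?thesis
      unfolding sum.atMost_Suc by linarith
  qed
  finally have "(\<Sum>\<xi>\<in>F. (\<Sum>k\<le>n. ?m k \<xi>) * measure (S 1 \<xi>) {\<eta>}) / real (Suc n) \<le> ((\<Sum>k\<le>n. ?m k \<eta>) + 1) / real (Suc n)"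
    by (rule divide_right_mono) simp
  then show ?thesis
    unfolding measure_empirical_mixture times_divide_eq_left sum_divide_distrib[symmetric] add_divide_distrib[symmetric] .
qed

lemma stationary_bep_exists: "\<exists>\<Xi>. stationary_measure bep_space K \<Xi>"
proof -
  obtain B where B: "\<And>n N. 1 - B / real (Suc N) \<le> measure (poisson_mixture (empirical_law n)) {\<eta>. particles \<eta> \<le> N}"
    using empirical_mixture_tight by blast
  have "(\<lambda>N. B / real (Suc N)) \<longlonglongrightarrow> 0"
    using LIMSEQ_Suc[OF lim_const_over_n[of B]] by simp
  then obtain r \<Xi> where r: "strict_mono r" and \<Xi>: "\<Xi> \<in> space (prob_algebra bep_space)"
    and lim: "\<And>\<eta>. (\<lambda>n. measure (poisson_mixture (empirical_law (r n))) {\<eta>}) \<longlonglongrightarrow> measure (poisson_mixture \<Xi>) {\<eta>}"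
    using poisson_mixture_limit[where X = empirical_law and F = "\<lambda>N. {\<eta>. particles \<eta> \<le> N}",
        OF empirical_law_space finite_level _ B] by blast
  define M where "M = poisson_mixture \<Xi>"
  have M: "prob_space M" "sets M = UNIV"
    unfolding M_def using prob_space_mixture[OF \<Xi>] sets_mixture[OF \<Xi>] by auto
  have MS: "prob_space (M \<bind> S 1)" "sets (M \<bind> S 1) = UNIV"
    using bind_S[OF M] by auto
  have "(\<lambda>n. 1 / real (Suc (r n))) \<longlonglongrightarrow> 0"
    using LIMSEQ_subseq_LIMSEQ[OF LIMSEQ_Suc[OF lim_1_over_n] r] by (simp add: o_def)
  then have lim': "(\<lambda>n. measure (poisson_mixture (empirical_law (r n))) {\<eta>} + 1 / real (Suc (r n))) \<longlonglongrightarrow> measure M {\<eta>} + 0" for \<eta>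
    unfolding M_def by (intro tendsto_add lim)
  \<comment> \<open>Fatou's lemma by hand: take the limit in \<open>n\<close> for a finite set of
    starting points first, and exhaust the state space afterwards.\<close>
  have part: "(\<Sum>\<xi>\<in>F. measure (S 1 \<xi>) {\<eta>} * measure M {\<xi>}) \<le> measure M {\<eta>}" if F: "finite F" for F \<eta>
  proof -
    have "(\<Sum>\<xi>\<in>F. measure M {\<xi>} * measure (S 1 \<xi>) {\<eta>}) \<le> measure M {\<eta>} + 0"
    proof (rule LIMSEQ_le[OF _ lim'])
      show "(\<lambda>n. \<Sum>\<xi>\<in>F. measure (poisson_mixture (empirical_law (r n))) {\<xi>} * measure (S 1 \<xi>) {\<eta>})
        \<longlonglongrightarrow> (\<Sum>\<xi>\<in>F. measure M {\<xi>} * measure (S 1 \<xi>) {\<eta>})"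
        unfolding M_def by (intro tendsto_sum tendsto_mult lim tendsto_const)
    qed (use empirical_mixture_almost_invariant[OF F] in auto)
    then show ?thesis
      by (simp add: mult.commute)
  qed
  have le: "measure (M \<bind> S 1) {\<eta>} \<le> measure M {\<eta>}" for \<eta>
  proof -
    have "(\<lambda>N. \<Sum>\<xi> | particles \<xi> \<le> N. measure (S 1 \<xi>) {\<eta>} * measure M {\<xi>}) \<longlonglongrightarrow> (\<integral>\<xi>. measure (S 1 \<xi>) {\<eta>} \<partial>M)"
      by (rule integral_level_truncation[OF M finite_level, where B = 1]) (simp add: prob_space.prob_le_1[OF prob])
    then have "(\<integral>\<xi>. measure (S 1 \<xi>) {\<eta>} \<partial>M) \<le> measure M {\<eta>}"
      by (rule LIMSEQ_le_const2) (auto intro: part finite_level)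
    then show ?thesis
      by (simp add: bind_S(3)[OF M])
  qed
  have mass: "(\<integral>\<^sup>+x. emeasure L {x} \<partial>count_space UNIV) = 1" if "prob_space L" "sets L = UNIV" for L :: "('v \<Rightarrow> nat) measure"
    using nn_integral_countable[OF that(2), of "\<lambda>_. 1"] prob_space.emeasure_space_1[OF that(1)] by simp
  \<comment> \<open>Fatou gives only an inequality, but both sides have total mass one, because
    tightness made the limit a probability measure.\<close>
  have "emeasure (M \<bind> S 1) {\<eta>} = emeasure M {\<eta>}" for \<eta>
  proof (rule nn_integral_count_space_eqD[where f = "\<lambda>\<eta>. emeasure (M \<bind> S 1) {\<eta>}" and g = "\<lambda>\<eta>. emeasure M {\<eta>}"])
    show "emeasure (M \<bind> S 1) {\<eta>} \<le> emeasure M {\<eta>}" for \<eta>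
      unfolding finite_measure.emeasure_eq_measure[OF prob_space.finite_measure[OF M(1)]]
        finite_measure.emeasure_eq_measure[OF prob_space.finite_measure[OF MS(1)]]
      by (intro ennreal_leI le)
  qed (simp_all add: mass M MS)
  then have "M \<bind> S 1 = M"
    using M MS by (intro measure_eqI_countable[where A = UNIV]) auto
  then have inv: "M \<bind> S t = M" if "0 \<le> t" for t
    by (intro invariant_all_times[OF reach_empty M _ that])
  \<comment> \<open>The mixtures of \<open>\<Xi> \<bind> K t\<close> and of \<open>\<Xi>\<close>
    agree, so injectivity gives invariance for the BEP.\<close>
  have "\<Xi> \<bind> K t = \<Xi>" if "0 \<le> t" for t
    using mixture_bind[OF \<Xi> that] inv[OF that] unfolding M_def by (intro poisson_mixture_inj \<Xi>) auto
  then show ?thesis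
    using \<Xi> by (auto simp: stationary_measure_def)
qed

end

end

theorem theorem4p1:
  fixes s :: real
    and p :: "'v::finite \<Rightarrow> 'v \<Rightarrow> real"
    and c \<alpha> \<gamma> :: "'v \<Rightarrow> real"
  assumes "s > 0"
    and "\<And>i j. p i j \<ge> 0" and "\<And>i j. p i j = p j i"
    and "\<And>i j. (i, j) \<in> {(k, l). p k l > 0}\<^sup>*"
    and "\<And>i. c i \<ge> 0" and "\<exists>i. c i > 0"
    and "\<And>i. \<alpha> i \<ge> 0" and "\<And>i. \<gamma> i \<ge> 0" and "\<And>i. \<alpha> i < \<gamma> i"
  shows
    "(\<forall>f :: ('v \<Rightarrow> nat) \<Rightarrow> real.
        (\<forall>\<zeta>\<in>orthant. integrable (poisson_product \<zeta>) f) \<longrightarrow>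
        (\<forall>\<zeta>\<in>orthant. integrable (poisson_product \<zeta>) (sip_generator s p c \<alpha> \<gamma> f)) \<and>
        C2_orthant (poisson_intertwiner f) \<and>
        (\<forall>\<zeta>\<in>orthant. poisson_intertwiner (sip_generator s p c \<alpha> \<gamma> f) \<zeta>
                     = bep_generator s p c \<alpha> \<gamma> (poisson_intertwiner f) \<zeta>))
   \<and> (\<forall>S K. sip_semigroup s p c \<alpha> \<gamma> S \<longrightarrow> bep_semigroup s p c \<alpha> \<gamma> K \<longrightarrow>
        (\<forall>\<zeta>\<in>orthant. \<forall>t\<ge>0. poisson_product \<zeta> \<bind> S t = poisson_mixture (K t \<zeta>)) \<and>
        (\<exists>!\<mu>. stationary_measure sip_space S \<mu>) \<and>
        (\<exists>!\<Xi>. stationary_measure bep_space K \<Xi>) \<and>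
        (\<forall>\<mu> \<Xi>. stationary_measure sip_space S \<mu> \<longrightarrow> stationary_measure bep_space K \<Xi> \<longrightarrow>
               \<mu> = poisson_mixture \<Xi>))"
proof (intro conjI allI impI)
  fix f :: "('v \<Rightarrow> nat) \<Rightarrow> real"
  assume "\<forall>\<zeta>\<in>orthant. integrable (poisson_product \<zeta>) f"
  then have f: "poisson_integrable f"
    by (simp add: poisson_integrable_def)
  show "\<forall>\<zeta>\<in>orthant. integrable (poisson_product \<zeta>) (sip_generator s p c \<alpha> \<gamma> f)"
    using poisson_integrable_sip_generator[OF f] by (simp add: poisson_integrable_def)
  show "C2_orthant (poisson_intertwiner f)"
    by (rule C2_orthant_intertwiner[OF f])
  show "\<forall>\<zeta>\<in>orthant. poisson_intertwiner (sip_generator s p c \<alpha> \<gamma> f) \<zeta>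
      = bep_generator s p c \<alpha> \<gamma> (poisson_intertwiner f) \<zeta>"
    using intertwiner_sip_generator[OF f] by blast
next
  interpret boundary_driven_sip s p c \<alpha> \<gamma>
    by unfold_locales (fact assms)+
  fix S :: "real \<Rightarrow> ('v \<Rightarrow> nat) \<Rightarrow> ('v \<Rightarrow> nat) measure"
    and K :: "real \<Rightarrow> ('v \<Rightarrow> real) \<Rightarrow> ('v \<Rightarrow> real) measure"
  assume S: "sip_semigroup s p c \<alpha> \<gamma> S" and K: "bep_semigroup s p c \<alpha> \<gamma> K"
  show "\<forall>\<zeta>\<in>orthant. \<forall>t\<ge>0. poisson_product \<zeta> \<bind> S t = poisson_mixture (K t \<zeta>)"
    using semigroup_intertwining[OF S K] by blast
  obtain \<Theta> where \<Theta>: "stationary_measure bep_space K \<Theta>"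
    using stationary_bep_exists[OF S K] by blast
  note mixture = stationary_mixture[OF S K]
  note sip_unique = stationary_sip_unique[OF S K]
  show "\<exists>!\<mu>. stationary_measure sip_space S \<mu>"
    using mixture[OF \<Theta>] sip_unique by blast
  show "\<exists>!\<Xi>. stationary_measure bep_space K \<Xi>"
    using \<Theta> stationary_bep_unique[OF S K] by blast
  show "\<mu> = poisson_mixture \<Xi>"
    if "stationary_measure sip_space S \<mu>" "stationary_measure bep_space K \<Xi>" for \<mu> \<Xi>
    by (rule sip_unique[OF that(1) mixture[OF that(2)]])
qed

end
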